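(* Let $H$ and $K$ be two complex Hilbert spaces with $\dim H\ge 3$, and let $\Phi:\mathcal{B}(H)\to\mathcal{B}(K)$ be a bijective map (not assumed linear or continuous). Then $\Phi$ satisfies $$\mathcal{M}(\Phi(A)\circ\Phi(B))=\Phi(\mathcal{M}(A\circ B))\quad\text{for all } A,B\in\mathcal{B}(H)$$ if and only if there exists a unitary or anti-unitary operator $U:H\to K$ such that $\Phi(T)=UTU^*$ for every $T\in\mathcal{B}(H)$.
   Context: $\mathcal{B}(H)$ denotes the algebra of all bounded linear operators on $H$. The Jordan product is $A\circ B=\frac12(AB+BA)$. For $T\in\mathcal{B}(H)$, $|T|=(T^*T)^{1/2}$ and $T=V|T|$ is the polar decomposition, where $V$ is the unique partial isometry with this property and $\mathcal{N}(V)=\mathcal{N}(T)$ (null spaces). The mean transform of $T$ is $\mathcal{M}(T)=\frac12(V|T|+|T|V)$. The same notation is used on $K$. A unitary operator $U:H\to K$ is a surjective linear isometry; an anti-unitary operator is a surjective conjugate-linear isometry, and in both cases $U^*=U^{-1}$. *)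

theory Defs
  imports "HOL-Analysis.Analysis" "HOL-Library.Extended_Nat"
begin

text \<open>
  Complex Hilbert spaces, built on top of the library's real Banach spaces so that \<open>norm\<close>,
  completeness and \<^const>\<open>bounded_linear\<close> are the library's. The inner product is linear in its
  first argument. Axiom \<open>cinner_self\<close> contains positive definiteness and says that the norm is the
  one induced by the inner product.
\<close>

class complex_hilbert = banach +
  fixes scaleC :: "complex \<Rightarrow> 'a \<Rightarrow> 'a"  (infixr "*\<^sub>C" 75)
    and cinner :: "'a \<Rightarrow> 'a \<Rightarrow> complex"
  assumes scaleC_add_right: "c *\<^sub>C (x + y) = c *\<^sub>C x + c *\<^sub>C y"
    and scaleC_add_left: "(c + d) *\<^sub>C x = c *\<^sub>C x + d *\<^sub>C x"
    and scaleC_scaleC: "c *\<^sub>C d *\<^sub>C x = (c * d) *\<^sub>C x"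
    and scaleC_one: "1 *\<^sub>C x = x"
    and scaleR_scaleC: "r *\<^sub>R x = complex_of_real r *\<^sub>C x"
    and cinner_commute: "cinner x y = cnj (cinner y x)"
    and cinner_add_left: "cinner (x + y) z = cinner x z + cinner y z"
    and cinner_scaleC_left: "cinner (c *\<^sub>C x) y = c * cinner x y"
    and cinner_self: "cinner x x = complex_of_real ((norm x)\<^sup>2)"

interpretation complex_vector: vector_space "scaleC :: complex \<Rightarrow> 'a \<Rightarrow> 'a::complex_hilbert"
  by unfold_locales (simp_all add: scaleC_add_right scaleC_add_left scaleC_scaleC scaleC_one)

text \<open>
  The library's \<^const>\<open>vector_space.dim\<close> is 0 on spaces without a finite basis, hence the case
  distinction.
\<close>

definition cdim :: "'a::complex_hilbert itself \<Rightarrow> enat" where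
  "cdim _ =
     (if \<exists>S::'a set. finite S \<and> complex_vector.span S = UNIV
      then enat (complex_vector.dim (UNIV :: 'a set)) else \<infinity>)"

definition bounded_ops :: "('a::complex_hilbert \<Rightarrow> 'a) set" where
  "bounded_ops = {T. bounded_linear T \<and> (\<forall>c x. T (c *\<^sub>C x) = c *\<^sub>C T x)}"

definition cadjoint :: "('a::complex_hilbert \<Rightarrow> 'a) \<Rightarrow> 'a \<Rightarrow> 'a" where
  "cadjoint T = (THE S. S \<in> bounded_ops \<and> (\<forall>x y. cinner (T x) y = cinner x (S y)))"

definition positive_op :: "('a::complex_hilbert \<Rightarrow> 'a) \<Rightarrow> bool" where
  "positive_op P \<longleftrightarrow> P \<in> bounded_ops \<and> (\<forall>x. cinner (P x) x \<in> \<real> \<and> 0 \<le> Re (cinner (P x) x))"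

definition sqrt_op :: "('a::complex_hilbert \<Rightarrow> 'a) \<Rightarrow> 'a \<Rightarrow> 'a" where
  "sqrt_op S = (THE P. positive_op P \<and> P \<circ> P = S)"

definition abs_op :: "('a::complex_hilbert \<Rightarrow> 'a) \<Rightarrow> 'a \<Rightarrow> 'a" where
  "abs_op T = sqrt_op (cadjoint T \<circ> T)"

definition null_space :: "('a::complex_hilbert \<Rightarrow> 'a) \<Rightarrow> 'a set" where
  "null_space T = {x. T x = 0}"

definition partial_isometry :: "('a::complex_hilbert \<Rightarrow> 'a) \<Rightarrow> bool" where
  "partial_isometry V \<longleftrightarrow>
     V \<in> bounded_ops \<and> (\<forall>x. (\<forall>y \<in> null_space V. cinner x y = 0) \<longrightarrow> norm (V x) = norm x)"

definition polar_isometry :: "('a::complex_hilbert \<Rightarrow> 'a) \<Rightarrow> 'a \<Rightarrow> 'a" where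
  "polar_isometry T =
     (THE V. partial_isometry V \<and> T = V \<circ> abs_op T \<and> null_space V = null_space T)"

definition jordan_product ::
    "('a::complex_hilbert \<Rightarrow> 'a) \<Rightarrow> ('a \<Rightarrow> 'a) \<Rightarrow> 'a \<Rightarrow> 'a"  (infixl "\<bullet>\<^sub>J" 70) where
  "A \<bullet>\<^sub>J B = (\<lambda>x. (1/2) *\<^sub>C (A (B x) + B (A x)))"

definition mean_transform :: "('a::complex_hilbert \<Rightarrow> 'a) \<Rightarrow> 'a \<Rightarrow> 'a" where
  "mean_transform T =
     (\<lambda>x. (1/2) *\<^sub>C (polar_isometry T (abs_op T x) + abs_op T (polar_isometry T x)))"

definition unitary_op :: "('a::complex_hilbert \<Rightarrow> 'b::complex_hilbert) \<Rightarrow> bool" where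
  "unitary_op U \<longleftrightarrow>
     (\<forall>x y. U (x + y) = U x + U y) \<and> (\<forall>c x. U (c *\<^sub>C x) = c *\<^sub>C U x) \<and>
     (\<forall>x. norm (U x) = norm x) \<and> surj U"

definition antiunitary_op :: "('a::complex_hilbert \<Rightarrow> 'b::complex_hilbert) \<Rightarrow> bool" where
  "antiunitary_op U \<longleftrightarrow>
     (\<forall>x y. U (x + y) = U x + U y) \<and> (\<forall>c x. U (c *\<^sub>C x) = cnj c *\<^sub>C U x) \<and>
     (\<forall>x. norm (U x) = norm x) \<and> surj U"

text \<open>
  For a unitary or anti-unitary \<open>U\<close>, the adjoint \<open>U\<^sup>*\<close> is the inverse map, so \<open>U T U\<^sup>*\<close> is written
  with \<^const>\<open>inv\<close>. Lemmas \<open>unitary_adjoint_inv\<close> and \<open>antiunitary_adjoint_inv\<close> below confirm this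
  (in the anti-unitary case the adjoint is the one
  of a conjugate-linear map).
\<close>

lemma cinner_add_right: "cinner x (y + z) = cinner x y + cinner (x::'a::complex_hilbert) z"
  by (simp add: cinner_commute[of x] cinner_add_left)

lemma cinner_scaleC_right: "cinner x (c *\<^sub>C y) = cnj c * cinner (x::'a::complex_hilbert) y"
  by (simp add: cinner_commute[of x] cinner_scaleC_left)

lemma Re_cinner_norm:
  "(norm (x + y))\<^sup>2 = (norm x)\<^sup>2 + (norm y)\<^sup>2 + 2 * Re (cinner x (y::'a::complex_hilbert))"
proof -
  have "cinner (x + y) (x + y) = cinner x x + cinner y y + (cinner x y + cnj (cinner x y))"
    by (simp add: cinner_add_left cinner_add_right cinner_commute[of y x])
  then have "Re (cinner (x + y) (x + y)) = Re (cinner x x) + Re (cinner y y) + 2 * Re (cinner x y)"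
    by simp
  then show ?thesis by (simp add: cinner_self)
qed

lemma unitary_cinner:
  assumes "unitary_op U" shows "cinner (U x) (U y) = cinner x y"
proof -
  have Re: "Re (cinner (U a) (U b)) = Re (cinner a b)" for a b
  proof -
    have "norm (U a + U b) = norm (a + b)" "norm (U a) = norm a" "norm (U b) = norm b"
      using assms unfolding unitary_op_def by metis+
    then show ?thesis using Re_cinner_norm[of "U a" "U b"] Re_cinner_norm[of a b] by simp
  qed
  have "Im (cinner (U x) (U y)) = Im (cinner x y)"
    using Re[of x "\<i> *\<^sub>C y"] assms by (simp add: unitary_op_def cinner_scaleC_right)
  with Re show ?thesis by (simp add: complex_eq_iff)
qed

lemma antiunitary_cinner:
  assumes "antiunitary_op U" shows "cinner (U x) (U y) = cnj (cinner x y)"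
proof -
  have Re: "Re (cinner (U a) (U b)) = Re (cinner a b)" for a b
  proof -
    have "norm (U a + U b) = norm (a + b)" "norm (U a) = norm a" "norm (U b) = norm b"
      using assms unfolding antiunitary_op_def by metis+
    then show ?thesis using Re_cinner_norm[of "U a" "U b"] Re_cinner_norm[of a b] by simp
  qed
  have "Im (cinner (U x) (U y)) = - Im (cinner x y)"
  proof -
    have "U (\<i> *\<^sub>C y) = cnj \<i> *\<^sub>C U y" using assms unfolding antiunitary_op_def by blast
    then have "cinner (U x) (U (\<i> *\<^sub>C y)) = \<i> * cinner (U x) (U y)"
      by (simp only: cinner_scaleC_right complex_cnj_cnj)
    then show ?thesis using Re[of x "\<i> *\<^sub>C y"] by (simp add: cinner_scaleC_right)
  qed
  with Re show ?thesis by (simp add: complex_eq_iff)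
qed

lemma unitary_adjoint_inv:
  "unitary_op U \<Longrightarrow> cinner (U x) y = cinner x (inv U y)"
  using unitary_cinner[of U x "inv U y"] by (simp add: unitary_op_def surj_f_inv_f)

lemma antiunitary_adjoint_inv:
  "antiunitary_op U \<Longrightarrow> cinner (U x) y = cnj (cinner x (inv U y))"
  using antiunitary_cinner[of U x "inv U y"] by (simp add: antiunitary_op_def surj_f_inv_f)

end

theory Submission
  imports Defs
begin

text \<open>
  In the comments, \<open>M\<close> is the mean transform, \<open>\<circ>\<close> the Jordan product, and \<open>x \<otimes> y\<close> the operator
  \<open>z \<mapsto> \<langle>z, y\<rangle>x\<close>.

  Conjugation by a unitary or anti-unitary operator preserves the Jordan product and, by uniqueness,
  the polar decomposition (\<open>mean_conj_by\<close>); this is the easy direction. For the converse, the map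
  \<open>\<Phi>\<close> is recovered step by step from what the identity says about simple operators.

  Projections. The equation \<open>A = M(A\<^sup>2)\<close> holds exactly for the orthogonal projections
  (\<open>mean_square_fixed_projection\<close>), so \<open>\<Phi>\<close> maps projections onto projections. It preserves their order and
  orthogonality, because \<open>M\<close> is the identity on self-adjoint operators and vanishes only at 0. In
  particular \<open>\<Phi>(I) = I\<close>, hence \<open>\<Phi>\<close> commutes with \<open>M\<close>, and projections of rank one go to projections
  of rank one.

  Transition probabilities. Although \<open>M\<close> is far from injective, \<open>M(T) = a \<otimes> b\<close> determines \<open>T\<close>
  (\<open>mean_eq_rank_one_imp\<close>). Therefore \<open>\<Phi>\<close> carries reducing eigenvectors to reducing eigenvectors, and
  acts on eigenvalues by an injective multiplicative function \<open>f\<close> on the complex numbers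
  (\<open>reducing_image\<close>). The Jordan product of two projections of rank one has the nonzero
  eigenvalues \<open>c(c \<plusminus> 1)/2\<close>, where \<open>c\<close> is the modulus of the inner product of the unit vectors
  spanning their ranges. This forces \<open>f\<close> to map the unit interval to itself, so \<open>f\<close> is a power function
  there; the angle of 45 degrees gives a fixed point, so \<open>f\<close> is the identity on nonnegative reals and
  transition probabilities are preserved. By Wigner's theorem (\<open>wigner\<close>), \<open>\<Phi>\<close> agrees on projections
  of rank one with the conjugation by some unitary or anti-unitary \<open>U\<close>.

  Normalisation. Composing with the inverse conjugation one may assume that \<open>\<Phi>\<close> fixes all
  projections of rank one. It remains to exclude maps that look like a transposition. On self-adjoint
  operators these cannot be told apart from the identity, but \<open>M(x \<otimes> y)\<close> is again of the form
  \<open>x' \<otimes> y\<close>, so \<open>M\<close> distinguishes the two factors. This gives that \<open>\<Phi>\<close> fixes all operators of rank one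
  (\<open>rank_one_fixed\<close>) and that \<open>f\<close> is the identity.

  All operators. \<open>M\<close> preserves the trace of operators of finite rank, and \<open>A \<circ> (x \<otimes> y)\<close> has
  trace \<open>\<langle>Ax, y\<rangle>\<close>. Hence \<open>\<langle>\<Phi>(A)x, y\<rangle> = \<langle>Ax, y\<rangle>\<close> whenever \<open>\<Phi>\<close> is known to fix \<open>A \<circ> (x \<otimes> y)\<close> or its
  mean transform. It fixes this operator when the latter is diagonalizable, which is the case for \<open>y\<close> in
  general position provided that \<open>A\<^sup>2x \<noteq> 0\<close> and \<open>x\<close> is not an eigenvector of \<open>A\<close>. Eigenvectors and operators
  of square zero are treated separately.
\<close>

section \<open>Geometry of complex Hilbert spaces\<close>

lemma cinner_zero [simp]: "cinner 0 x = 0" "cinner x 0 = 0"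
  for x :: "'a::complex_hilbert"
  using cinner_add_left[of 0 0 x] cinner_add_right[of x 0 0] by simp_all

lemma cinner_minus [simp]: "cinner (- x) y = - cinner x y" "cinner x (- y) = - cinner x y"
  for x :: "'a::complex_hilbert"
  using cinner_add_left[of x "- x" y] cinner_add_right[of x y "- y"]
  by (simp_all add: eq_neg_iff_add_eq_0 add.commute)

lemma cinner_diff_left: "cinner (x - y) z = cinner x z - cinner y z"
  and cinner_diff_right: "cinner z (x - y) = cinner z x - cinner z y"
  for x :: "'a::complex_hilbert"
  using cinner_add_left[of x "- y" z] cinner_add_right[of z x "- y"] by simp_all

lemma cinner_scaleR: "cinner (r *\<^sub>R x) y = of_real r * cinner x y"
  "cinner x (r *\<^sub>R y) = of_real r * cinner x y"
  for x :: "'a::complex_hilbert"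
  by (simp_all add: scaleR_scaleC cinner_scaleC_left cinner_scaleC_right)

lemma cinner_sum: "cinner (sum f I) y = (\<Sum>i\<in>I. cinner (f i) y)"
  "cinner y (sum f I) = (\<Sum>i\<in>I. cinner y (f i))"
  for y :: "'a::complex_hilbert"
  by (induction I rule: infinite_finite_induct) (simp_all add: cinner_add_left cinner_add_right)

lemmas cinner_simps = cinner_add_left cinner_add_right cinner_diff_left cinner_diff_right
  cinner_scaleC_left cinner_scaleC_right cinner_scaleR cinner_sum

lemma cinner_self_eq_0 [simp]: "cinner x x = 0 \<longleftrightarrow> x = 0" for x :: "'a::complex_hilbert"
  by (simp add: cinner_self)

lemma cinner_ext: "(\<And>z. cinner x z = cinner y z) \<Longrightarrow> x = y" for x :: "'a::complex_hilbert"
  using cinner_self_eq_0[of "x - y"] by (simp add: cinner_diff_left del: cinner_self_eq_0)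

lemma cinner_ext': "(\<And>z. cinner z x = cinner z y) \<Longrightarrow> x = y" for x :: "'a::complex_hilbert"
  using cinner_self_eq_0[of "x - y"] by (simp add: cinner_diff_right del: cinner_self_eq_0)

lemma cinner_0_commute: "cinner x y = 0 \<longleftrightarrow> cinner y x = 0" for x :: "'a::complex_hilbert"
  by (metis cinner_commute complex_cnj_zero)

lemma norm_scaleC [simp]: "norm (c *\<^sub>C x) = cmod c * norm x" for x :: "'a::complex_hilbert"
proof -
  have "complex_of_real ((norm (c *\<^sub>C x))\<^sup>2) = c * cnj c * cinner x x"
    unfolding cinner_self[symmetric] by (simp add: cinner_simps)
  also have "\<dots> = complex_of_real ((cmod c * norm x)\<^sup>2)"
    by (simp add: cinner_self power_mult_distrib complex_norm_square[symmetric])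
  finally have "complex_of_real ((norm (c *\<^sub>C x))\<^sup>2) = complex_of_real ((cmod c * norm x)\<^sup>2)" .
  then have "(norm (c *\<^sub>C x))\<^sup>2 = (cmod c * norm x)\<^sup>2"
    using of_real_eq_iff by blast
  then show ?thesis by (simp add: power2_eq_iff_nonneg)
qed

lemma norm_diff_cinner:
  "(norm (x - y))\<^sup>2 = (norm x)\<^sup>2 + (norm y)\<^sup>2 - 2 * Re (cinner x (y::'a::complex_hilbert))"
  using Re_cinner_norm[of x "- y"] by simp

lemma parallelogram:
  "(norm (x + y))\<^sup>2 + (norm (x - y))\<^sup>2 = 2 * (norm x)\<^sup>2 + 2 * (norm (y::'a::complex_hilbert))\<^sup>2"
  by (simp add: Re_cinner_norm norm_diff_cinner)

lemma component_orthogonal: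
  fixes x y :: "'a::complex_hilbert"
  assumes "y \<noteq> 0"
  shows "cinner (x - (cinner x y / (norm y)\<^sup>2) *\<^sub>C y) y = 0"
  using assms by (simp add: cinner_simps cinner_self)

text \<open>
  Pythagoras for the decomposition of \<open>x\<close> along \<open>y\<close>. It contains the Cauchy--Schwarz inequality
  together with the case of equality.
\<close>

lemma norm_orthogonal_component:
  fixes x y :: "'a::complex_hilbert"
  assumes "y \<noteq> 0"
  shows "(norm x * norm y)\<^sup>2 =
    (norm (x - (cinner x y / (norm y)\<^sup>2) *\<^sub>C y) * norm y)\<^sup>2 + (cmod (cinner x y))\<^sup>2"
proof -
  define z where "z = x - (cinner x y / (norm y)\<^sup>2) *\<^sub>C y"
  have "cinner z ((cinner x y / (norm y)\<^sup>2) *\<^sub>C y) = 0"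
    using component_orthogonal[OF assms, of x] by (simp add: z_def cinner_scaleC_right)
  then have "(norm x)\<^sup>2 = (norm z)\<^sup>2 + (norm ((cinner x y / (norm y)\<^sup>2) *\<^sub>C y))\<^sup>2"
    using Re_cinner_norm[of z "(cinner x y / (norm y)\<^sup>2) *\<^sub>C y"] by (simp add: z_def)
  also have "norm ((cinner x y / (norm y)\<^sup>2) *\<^sub>C y) = cmod (cinner x y) / norm y"
    using assms by (simp add: norm_divide norm_power norm_mult power2_eq_square)
  finally show ?thesis
    using assms unfolding z_def[symmetric] by (simp add: power_mult_distrib power_divide algebra_simps)
qed

lemma cauchy_schwarz: "cmod (cinner x y) \<le> norm x * norm (y::'a::complex_hilbert)"
proof (cases "y = 0")
  case False
  then have "(cmod (cinner x y))\<^sup>2 \<le> (norm x * norm y)\<^sup>2"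
    using norm_orthogonal_component[of y x] by simp
  then show ?thesis by (rule power2_le_imp_le) simp
qed simp

lemma cauchy_schwarz_equality:
  fixes x y :: "'a::complex_hilbert"
  assumes "cmod (cinner x y) = norm x * norm y" "y \<noteq> 0"
  shows "x = (cinner x y / (norm y)\<^sup>2) *\<^sub>C y"
  using norm_orthogonal_component[OF assms(2), of x] assms by simp

lemma Re_cinner_zero_of_quadratic:
  fixes v y :: "'a::complex_hilbert"
  assumes "\<And>t::real. (norm v)\<^sup>2 \<le> (norm (v - t *\<^sub>R y))\<^sup>2"
  shows "Re (cinner v y) = 0"
proof (cases "y = 0")
  case False
  define t where "t = Re (cinner v y) / (norm y)\<^sup>2"
  have "(norm (v - t *\<^sub>R y))\<^sup>2 = (norm v)\<^sup>2 + t\<^sup>2 * (norm y)\<^sup>2 - 2 * (t * Re (cinner v y))"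
    by (simp add: norm_diff_cinner cinner_simps power_mult_distrib)
  then have "2 * (t * Re (cinner v y)) \<le> t\<^sup>2 * (norm y)\<^sup>2"
    using assms[of t] by simp
  moreover have "t\<^sup>2 * (norm y)\<^sup>2 = t * Re (cinner v y)"
    using False by (simp add: t_def power2_eq_square)
  moreover have "t * Re (cinner v y) = (Re (cinner v y) / norm y)\<^sup>2"
    by (simp add: t_def power2_eq_square)
  ultimately have "(Re (cinner v y) / norm y)\<^sup>2 \<le> 0" by simp
  then show ?thesis using False by simp
qed simp

definition csubspace :: "'a::complex_hilbert set \<Rightarrow> bool" where
  "csubspace S \<longleftrightarrow> 0 \<in> S \<and> (\<forall>x\<in>S. \<forall>y\<in>S. x + y \<in> S) \<and> (\<forall>c. \<forall>x\<in>S. c *\<^sub>C x \<in> S)"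

lemma csubspace_scaleR: "csubspace S \<Longrightarrow> x \<in> S \<Longrightarrow> r *\<^sub>R x \<in> S"
  by (simp add: csubspace_def scaleR_scaleC)

text \<open>
  The points of \<open>S\<close> whose squared distance from \<open>x\<close> exceeds the infimum by at most \<open>1/(n + 1)\<close> form a
  nested sequence of closed sets, and the parallelogram law makes their diameters shrink to zero.
\<close>

lemma nearest_point:
  fixes S :: "'a::complex_hilbert set"
  assumes "closed S" "csubspace S"
  shows "\<exists>a\<in>S. \<forall>s\<in>S. norm (x - a) \<le> norm (x - s)"
proof -
  define d where "d = (INF s\<in>S. (norm (x - s))\<^sup>2)"
  have S0: "0 \<in> S" using assms(2) by (simp add: csubspace_def)
  have bdd: "bdd_below ((\<lambda>s. (norm (x - s))\<^sup>2) ` S)" by (rule bdd_belowI[of _ 0]) auto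
  have d_le: "d \<le> (norm (x - s))\<^sup>2" if "s \<in> S" for s
    unfolding d_def by (rule cINF_lower[OF bdd that])
  define N where "N n = {s \<in> S. (norm (x - s))\<^sup>2 \<le> d + 1 / Suc n}" for n
  have diam: "(dist s t)\<^sup>2 \<le> 4 / Suc n" if "s \<in> N n" "t \<in> N n" for s t n
  proof -
    define e where "e = 1 / real (Suc n)"
    have mid: "(1/2) *\<^sub>R (s + t) \<in> S"
      using that assms(2) by (auto simp: N_def csubspace_def intro!: csubspace_scaleR)
    have "(norm ((x - s) + (x - t)))\<^sup>2 = 4 * (norm (x - (1/2) *\<^sub>R (s + t)))\<^sup>2"
    proof -
      have "(x - s) + (x - t) = 2 *\<^sub>R (x - (1/2) *\<^sub>R (s + t))"
        by (simp add: algebra_simps scaleR_2)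
      then have "norm ((x - s) + (x - t)) = 2 * norm (x - (1/2) *\<^sub>R (s + t))"
        by (metis norm_scaleR abs_numeral)
      then show ?thesis by (simp add: power_mult_distrib)
    qed
    then have "(dist s t)\<^sup>2 + 4 * (norm (x - (1/2) *\<^sub>R (s + t)))\<^sup>2
        = 2 * (norm (x - s))\<^sup>2 + 2 * (norm (x - t))\<^sup>2"
      using parallelogram[of "x - s" "x - t"] by (simp add: dist_norm norm_minus_commute)
    moreover have "(norm (x - s))\<^sup>2 \<le> d + e" "(norm (x - t))\<^sup>2 \<le> d + e"
      using that by (auto simp: N_def e_def)
    ultimately have "(dist s t)\<^sup>2 \<le> 4 * e"
      using d_le[OF mid] by linarith
    then show ?thesis by (simp add: e_def)
  qed
  have "\<exists>a. \<Inter>(range N) = {a}"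
  proof (rule decreasing_closed_nest_sing)
    show "closed (N n)" for n
    proof -
      have "N n = S \<inter> {s. (norm (x - s))\<^sup>2 \<le> d + 1 / Suc n}" by (auto simp: N_def)
      then show ?thesis using assms(1)
        by (simp add: closed_Int closed_Collect_le continuous_intros)
    qed
    show "N n \<noteq> {}" for n
    proof -
      have "d < d + 1 / Suc n" by simp
      then obtain s where "s \<in> S" "(norm (x - s))\<^sup>2 < d + 1 / Suc n"
        unfolding d_def using S0 bdd by (subst (asm) cINF_less_iff) auto
      then show ?thesis by (auto simp: N_def)
    qed
    show "N n \<subseteq> N m" if "m \<le> n" for m n
    proof -
      have "1 / real (Suc n) \<le> 1 / real (Suc m)" using that by (simp add: frac_le)
      then show ?thesis unfolding N_def by force
    qed
    show "\<exists>n. \<forall>s\<in>N n. \<forall>t\<in>N n. dist s t < e" if "0 < e" for e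
    proof -
      obtain n where n: "4 / e\<^sup>2 < real (Suc n)"
        using reals_Archimedean2[of "4 / e\<^sup>2"] by (metis lessI less_trans of_nat_less_iff)
      have "(dist s t)\<^sup>2 < e\<^sup>2" if "s \<in> N n" "t \<in> N n" for s t
      proof -
        have "4 / real (Suc n) < e\<^sup>2" using n \<open>0 < e\<close> by (simp add: field_simps)
        then show ?thesis using diam[OF that] by linarith
      qed
      then show ?thesis using \<open>0 < e\<close> by (meson less_imp_le power2_less_imp_less)
    qed
  qed
  then obtain a where a: "\<And>n. a \<in> N n" by blast
  have "(norm (x - a))\<^sup>2 \<le> d"
  proof (rule field_le_epsilon)
    fix e :: real assume "0 < e"
    then obtain n where "1 / Suc n < e" by (rule nat_approx_posE)
    moreover have "(norm (x - a))\<^sup>2 \<le> d + 1 / Suc n" using a[of n] by (simp add: N_def)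
    ultimately show "(norm (x - a))\<^sup>2 \<le> d + e" by linarith
  qed
  then have "norm (x - a) \<le> norm (x - s)" if "s \<in> S" for s
    using d_le[OF that] by (meson norm_ge_zero order_trans power2_le_imp_le)
  moreover have "a \<in> S" using a[of 0] by (simp add: N_def)
  ultimately show ?thesis by blast
qed

lemma orthogonal_projection:
  fixes S :: "'a::complex_hilbert set"
  assumes "closed S" "csubspace S"
  obtains a where "a \<in> S" "\<And>s. s \<in> S \<Longrightarrow> cinner (x - a) s = 0"
proof -
  obtain a where a: "a \<in> S" and min: "\<And>s. s \<in> S \<Longrightarrow> norm (x - a) \<le> norm (x - s)"
    using nearest_point[OF assms] by blast
  have Re: "Re (cinner (x - a) s) = 0" if "s \<in> S" for s
  proof (rule Re_cinner_zero_of_quadratic)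
    fix t :: real
    have "a + t *\<^sub>R s \<in> S" using a that assms(2) by (simp add: csubspace_def csubspace_scaleR)
    from min[OF this] show "(norm (x - a))\<^sup>2 \<le> (norm (x - a - t *\<^sub>R s))\<^sup>2"
      by (simp add: diff_diff_add power_mono)
  qed
  have "cinner (x - a) s = 0" if "s \<in> S" for s
  proof -
    have "\<i> *\<^sub>C s \<in> S" using that assms(2) by (simp add: csubspace_def)
    from Re[OF this] Re[OF that] show ?thesis by (simp add: cinner_scaleC_right complex_eq_iff)
  qed
  then show ?thesis using a that by blast
qed

text \<open>
  A vector orthogonal to the kernel represents the functional up to a scalar factor, because the kernel has
  codimension at most one.
\<close>

theorem riesz_representation:
  fixes \<phi> :: "'a::complex_hilbert \<Rightarrow> complex"
  assumes add: "\<And>x y. \<phi> (x + y) = \<phi> x + \<phi> y" and scale: "\<And>c x. \<phi> (c *\<^sub>C x) = c * \<phi> x"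
    and bound: "\<And>x. cmod (\<phi> x) \<le> norm x * K"
  shows "\<exists>y. \<forall>x. \<phi> x = cinner x y"
proof (cases "\<forall>x. \<phi> x = 0")
  case True
  then show ?thesis by (intro exI[of _ 0]) simp
next
  case False
  then obtain x0 where x0: "\<phi> x0 \<noteq> 0" by blast
  have zero: "\<phi> 0 = 0" using add[of 0 0] by simp
  have minus: "\<phi> (- x) = - \<phi> x" for x using add[of x "- x"] zero by (simp add: eq_neg_iff_add_eq_0 add.commute)
  have diff: "\<phi> (x - y) = \<phi> x - \<phi> y" for x y using add[of x "- y"] minus by simp
  have "bounded_linear \<phi>"
    by (rule bounded_linear_intro[of _ K])
      (simp_all add: add scale scaleR_scaleC bound scaleR_conv_of_real)
  then have "closed {x. \<phi> x = 0}"
    by (intro closed_Collect_eq continuous_intros) (simp_all add: linear_continuous_on)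
  moreover have "csubspace {x. \<phi> x = 0}" by (simp add: csubspace_def zero add scale)
  ultimately obtain a where a: "\<phi> a = 0" and orth: "\<And>s. \<phi> s = 0 \<Longrightarrow> cinner (x0 - a) s = 0"
    using orthogonal_projection by (metis (mono_tags, lifting) mem_Collect_eq)
  define z where "z = x0 - a"
  have z: "\<phi> z \<noteq> 0" using x0 a by (simp add: z_def diff)
  then have z0: "z \<noteq> 0" using zero by auto
  have "\<phi> x = cinner x ((cnj (\<phi> z) / (norm z)\<^sup>2) *\<^sub>C z)" for x
  proof -
    have "\<phi> (x - (\<phi> x / \<phi> z) *\<^sub>C z) = 0" using z by (simp add: diff scale)
    then have "cinner (x - (\<phi> x / \<phi> z) *\<^sub>C z) z = 0"
      using orth cinner_0_commute z_def by blast
    then have "cinner x z = \<phi> x / \<phi> z * (norm z)\<^sup>2" by (simp add: cinner_simps cinner_self)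
    then show ?thesis using z z0 by (simp add: cinner_simps)
  qed
  then show ?thesis by blast
qed

section \<open>Bounded operators and adjoints\<close>

lemma bounded_opsI:
  assumes "\<And>x y. T (x + y) = T x + T y" "\<And>c x. T (c *\<^sub>C x) = c *\<^sub>C T x"
    "\<And>x. norm (T x) \<le> norm x * K"
  shows "T \<in> bounded_ops"
  unfolding bounded_ops_def using assms
  by (auto intro!: bounded_linear_intro[of _ K] simp: scaleR_scaleC)

lemma bounded_ops_linear: "T \<in> bounded_ops \<Longrightarrow> bounded_linear T"
  by (simp add: bounded_ops_def)

lemma op_scaleC: "T \<in> bounded_ops \<Longrightarrow> T (c *\<^sub>C x) = c *\<^sub>C T x"
  by (simp add: bounded_ops_def)

lemma op_add: "T \<in> bounded_ops \<Longrightarrow> T (x + y) = T x + T y"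
  by (simp add: bounded_ops_linear linear_simps)

lemma op_diff: "T \<in> bounded_ops \<Longrightarrow> T (x - y) = T x - T y"
  by (simp add: bounded_ops_linear linear_simps)

lemma op_minus: "T \<in> bounded_ops \<Longrightarrow> T (- x) = - T x"
  by (simp add: bounded_ops_linear linear_simps)

lemma op_zero: "T \<in> bounded_ops \<Longrightarrow> T 0 = 0"
  by (simp add: bounded_ops_linear linear_simps)

lemma op_scaleR: "T \<in> bounded_ops \<Longrightarrow> T (r *\<^sub>R x) = r *\<^sub>R T x"
  by (simp add: scaleR_scaleC op_scaleC)

lemma op_sum: "T \<in> bounded_ops \<Longrightarrow> T (sum f I) = (\<Sum>i\<in>I. T (f i))"
  by (induction I rule: infinite_finite_induct) (simp_all add: op_zero op_add)

lemmas op_simps = op_scaleC op_add op_diff op_minus op_zero op_scaleR op_sum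

lemma op_bound:
  assumes "T \<in> bounded_ops"
  obtains K where "K > 0" "\<And>x. norm (T x) \<le> K * norm x"
  using bounded_linear.pos_bounded[OF bounded_ops_linear[OF assms]] by (metis mult.commute)

lemma op_tendsto: "T \<in> bounded_ops \<Longrightarrow> X \<longlonglongrightarrow> l \<Longrightarrow> (\<lambda>n. T (X n)) \<longlonglongrightarrow> T l"
  by (simp add: bounded_linear.tendsto bounded_ops_linear)

lemma ops_id: "(\<lambda>x. x) \<in> bounded_ops"
  by (rule bounded_opsI[of _ 1]) simp_all

lemma ops_zero: "(\<lambda>x. 0) \<in> bounded_ops"
  by (rule bounded_opsI[of _ 1]) simp_all

lemma ops_add: "S \<in> bounded_ops \<Longrightarrow> T \<in> bounded_ops \<Longrightarrow> (\<lambda>x. S x + T x) \<in> bounded_ops"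
  unfolding bounded_ops_def by (simp add: bounded_linear_add scaleC_add_right)

lemma ops_diff: "S \<in> bounded_ops \<Longrightarrow> T \<in> bounded_ops \<Longrightarrow> (\<lambda>x. S x - T x) \<in> bounded_ops"
  unfolding bounded_ops_def
  by (simp add: bounded_linear_sub complex_vector.scale_right_diff_distrib)

lemma ops_comp: "S \<in> bounded_ops \<Longrightarrow> T \<in> bounded_ops \<Longrightarrow> (\<lambda>x. S (T x)) \<in> bounded_ops"
  unfolding bounded_ops_def by (simp add: bounded_linear_compose)

lemma ops_scaleC:
  assumes "T \<in> bounded_ops" shows "(\<lambda>x. c *\<^sub>C T x) \<in> bounded_ops"
proof -
  obtain K where "\<And>x. norm (T x) \<le> K * norm x" using op_bound[OF assms] by metis
  then have "norm (c *\<^sub>C T x) \<le> norm x * (cmod c * K)" for x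
    using mult_left_mono[of "norm (T x)" "K * norm x" "cmod c"] by (simp add: ac_simps)
  then show ?thesis
    by (intro bounded_opsI[of _ "cmod c * K"])
      (simp_all add: op_simps assms scaleC_add_right mult.commute)
qed

definition rank_one :: "'a::complex_hilbert \<Rightarrow> 'a \<Rightarrow> 'a \<Rightarrow> 'a" where
  "rank_one x y = (\<lambda>z. cinner z y *\<^sub>C x)"

lemma ops_rank_one: "rank_one x y \<in> bounded_ops"
proof (rule bounded_opsI)
  show "norm (rank_one x y z) \<le> norm z * (norm y * norm x)" for z
    using mult_right_mono[OF cauchy_schwarz[of z y], of "norm x"]
    by (simp add: rank_one_def mult.assoc)
qed (simp_all add: rank_one_def cinner_simps scaleC_add_left)

lemma ops_jordan: "A \<in> bounded_ops \<Longrightarrow> B \<in> bounded_ops \<Longrightarrow> A \<bullet>\<^sub>J B \<in> bounded_ops"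
  unfolding jordan_product_def by (rule ops_scaleC, rule ops_add; rule ops_comp)

lemma adjoint_bound:
  fixes S T :: "'a::complex_hilbert \<Rightarrow> 'a"
  assumes adj: "\<And>x y. cinner (T x) y = cinner x (S y)" and K: "\<And>x. norm (T x) \<le> K * norm x"
  shows "norm (S y) \<le> K * norm y"
proof (cases "S y = 0")
  case True
  then show ?thesis using order_trans[OF norm_ge_zero K[of y]] by simp
next
  case False
  have "(norm (S y))\<^sup>2 = cmod (cinner (T (S y)) y)"
    by (simp add: adj cinner_self norm_power)
  also have "\<dots> \<le> norm (T (S y)) * norm y" by (rule cauchy_schwarz)
  also have "\<dots> \<le> K * norm (S y) * norm y" by (intro mult_right_mono K) simp
  finally have "norm (S y) * norm (S y) \<le> norm (S y) * (K * norm y)"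
    by (simp add: power2_eq_square algebra_simps)
  then show ?thesis using False by (simp add: mult_le_cancel_left)
qed

lemma adjoint_exists:
  assumes T: "T \<in> bounded_ops"
  shows "\<exists>S\<in>bounded_ops. \<forall>x y. cinner (T x) y = cinner x (S y)"
proof -
  obtain K where K: "K > 0" "\<And>x. norm (T x) \<le> K * norm x" using op_bound[OF T] by metis
  have "\<exists>z. \<forall>x. cinner (T x) y = cinner x z" for y
  proof (rule riesz_representation)
    show "cmod (cinner (T x) y) \<le> norm x * (K * norm y)" for x
      using cauchy_schwarz[of "T x" y] mult_right_mono[OF K(2)[of x], of "norm y"]
      by (simp add: mult.assoc mult.left_commute)
  qed (simp_all add: op_simps T cinner_simps)
  then obtain S where S: "\<And>x y. cinner (T x) y = cinner x (S y)" by metis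
  have "S \<in> bounded_ops"
  proof (rule bounded_opsI)
    show "S (x + y) = S x + S y" for x y
      by (rule cinner_ext') (simp add: S[symmetric] cinner_simps)
    show "S (c *\<^sub>C x) = c *\<^sub>C S x" for c x
      by (rule cinner_ext') (simp add: S[symmetric] cinner_simps)
    show "norm (S y) \<le> norm y * K" for y
      using adjoint_bound[OF S K(2), of y] by (simp add: mult.commute)
  qed
  then show ?thesis using S by blast
qed

lemma cadjoint:
  assumes "T \<in> bounded_ops"
  shows ops_cadjoint: "cadjoint T \<in> bounded_ops"
    and cinner_cadjoint: "cinner (T x) y = cinner x (cadjoint T y)"
proof -
  have "\<exists>!S. S \<in> bounded_ops \<and> (\<forall>x y. cinner (T x) y = cinner x (S y))"
  proof (rule ex_ex1I)
    show "\<exists>S. S \<in> bounded_ops \<and> (\<forall>x y. cinner (T x) y = cinner x (S y))"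
      using adjoint_exists[OF assms] by blast
    show "S = S'" if "S \<in> bounded_ops \<and> (\<forall>x y. cinner (T x) y = cinner x (S y))"
      "S' \<in> bounded_ops \<and> (\<forall>x y. cinner (T x) y = cinner x (S' y))" for S S'
      using that by (intro ext cinner_ext') metis
  qed
  from theI'[OF this] show "cadjoint T \<in> bounded_ops"
    "cinner (T x) y = cinner x (cadjoint T y)"
    unfolding cadjoint_def by blast+
qed

lemma cinner_cadjoint': "T \<in> bounded_ops \<Longrightarrow> cinner (cadjoint T x) y = cinner x (T y)"
  by (metis cinner_cadjoint cinner_commute)

lemma cadjoint_eqI:
  assumes "T \<in> bounded_ops" "\<And>x y. cinner (T x) y = cinner x (S y)"
  shows "cadjoint T = S"
  by (intro ext cinner_ext') (metis assms cinner_cadjoint)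

lemma selfadjoint_iff:
  "T \<in> bounded_ops \<Longrightarrow> cadjoint T = T \<longleftrightarrow> (\<forall>x y. cinner (T x) y = cinner x (T y))"
  using cadjoint_eqI[of T T] cinner_cadjoint by metis

section \<open>Positive operators and their square roots\<close>

lemma positive_opD:
  assumes "positive_op P"
  shows positive_ops: "P \<in> bounded_ops" and positive_ge0: "0 \<le> Re (cinner (P x) x)"
    and positive_symmetric: "cinner (P x) y = cinner x (P y)"
proof -
  show P: "P \<in> bounded_ops" and "0 \<le> Re (cinner (P x) x)"
    using assms by (auto simp: positive_op_def)
  have real: "Im (cinner (P z) z) = 0" for z
    using assms by (auto simp: positive_op_def complex_is_Real_iff)
  have "Im (cinner (P x) y) + Im (cinner (P y) x) = 0"
    using real[of "x + y"] real[of x] real[of y] by (simp add: op_simps P cinner_simps)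
  moreover have "Re (cinner (P x) y) - Re (cinner (P y) x) = 0"
    using real[of "x + \<i> *\<^sub>C y"] real[of x] real[of y]
    by (simp add: op_simps P cinner_simps)
  ultimately show "cinner (P x) y = cinner x (P y)"
    by (subst cinner_commute[of x]) (simp add: complex_eq_iff)
qed

lemma symmetric_cinner_real:
  assumes "\<And>x y. cinner (P x) y = cinner x (P y)"
  shows "cinner (P x) x = of_real (Re (cinner (P x) x))"
  by (metis assms cinner_commute complex_cnj_cnj complex_is_Real_iff Reals_cnj_iff of_real_Re)

lemma positive_opI:
  assumes "P \<in> bounded_ops" "\<And>x y. cinner (P x) y = cinner x (P y)"
    "\<And>x. 0 \<le> Re (cinner (P x) x)"
  shows "positive_op P"
  unfolding positive_op_def using assms(1,3) symmetric_cinner_real[of P, OF assms(2)]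
  by (metis Reals_of_real)

text \<open>
  The quadratic form of \<open>P\<close> at \<open>y + tPy\<close> is a polynomial in \<open>t\<close> without constant term which is
  nonnegative for all real \<open>t\<close>, so its linear coefficient \<open>2\<parallel>Py\<parallel>\<^sup>2\<close> vanishes.
\<close>

lemma positive_kernel:
  assumes P: "positive_op P" and "Re (cinner (P y) y) = 0"
  shows "P y = 0"
proof -
  note ops = positive_ops[OF P]
  have quad: "0 \<le> 2 * t * (norm (P y))\<^sup>2 + t\<^sup>2 * Re (cinner (P (P y)) (P y))" for t :: real
  proof -
    have "Re (cinner (P (y + t *\<^sub>R P y)) (y + t *\<^sub>R P y)) =
        2 * t * (norm (P y))\<^sup>2 + t\<^sup>2 * Re (cinner (P (P y)) (P y))"
      using assms(2) by (simp add: op_simps ops cinner_simps positive_symmetric[OF P, of "P y" y]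
          cinner_self power2_eq_square algebra_simps)
    then show ?thesis using positive_ge0[OF P] by metis
  qed
  define a b where "a = (norm (P y))\<^sup>2" and "b = Re (cinner (P (P y)) (P y))"
  have b: "0 \<le> b" unfolding b_def by (rule positive_ge0[OF P])
  have a: "0 \<le> a" by (simp add: a_def)
  \<comment> \<open>The value \<open>-a/(b + 1)\<close> of \<open>t\<close> makes the polynomial negative unless \<open>a = 0\<close>; adding 1 to \<open>b\<close>
    avoids a case distinction on \<open>b = 0\<close>.\<close>
  have "0 \<le> 2 * (- (a / (b + 1))) * a + (- (a / (b + 1)))\<^sup>2 * b"
    using quad[of "- (a / (b + 1))"] by (simp add: a_def b_def)
  also have "\<dots> = - ((a / (b + 1))\<^sup>2 * (b + 2))"
  proof -
    have "a = (a / (b + 1)) * (b + 1)" using b by simp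
    then show ?thesis by (smt (verit) power2_eq_square ring_class.ring_distribs mult.commute mult.left_commute)
  qed
  finally have "(a / (b + 1))\<^sup>2 * (b + 2) \<le> 0" by simp
  then have "a = 0" using b by (auto simp: mult_le_0_iff)
  then show ?thesis by (simp add: a_def)
qed

lemma bounded_bilinear_cinner: "bounded_bilinear (cinner :: 'a::complex_hilbert \<Rightarrow> _)"
  by (rule bounded_bilinear.intro)
    (auto simp: cinner_simps scaleR_conv_of_real intro!: exI[of _ 1] cauchy_schwarz)

lemmas tendsto_cinner = bounded_bilinear.tendsto[OF bounded_bilinear_cinner]

text \<open>
  The square root of \<open>S = 1 - B\<close> is \<open>1 - L\<close> where \<open>L\<close> solves \<open>L = (B + L\<^sup>2)/2\<close>. The solution
  is the limit of the obvious iteration. When \<open>B\<close> is a contraction, the increments of the iteration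
  are dominated in norm by those of the same iteration for the number \<open>1\<close> in place of \<open>B\<close>,
  and the latter is increasing and bounded.
\<close>

context
  fixes B :: "'a::complex_hilbert \<Rightarrow> 'a"
begin

fun sqrt_iter :: "nat \<Rightarrow> 'a \<Rightarrow> 'a" where
  "sqrt_iter 0 = (\<lambda>x. 0)"
| "sqrt_iter (Suc n) = (\<lambda>x. (1/2) *\<^sub>C (B x + sqrt_iter n (sqrt_iter n x)))"

end

fun sqrt_majorant :: "nat \<Rightarrow> real" where
  "sqrt_majorant 0 = 0"
| "sqrt_majorant (Suc n) = (1 + (sqrt_majorant n)\<^sup>2) / 2"

lemma sqrt_majorant_bounds: "0 \<le> sqrt_majorant n \<and> sqrt_majorant n \<le> 1"
proof (induction n)
  case (Suc n)
  then have "(sqrt_majorant n)\<^sup>2 \<le> 1" by (simp add: power_le_one)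
  then show ?case by simp
qed simp

lemma sqrt_majorant_mono: "incseq sqrt_majorant"
proof (rule incseq_SucI)
  show "sqrt_majorant n \<le> sqrt_majorant (Suc n)" for n
    using sum_squares_ge_zero[of "sqrt_majorant n - 1" 0]
    by (simp add: power2_eq_square algebra_simps)
qed

context
  fixes B :: "'a::complex_hilbert \<Rightarrow> 'a"
  assumes B: "B \<in> bounded_ops"
begin

lemma ops_sqrt_iter: "sqrt_iter B n \<in> bounded_ops"
proof (induction n)
  case (Suc n)
  have "(\<lambda>x. (1/2) *\<^sub>C (B x + sqrt_iter B n (sqrt_iter B n x))) \<in> bounded_ops"
    by (rule ops_scaleC, rule ops_add, rule B, rule ops_comp) (rule Suc)+
  then show ?case by simp
qed (simp add: ops_zero)

lemma sqrt_iter_commute: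
  assumes Q: "Q \<in> bounded_ops" and "\<And>x. Q (B x) = B (Q x)"
  shows "Q (sqrt_iter B n x) = sqrt_iter B n (Q x)"
  by (induction n arbitrary: x) (simp_all add: op_simps Q assms(2))

lemma sqrt_iter_commute_iter: "sqrt_iter B m (sqrt_iter B n x) = sqrt_iter B n (sqrt_iter B m x)"
  by (rule sqrt_iter_commute) (simp_all add: ops_sqrt_iter sqrt_iter_commute B)

lemma sqrt_iter_symmetric:
  assumes "\<And>x y. cinner (B x) y = cinner x (B y)"
  shows "cinner (sqrt_iter B n x) y = cinner x (sqrt_iter B n y)"
  by (induction n arbitrary: x y) (simp_all add: cinner_simps assms)

context
  assumes contraction: "\<And>x. norm (B x) \<le> norm x"
begin

lemma sqrt_iter_bound: "norm (sqrt_iter B n x) \<le> sqrt_majorant n * norm x"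
proof (induction n arbitrary: x)
  case (Suc n)
  have "norm (sqrt_iter B n (sqrt_iter B n x)) \<le> sqrt_majorant n * (sqrt_majorant n * norm x)"
    by (rule order_trans[OF Suc], rule mult_left_mono[OF Suc]) (simp add: sqrt_majorant_bounds)
  then have "norm (B x + sqrt_iter B n (sqrt_iter B n x)) \<le> (1 + (sqrt_majorant n)\<^sup>2) * norm x"
    using norm_triangle_ineq[of "B x" "sqrt_iter B n (sqrt_iter B n x)"] contraction[of x]
    by (simp add: power2_eq_square algebra_simps)
  then show ?case by simp
qed simp

lemma sqrt_iter_step:
  "norm (sqrt_iter B (Suc n) x - sqrt_iter B n x) \<le> (sqrt_majorant (Suc n) - sqrt_majorant n) * norm x"
proof (induction n arbitrary: x)
  case 0
  then show ?case using contraction[of x] by simp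
next
  case (Suc n)
  let ?Y = "sqrt_iter B" and ?y = sqrt_majorant
  define D where "D = ?Y (Suc n) x - ?Y n x"
  have step: "norm D \<le> (?y (Suc n) - ?y n) * norm x" unfolding D_def by (rule Suc)
  have "?Y (Suc (Suc n)) x - ?Y (Suc n) x
      = (1/2) *\<^sub>C (?Y (Suc n) (?Y (Suc n) x) - ?Y n (?Y n x))"
    by (subst sqrt_iter.simps(2), subst sqrt_iter.simps(2)[of B n])
      (simp add: complex_vector.scale_right_diff_distrib[symmetric] del: sqrt_iter.simps)
  also have "?Y (Suc n) (?Y (Suc n) x) - ?Y n (?Y n x) = ?Y (Suc n) D + ?Y n D"
    unfolding D_def op_diff[OF ops_sqrt_iter] by (simp add: sqrt_iter_commute_iter del: sqrt_iter.simps)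
  finally have "norm (?Y (Suc (Suc n)) x - ?Y (Suc n) x) \<le> (norm (?Y (Suc n) D) + norm (?Y n D)) / 2"
    using norm_triangle_ineq[of "?Y (Suc n) D" "?Y n D"] by (simp del: sqrt_iter.simps)
  also have "\<dots> \<le> (?y (Suc n) + ?y n) * norm D / 2"
    using sqrt_iter_bound[of "Suc n" D] sqrt_iter_bound[of n D]
    by (simp add: algebra_simps del: sqrt_iter.simps sqrt_majorant.simps)
  also have "\<dots> \<le> (?y (Suc n) + ?y n) * ((?y (Suc n) - ?y n) * norm x) / 2"
    by (intro divide_right_mono mult_left_mono step add_nonneg_nonneg)
      (simp_all add: sqrt_majorant_bounds del: sqrt_majorant.simps)
  also have "\<dots> = (?y (Suc (Suc n)) - ?y (Suc n)) * norm x"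
  proof -
    have "(a + b) * ((a - b) * t) / 2 = ((1 + a\<^sup>2) / 2 - (1 + b\<^sup>2) / 2) * t" for a b t :: real
      by (simp add: power2_eq_square field_simps)
    then show ?thesis by (metis sqrt_majorant.simps(2))
  qed
  finally show ?case .
qed

lemma sqrt_iter_increment:
  assumes "m \<le> n"
  shows "norm (sqrt_iter B n x - sqrt_iter B m x) \<le> (sqrt_majorant n - sqrt_majorant m) * norm x"
  using assms
proof (induction n rule: dec_induct)
  case (step n)
  then show ?case
    using norm_triangle_ineq[of "sqrt_iter B (Suc n) x - sqrt_iter B n x" "sqrt_iter B n x - sqrt_iter B m x"]
      sqrt_iter_step[of n x]
    by (simp add: algebra_simps del: sqrt_iter.simps sqrt_majorant.simps)
qed simp

lemma sqrt_iter_convergent: "convergent (\<lambda>n. sqrt_iter B n x)"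
proof (rule Cauchy_convergent, rule metric_CauchyI)
  fix e :: real assume e: "0 < e"
  have "Cauchy sqrt_majorant"
    using sqrt_majorant_mono incseq_convergent[of sqrt_majorant 1] sqrt_majorant_bounds
    by (metis LIMSEQ_imp_Cauchy)
  then obtain M where M: "\<And>m n. m \<ge> M \<Longrightarrow> n \<ge> M \<Longrightarrow> dist (sqrt_majorant m) (sqrt_majorant n) < e / (norm x + 1)"
    using metric_CauchyD[of sqrt_majorant "e / (norm x + 1)"] e by (metis add_nonneg_pos divide_pos_pos norm_ge_zero zero_less_one)
  have less: "dist (sqrt_iter B n x) (sqrt_iter B m x) < e" if "m \<ge> M" "m \<le> n" for m n
  proof -
    have "sqrt_majorant n - sqrt_majorant m \<le> e / (norm x + 1)"
      using M[of n m] that by (simp add: dist_real_def)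
    then have "(sqrt_majorant n - sqrt_majorant m) * norm x \<le> e / (norm x + 1) * norm x"
      by (rule mult_right_mono) simp
    also have "\<dots> < e" using e by (simp add: field_simps add_pos_nonneg)
    finally show ?thesis using sqrt_iter_increment[OF that(2), of x] by (simp add: dist_norm)
  qed
  show "\<exists>M. \<forall>m\<ge>M. \<forall>n\<ge>M. dist (sqrt_iter B m x) (sqrt_iter B n x) < e"
    by (metis less dist_commute nle_le)
qed

end
end

lemma sqrt_exists:
  fixes S :: "'a::complex_hilbert \<Rightarrow> 'a"
  assumes S: "S \<in> bounded_ops" and sym: "\<And>x y. cinner (S x) y = cinner x (S y)"
    and contraction: "\<And>x. norm (x - S x) \<le> norm x"
  shows "\<exists>R. positive_op R \<and> (\<forall>x. R (R x) = S x) \<and>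
    (\<forall>Q\<in>bounded_ops. (\<forall>x. Q (S x) = S (Q x)) \<longrightarrow> (\<forall>x. Q (R x) = R (Q x)))"
proof -
  define B where "B = (\<lambda>x. x - S x)"
  have B: "B \<in> bounded_ops" unfolding B_def by (rule ops_diff[OF ops_id S])
  have Bsym: "cinner (B x) y = cinner x (B y)" for x y by (simp add: B_def cinner_simps sym)
  have Bc: "norm (B x) \<le> norm x" for x by (simp add: B_def contraction)
  let ?Y = "sqrt_iter B"
  obtain L where L: "\<And>x. (\<lambda>n. ?Y n x) \<longlonglongrightarrow> L x"
    using sqrt_iter_convergent[OF B Bc] unfolding convergent_def by metis
  have Ybound: "norm (?Y n x) \<le> norm x" for n x
    using sqrt_iter_bound[OF B Bc, of n x] sqrt_majorant_bounds[of n]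
      mult_right_mono[of "sqrt_majorant n" 1 "norm x"] by simp
  have Lbound: "norm (L x) \<le> norm x" for x
    by (rule LIMSEQ_le_const2[OF tendsto_norm[OF L]]) (use Ybound in blast)
  have Lop: "L \<in> bounded_ops"
  proof (rule bounded_opsI[of _ 1])
    show "L (x + y) = L x + L y" for x y
      using LIMSEQ_unique[OF L[of "x + y"]] tendsto_add[OF L[of x] L[of y]]
      by (simp add: op_add[OF ops_sqrt_iter[OF B]])
    show "L (c *\<^sub>C x) = c *\<^sub>C L x" for c x
      using LIMSEQ_unique[OF L[of "c *\<^sub>C x"]] op_tendsto[OF ops_scaleC[OF ops_id] L[of x], of c]
      by (simp add: op_scaleC[OF ops_sqrt_iter[OF B]])
  qed (simp add: Lbound)
  have Lsym: "cinner (L x) y = cinner x (L y)" for x y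
    using LIMSEQ_unique[OF tendsto_cinner[OF L[of x] tendsto_const[of y]]]
      tendsto_cinner[OF tendsto_const[of x] L[of y]]
    by (simp add: sqrt_iter_symmetric[OF B Bsym])
  have Lcomm: "Q (L x) = L (Q x)" if Q: "Q \<in> bounded_ops" "\<And>x. Q (S x) = S (Q x)" for Q x
  proof -
    have "Q (B y) = B (Q y)" for y by (simp add: B_def op_diff Q)
    then have "Q (?Y n x) = ?Y n (Q x)" for n by (rule sqrt_iter_commute[OF B Q(1)])
    then show ?thesis using LIMSEQ_unique[OF L[of "Q x"]] op_tendsto[OF Q(1) L[of x]] by simp
  qed
  have "(\<lambda>n. ?Y n (?Y n x)) \<longlonglongrightarrow> L (L x)" for x
  proof -
    have "(\<lambda>n. ?Y n (?Y n x - L x)) \<longlonglongrightarrow> 0"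
    proof (rule Lim_null_comparison)
      show "(\<lambda>n. norm (?Y n x - L x)) \<longlonglongrightarrow> 0"
        using tendsto_norm[OF tendsto_diff[OF L[of x] tendsto_const[of "L x"]]] by simp
    qed (simp add: Ybound)
    from tendsto_add[OF this L[of "L x"]] show ?thesis
      by (simp add: op_diff[OF ops_sqrt_iter[OF B]])
  qed
  then have "(\<lambda>n. (1/2) *\<^sub>C (B x + ?Y n (?Y n x))) \<longlonglongrightarrow> (1/2) *\<^sub>C (B x + L (L x))" for x
    by (intro op_tendsto[OF ops_scaleC[OF ops_id]] tendsto_add tendsto_const)
  then have "(\<lambda>n. ?Y (Suc n) x) \<longlonglongrightarrow> (1/2) *\<^sub>C (B x + L (L x))" for x by simp
  then have "L x = (1/2) *\<^sub>C (B x + L (L x))" for x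
    by (rule LIMSEQ_unique[OF LIMSEQ_Suc[OF L[of x]]])
  then have "2 *\<^sub>C L x = 2 *\<^sub>C ((1/2) *\<^sub>C (B x + L (L x)))" for x by metis
  then have fix_eq: "2 *\<^sub>C L x = x - S x + L (L x)" for x by (simp add: B_def)
  define R where "R = (\<lambda>x. x - L x)"
  have R: "R \<in> bounded_ops" unfolding R_def by (rule ops_diff[OF ops_id Lop])
  have "R (R x) = S x" for x
  proof -
    have "R (R x) = x - 2 *\<^sub>C L x + L (L x)"
      using scaleC_add_left[of 1 1 "L x"] by (simp add: R_def op_diff[OF Lop] scaleC_one)
    then show ?thesis by (simp add: fix_eq)
  qed
  moreover have "positive_op R"
  proof (rule positive_opI[OF R])
    show "cinner (R x) y = cinner x (R y)" for x y by (simp add: R_def cinner_simps Lsym)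
    show "0 \<le> Re (cinner (R x) x)" for x
    proof -
      have "Re (cinner (L x) x) \<le> norm (L x) * norm x"
        using cauchy_schwarz[of "L x" x] complex_Re_le_cmod order_trans by blast
      also have "\<dots> \<le> norm x * norm x" by (rule mult_right_mono[OF Lbound]) simp
      finally show ?thesis by (simp add: R_def cinner_simps cinner_self power2_eq_square)
    qed
  qed
  moreover have "Q (R x) = R (Q x)" if "Q \<in> bounded_ops" "\<And>x. Q (S x) = S (Q x)" for Q x
    by (simp add: R_def op_diff[OF that(1)] Lcomm that)
  ultimately show ?thesis by blast
qed

lemma sqrt_adjoint_square_exists:
  fixes T :: "'a::complex_hilbert \<Rightarrow> 'a"
  assumes T: "T \<in> bounded_ops"
  shows "\<exists>R. positive_op R \<and> (\<forall>x. R (R x) = cadjoint T (T x)) \<and>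
    (\<forall>Q\<in>bounded_ops. (\<forall>x. Q (cadjoint T (T x)) = cadjoint T (T (Q x))) \<longrightarrow> (\<forall>x. Q (R x) = R (Q x)))"
proof -
  obtain K where K: "K > 0" "\<And>x. norm (T x) \<le> K * norm x" using op_bound[OF T] by metis
  define S where "S = (\<lambda>x. (1 / K\<^sup>2) *\<^sub>C cadjoint T (T x))"
  have S: "S \<in> bounded_ops"
    unfolding S_def by (rule ops_scaleC, rule ops_comp) (simp_all add: T ops_cadjoint)
  have sym: "cinner (S x) y = cinner x (S y)" for x y
    by (simp add: S_def cinner_simps cinner_cadjoint[OF T] cinner_cadjoint'[OF T] flip: of_real_power)
  have con: "norm (x - S x) \<le> norm x" for x
  proof (rule power2_le_imp_le)
    have "norm (S x) \<le> (1 / K\<^sup>2) * (K * norm (T x))"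
      using mult_left_mono[OF adjoint_bound[OF cinner_cadjoint[OF T] K(2), of "T x"], of "1 / K\<^sup>2"]
      by (simp add: S_def norm_divide norm_power)
    then have "norm (S x) \<le> norm (T x) / K" using K(1) by (simp add: power2_eq_square)
    then have "(norm (S x))\<^sup>2 \<le> (norm (T x) / K)\<^sup>2" by (rule power_mono) simp
    moreover have "Re (cinner x (S x)) = (norm (T x) / K)\<^sup>2"
      by (simp add: S_def cinner_simps cinner_cadjoint[OF T, symmetric] cinner_self power_divide
          flip: of_real_power)
    ultimately show "(norm (x - S x))\<^sup>2 \<le> (norm x)\<^sup>2"
      using zero_le_power2[of "norm (T x) / K"] unfolding norm_diff_cinner by linarith
  qed simp
  obtain R where R: "positive_op R" "\<And>x. R (R x) = S x"
    "\<And>Q x. Q \<in> bounded_ops \<Longrightarrow> (\<And>x. Q (S x) = S (Q x)) \<Longrightarrow> Q (R x) = R (Q x)"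
    using sqrt_exists[OF S sym con] by blast
  note Rop = positive_ops[OF R(1)]
  define P where "P = (\<lambda>x. complex_of_real K *\<^sub>C R x)"
  have P: "P \<in> bounded_ops" unfolding P_def by (rule ops_scaleC[OF Rop])
  have "positive_op P"
    using K(1) by (intro positive_opI[OF P])
      (simp_all add: P_def cinner_simps positive_symmetric[OF R(1)] positive_ge0[OF R(1), unfolded positive_symmetric[OF R(1)]])
  moreover have "P (P x) = cadjoint T (T x)" for x
    using K(1) by (simp add: P_def op_scaleC[OF Rop] R(2) S_def power2_eq_square)
  moreover have "Q (P x) = P (Q x)"
    if "Q \<in> bounded_ops" "\<And>x. Q (cadjoint T (T x)) = cadjoint T (T (Q x))" for Q x
    using R(3)[of Q x] that by (simp add: P_def S_def op_scaleC)
  ultimately show ?thesis by blast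
qed

text \<open>
  For \<open>y = (R - P)x\<close> one has \<open>(R + P)y = 0\<close>. Both summands being positive, their quadratic forms vanish
  at \<open>y\<close>, so \<open>Ry = Py = 0\<close> and hence \<open>\<parallel>y\<parallel>\<^sup>2 = \<langle>(R - P)y, x\<rangle> = 0\<close>.
\<close>

lemma positive_sqrt_unique:
  assumes R: "positive_op R" and P: "positive_op P" and eq: "\<And>x. R (R x) = P (P x)"
    and comm: "\<And>x. P (R x) = R (P x)"
  shows "R = P"
proof
  note ops = positive_ops[OF R] positive_ops[OF P]
  fix x
  define y where "y = R x - P x"
  have "R y + P y = 0" by (simp add: y_def op_diff ops eq comm)
  then have "Re (cinner (R y) y) + Re (cinner (P y) y) = 0"
    by (metis cinner_add_left cinner_zero(1) plus_complex.simps(1) zero_complex.simps(1))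
  then have "Re (cinner (R y) y) = 0" "Re (cinner (P y) y) = 0"
    using positive_ge0[OF R, of y] positive_ge0[OF P, of y] by linarith+
  then have "R y = 0" "P y = 0" by (auto intro: positive_kernel R P)
  then have "cinner y y = 0"
    using positive_symmetric[OF R, of y x] positive_symmetric[OF P, of y x]
    by (subst (2) y_def) (simp add: cinner_simps)
  then show "R x = P x" by (simp add: y_def)
qed

text \<open>
  The root constructed above commutes with every operator that commutes with \<open>T\<^sup>*T\<close>, in particular with
  any other positive root, so the previous uniqueness result applies.
\<close>

lemma abs_op_ex1:
  fixes T :: "'a::complex_hilbert \<Rightarrow> 'a"
  assumes T: "T \<in> bounded_ops"
  shows "\<exists>!P. positive_op P \<and> P \<circ> P = cadjoint T \<circ> T"
    and "positive_op P \<Longrightarrow> P \<circ> P = cadjoint T \<circ> T \<Longrightarrow> Q \<in> bounded_ops \<Longrightarrow>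
      (\<And>x. Q (cadjoint T (T x)) = cadjoint T (T (Q x))) \<Longrightarrow> Q (P x) = P (Q x)"
proof -
  obtain R where R: "positive_op R" "\<And>x. R (R x) = cadjoint T (T x)"
    and comm: "\<And>Q x. Q \<in> bounded_ops \<Longrightarrow> (\<And>x. Q (cadjoint T (T x)) = cadjoint T (T (Q x)))
      \<Longrightarrow> Q (R x) = R (Q x)"
    using sqrt_adjoint_square_exists[OF T] by blast
  have unique: "P = R" if "positive_op P" "P \<circ> P = cadjoint T \<circ> T" for P
  proof -
    have sq: "P (P x) = cadjoint T (T x)" for x using that(2) by (metis comp_apply)
    have "P (R x) = R (P x)" for x
      by (rule comm[OF positive_ops[OF that(1)]]) (simp flip: sq)
    then show ?thesis using positive_sqrt_unique[OF R(1) that(1)] R(2) sq by metis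
  qed
  show "\<exists>!P. positive_op P \<and> P \<circ> P = cadjoint T \<circ> T"
    by (rule ex1I[of _ R]) (simp_all add: R comp_def unique)
  show "Q (P x) = P (Q x)" if "positive_op P" "P \<circ> P = cadjoint T \<circ> T" "Q \<in> bounded_ops"
    "\<And>x. Q (cadjoint T (T x)) = cadjoint T (T (Q x))"
    using unique[OF that(1,2)] comm[OF that(3,4)] by simp
qed

lemma abs_op:
  assumes T: "T \<in> bounded_ops"
  shows positive_abs_op: "positive_op (abs_op T)"
    and abs_op_square: "abs_op T (abs_op T x) = cadjoint T (T x)"
    and abs_op_commute: "Q \<in> bounded_ops \<Longrightarrow> (\<And>x. Q (cadjoint T (T x)) = cadjoint T (T (Q x)))
      \<Longrightarrow> Q (abs_op T x) = abs_op T (Q x)"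
proof -
  have *: "positive_op (abs_op T) \<and> abs_op T \<circ> abs_op T = cadjoint T \<circ> T"
    unfolding abs_op_def sqrt_op_def by (rule theI'[OF abs_op_ex1(1)[OF T]])
  then show "positive_op (abs_op T)" "abs_op T (abs_op T x) = cadjoint T (T x)"
    by (simp_all add: fun_eq_iff)
  show "Q \<in> bounded_ops \<Longrightarrow> (\<And>x. Q (cadjoint T (T x)) = cadjoint T (T (Q x)))
      \<Longrightarrow> Q (abs_op T x) = abs_op T (Q x)"
    using abs_op_ex1(2)[OF T] * by blast
qed

lemma abs_op_eqI:
  assumes "T \<in> bounded_ops" "positive_op P" "\<And>x. P (P x) = cadjoint T (T x)"
  shows "abs_op T = P"
proof -
  have "positive_op P \<and> P \<circ> P = cadjoint T \<circ> T" using assms by (simp add: fun_eq_iff)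
  then show ?thesis
    unfolding abs_op_def sqrt_op_def by (rule the1_equality[OF abs_op_ex1(1)[OF assms(1)]])
qed

lemma cadjoint_positive: "positive_op P \<Longrightarrow> cadjoint P = P"
  by (simp add: selfadjoint_iff positive_ops positive_symmetric)

lemma positive_commute_square:
  assumes P: "positive_op P" and "Q \<in> bounded_ops" "\<And>x. Q (P (P x)) = P (P (Q x))"
  shows "Q (P x) = P (Q x)"
proof -
  have "abs_op P = P"
    by (rule abs_op_eqI[OF positive_ops[OF P] P]) (simp add: cadjoint_positive[OF P])
  then show ?thesis
    using abs_op_commute[OF positive_ops[OF P] assms(2)] assms(3) cadjoint_positive[OF P] by metis
qed

section \<open>Polar decomposition\<close>

lemma norm_eq_imp_cinner_eq:
  assumes A: "A \<in> bounded_ops" and B: "B \<in> bounded_ops" and eq: "\<And>x. norm (A x) = norm (B x)"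
  shows "cinner (A x) (A y) = cinner (B x) (B y)"
proof -
  have Re: "Re (cinner (A x) (A y)) = Re (cinner (B x) (B y))" for x y
    using eq[of "x + y"] eq[of x] eq[of y] Re_cinner_norm[of "A x" "A y"] Re_cinner_norm[of "B x" "B y"]
    by (simp add: op_add A B)
  show ?thesis
    using Re[of x y] Re[of x "\<i> *\<^sub>C y"] by (simp add: op_scaleC A B cinner_simps complex_eq_iff)
qed

lemma closure_range_sequential: "x \<in> closure (range P) \<longleftrightarrow> (\<exists>X. (\<lambda>n. P (X n)) \<longlonglongrightarrow> x)"
  for x :: "'a::complex_hilbert"
proof
  assume "x \<in> closure (range P)"
  then obtain Y where Y: "\<forall>n. Y n \<in> range P" "Y \<longlonglongrightarrow> x" unfolding closure_sequential by blast
  then have "\<forall>n. \<exists>z. Y n = P z" by blast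
  then obtain X where "\<And>n. Y n = P (X n)" by metis
  then have "Y = (\<lambda>n. P (X n))" by (rule ext)
  then show "\<exists>X. (\<lambda>n. P (X n)) \<longlonglongrightarrow> x" using Y(2) by blast
next
  assume "\<exists>X. (\<lambda>n. P (X n)) \<longlonglongrightarrow> x"
  then obtain X where "(\<lambda>n. P (X n)) \<longlonglongrightarrow> x" ..
  then show "x \<in> closure (range P)"
    unfolding closure_sequential by (intro exI[of _ "\<lambda>n. P (X n)"]) simp
qed

lemma csubspace_closure_range:
  assumes P: "P \<in> bounded_ops" shows "csubspace (closure (range P))"
  unfolding csubspace_def
proof (intro conjI ballI allI)
  show "0 \<in> closure (range P)"
    by (auto simp: closure_range_sequential op_zero[OF P] intro!: exI[of _ "\<lambda>_. 0"])
  fix x assume "x \<in> closure (range P)"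
  then obtain X where X: "(\<lambda>n. P (X n)) \<longlonglongrightarrow> x"
    unfolding closure_range_sequential by blast
  show "c *\<^sub>C x \<in> closure (range P)" for c
    unfolding closure_range_sequential
    by (rule exI[of _ "\<lambda>n. c *\<^sub>C X n"])
      (use op_tendsto[OF ops_scaleC[OF ops_id] X, of c] in \<open>simp add: op_scaleC[OF P]\<close>)
  fix y assume "y \<in> closure (range P)"
  then obtain Y where Y: "(\<lambda>n. P (Y n)) \<longlonglongrightarrow> y"
    unfolding closure_range_sequential by blast
  show "x + y \<in> closure (range P)"
    unfolding closure_range_sequential
    by (rule exI[of _ "\<lambda>n. X n + Y n"]) (use tendsto_add[OF X Y] in \<open>simp add: op_add[OF P]\<close>)
qed

text \<open>
  The kernel of a self-adjoint operator is the orthogonal complement of its range.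
\<close>

lemma range_kernel_decomposition:
  assumes P: "positive_op P"
  obtains b X where "P b = 0" "(\<lambda>n. P (X n)) \<longlonglongrightarrow> x - b"
proof -
  note Pop = positive_ops[OF P]
  obtain a where a: "a \<in> closure (range P)" "\<And>s. s \<in> closure (range P) \<Longrightarrow> cinner (x - a) s = 0"
    using orthogonal_projection[OF closed_closure csubspace_closure_range[OF Pop]] by metis
  have "P (x - a) = 0"
  proof (rule cinner_ext)
    show "cinner (P (x - a)) z = cinner 0 z" for z
      using a(2)[of "P z"] closure_subset[of "range P"] positive_symmetric[OF P] by auto
  qed
  moreover obtain X where "(\<lambda>n. P (X n)) \<longlonglongrightarrow> a"
    using a(1) unfolding closure_range_sequential by blast
  ultimately show ?thesis by (intro that[of "x - a" X]) simp_all
qed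

lemma limit_orthogonal_kernel:
  assumes P: "positive_op P" and "(\<lambda>n. P (X n)) \<longlonglongrightarrow> a" "P b = 0"
  shows "cinner a b = 0"
  using tendsto_cinner[OF assms(2) tendsto_const[of b]]
  by (simp add: positive_symmetric[OF P] assms(3) LIMSEQ_const_iff)

lemma ops_eqI_range_kernel:
  assumes "positive_op P" "S \<in> bounded_ops" "T \<in> bounded_ops"
    and range: "\<And>x. S (P x) = T (P x)" and kernel: "\<And>x. P x = 0 \<Longrightarrow> S x = T x"
  shows "S = T"
proof
  fix x
  obtain b X where b: "P b = 0" "(\<lambda>n. P (X n)) \<longlonglongrightarrow> x - b"
    using range_kernel_decomposition[OF assms(1)] by metis
  have "S (x - b) = T (x - b)"
    using LIMSEQ_unique[OF op_tendsto[OF assms(2) b(2)]] op_tendsto[OF assms(3) b(2)] range by simp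
  then show "S x = T x" using kernel[OF b(1)] by (simp add: op_diff assms)
qed

lemma partial_isometryI:
  assumes P: "positive_op P" and V: "V \<in> bounded_ops"
    and iso: "\<And>x. norm (V (P x)) = norm (P x)" and ker: "\<And>x. V x = 0 \<longleftrightarrow> P x = 0"
  shows "partial_isometry V"
  unfolding partial_isometry_def null_space_def
proof (intro conjI allI impI V)
  fix x assume orth: "\<forall>y\<in>{x. V x = 0}. cinner x y = 0"
  obtain b X where b: "P b = 0" "(\<lambda>n. P (X n)) \<longlonglongrightarrow> x - b"
    using range_kernel_decomposition[OF P] by metis
  have "cinner x b = 0" using orth b(1) ker by blast
  then have "cinner b b = 0"
    using limit_orthogonal_kernel[OF P b(2,1)] by (simp add: cinner_simps)
  then have X: "(\<lambda>n. P (X n)) \<longlonglongrightarrow> x" using b(2) by simp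
  show "norm (V x) = norm x"
    using LIMSEQ_unique[OF tendsto_norm[OF op_tendsto[OF V X]]] tendsto_norm[OF X] iso by simp
qed

text \<open>
  A vector decomposes as \<open>x = (x - b) + b\<close> with \<open>P b = 0\<close> and \<open>x - b\<close> a limit of vectors \<open>P (X n)\<close>.
  Since \<open>P x \<mapsto> T x\<close> is isometric, \<open>T (X n)\<close> converges, and its limit is the value at \<open>x\<close> of the
  partial isometry.
\<close>

lemma polar_exists:
  assumes T: "T \<in> bounded_ops" and P: "positive_op P" and iso: "\<And>x. norm (T x) = norm (P x)"
  shows "\<exists>V\<in>bounded_ops. (\<forall>x. V (P x) = T x) \<and> (\<forall>x. V x = 0 \<longleftrightarrow> P x = 0)"
proof -
  note Pop = positive_ops[OF P]
  define G where "G x w \<longleftrightarrow> (\<exists>b X. P b = 0 \<and> (\<lambda>n. P (X n)) \<longlonglongrightarrow> x - b \<and> (\<lambda>n. T (X n)) \<longlonglongrightarrow> w)"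
    for x w
  have G_add: "G (x + y) (v + w)" if xv: "G x v" and yw: "G y w" for x y v w
  proof -
    obtain b X c Y where b: "P b = 0" "(\<lambda>n. P (X n)) \<longlonglongrightarrow> x - b" "(\<lambda>n. T (X n)) \<longlonglongrightarrow> v"
      and c: "P c = 0" "(\<lambda>n. P (Y n)) \<longlonglongrightarrow> y - c" "(\<lambda>n. T (Y n)) \<longlonglongrightarrow> w"
      using xv yw unfolding G_def by blast
    show ?thesis unfolding G_def
      by (intro exI[of _ "b + c"] exI[of _ "\<lambda>n. X n + Y n"])
        (use b c tendsto_add[OF b(2) c(2)] tendsto_add[OF b(3) c(3)] in
          \<open>simp add: op_add Pop T algebra_simps\<close>)
  qed
  have G_scale: "G (k *\<^sub>C x) (k *\<^sub>C v)" if xv: "G x v" for x v k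
  proof -
    obtain b X where b: "P b = 0" "(\<lambda>n. P (X n)) \<longlonglongrightarrow> x - b" "(\<lambda>n. T (X n)) \<longlonglongrightarrow> v"
      using xv unfolding G_def by blast
    note lim = op_tendsto[OF ops_scaleC[OF ops_id, of k]]
    show ?thesis unfolding G_def
      by (intro exI[of _ "k *\<^sub>C b"] exI[of _ "\<lambda>n. k *\<^sub>C X n"])
        (use b lim[OF b(2)] lim[OF b(3)] in
          \<open>simp add: op_scaleC Pop T complex_vector.scale_right_diff_distrib\<close>)
  qed
  have G_norm: "\<exists>b. P b = 0 \<and> cinner (x - b) b = 0 \<and> norm w = norm (x - b)" if xw: "G x w" for x w
  proof -
    obtain b X where b: "P b = 0" "(\<lambda>n. P (X n)) \<longlonglongrightarrow> x - b" "(\<lambda>n. T (X n)) \<longlonglongrightarrow> w"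
      using xw unfolding G_def by blast
    have "norm w = norm (x - b)"
      using LIMSEQ_unique[OF tendsto_norm[OF b(3)]] tendsto_norm[OF b(2)] by (simp add: iso)
    then show ?thesis using b(1) limit_orthogonal_kernel[OF P b(2,1)] by blast
  qed
  have G_bound: "norm w \<le> norm x" if xw: "G x w" for x w
  proof -
    obtain b where b: "cinner (x - b) b = 0" "norm w = norm (x - b)" using G_norm[OF xw] by blast
    have "(norm w)\<^sup>2 \<le> (norm x)\<^sup>2" using Re_cinner_norm[of "x - b" b] b by simp
    then show ?thesis by (rule power2_le_imp_le) simp
  qed
  have G_ex: "\<exists>w. G x w" for x
  proof -
    obtain b X where b: "P b = 0" "(\<lambda>n. P (X n)) \<longlonglongrightarrow> x - b"
      using range_kernel_decomposition[OF P] by metis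
    have "dist (T u) (T v) = dist (P u) (P v)" for u v
      using iso[of "u - v"] by (simp add: dist_norm op_diff T Pop)
    then have "Cauchy (\<lambda>n. T (X n))"
      using LIMSEQ_imp_Cauchy[OF b(2)] unfolding Cauchy_def by simp
    then show ?thesis unfolding G_def using b Cauchy_convergent convergent_def by blast
  qed
  have G_unique: "v = w" if "G x v" "G x w" for x v w
    using G_bound[OF G_add[OF that(1) G_scale[OF that(2), of "-1"]]] by simp
  define V where "V x = (THE w. G x w)" for x
  have GV: "G x (V x)" for x
    unfolding V_def by (rule theI') (use G_ex G_unique in blast)
  have V_eq: "V x = w" if "G x w" for x w using GV G_unique that by blast
  have "V \<in> bounded_ops"
    by (rule bounded_opsI[of _ 1]) (auto intro: V_eq G_add G_scale GV G_bound)
  moreover have "V (P x) = T x" for x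
    by (rule V_eq) (auto simp: G_def op_zero Pop intro!: exI[of _ 0] exI[of _ "\<lambda>_. x"])
  moreover have "P x = 0" if "V x = 0" for x
    using G_norm[OF GV[of x]] that by auto
  moreover have "V x = 0" if "P x = 0" for x
    by (rule V_eq) (auto simp: G_def op_zero Pop T that intro!: exI[of _ x] exI[of _ "\<lambda>_. 0"])
  ultimately show ?thesis by blast
qed

text \<open>
  A criterion by which both factors of the polar decomposition of a concrete operator are recognised.
\<close>

lemma polar_eqI:
  assumes T: "T \<in> bounded_ops" and P: "positive_op P" and V: "V \<in> bounded_ops"
    and eq: "\<And>x. V (P x) = T x" and iso: "\<And>x. norm (T x) = norm (P x)"
    and ker: "\<And>x. V x = 0 \<longleftrightarrow> P x = 0"
  shows "abs_op T = P" and polar_isometry_eqI: "polar_isometry T = V"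
proof -
  note Pop = positive_ops[OF P]
  show abs: "abs_op T = P"
  proof (rule abs_op_eqI[OF T P], rule cinner_ext')
    show "cinner y (P (P x)) = cinner y (cadjoint T (T x))" for x y
      using norm_eq_imp_cinner_eq[OF T Pop iso, of y x]
      by (simp add: cinner_cadjoint[OF T] positive_symmetric[OF P, symmetric] flip: cinner_cadjoint[OF T])
  qed
  have null: "null_space V = null_space T"
    using ker iso by (auto simp: null_space_def) (metis norm_eq_zero)+
  show "polar_isometry T = V"
    unfolding polar_isometry_def abs
  proof (rule the_equality)
    show "partial_isometry V \<and> T = V \<circ> P \<and> null_space V = null_space T"
      using partial_isometryI[OF P V _ ker] eq iso null by (simp add: fun_eq_iff)
    fix W assume W: "partial_isometry W \<and> T = W \<circ> P \<and> null_space W = null_space T"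
    then have Wop: "W \<in> bounded_ops" by (simp add: partial_isometry_def)
    have "{x. W x = 0} = {x. V x = 0}" using W null by (simp add: null_space_def)
    then have ker': "P x = 0 \<Longrightarrow> W x = 0" for x using ker by blast
    show "W = V"
      by (rule ops_eqI_range_kernel[OF P Wop V]) (use W eq ker ker' in \<open>auto simp: fun_eq_iff\<close>)
  qed
qed

lemma norm_abs_op:
  assumes T: "T \<in> bounded_ops" shows "norm (T x) = norm (abs_op T x)"
proof -
  have "cinner (abs_op T x) (abs_op T x) = cinner (T x) (T x)"
    by (simp add: positive_symmetric[OF positive_abs_op[OF T]] abs_op_square[OF T]
        flip: cinner_cadjoint[OF T])
  then show ?thesis by (metis cinner_self norm_ge_zero of_real_eq_iff power2_eq_iff_nonneg)
qed

lemma polar: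
  assumes T: "T \<in> bounded_ops"
  shows ops_polar: "polar_isometry T \<in> bounded_ops"
    and polar_abs: "polar_isometry T (abs_op T x) = T x"
    and polar_kernel: "polar_isometry T x = 0 \<longleftrightarrow> abs_op T x = 0"
proof -
  obtain V where V: "V \<in> bounded_ops" "\<And>x. V (abs_op T x) = T x" "\<And>x. V x = 0 \<longleftrightarrow> abs_op T x = 0"
    using polar_exists[OF T positive_abs_op[OF T] norm_abs_op[OF T]] by blast
  have "polar_isometry T = V"
    by (rule polar_isometry_eqI[OF T positive_abs_op[OF T] V(1,2) norm_abs_op[OF T] V(3)])
  then show "polar_isometry T \<in> bounded_ops" "polar_isometry T (abs_op T x) = T x"
    "polar_isometry T x = 0 \<longleftrightarrow> abs_op T x = 0"
    using V by simp_all
qed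

text \<open>
  This is the statement that \<open>V\<^sup>*V\<close> is the projection onto the closure of the range of \<open>|T|\<close>, in the form in
  which it is applied below.
\<close>

lemma polar_initial:
  assumes T: "T \<in> bounded_ops"
  shows "cadjoint (polar_isometry T) (T x) = abs_op T x"
proof -
  let ?V = "polar_isometry T" and ?P = "abs_op T"
  note P = positive_abs_op[OF T] and V = ops_polar[OF T]
  note Pop = positive_ops[OF P] and sym = positive_symmetric[OF P]
  define d where "d = cadjoint ?V (T x) - ?P x"
  have "cinner (T x) (T y) = cinner (?P x) (?P y)" for y
    by (rule norm_eq_imp_cinner_eq[OF T Pop norm_abs_op[OF T]])
  then have "cinner d (?P y) = 0" for y
    by (simp add: d_def cinner_simps cinner_cadjoint'[OF V] polar_abs[OF T])
  then have Pd: "?P d = 0" by (intro cinner_ext) (simp add: sym)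
  then have "?V d = 0" by (simp add: polar_kernel[OF T])
  then have "cinner d d = 0"
    using Pd by (subst (1) d_def) (simp add: cinner_simps cinner_cadjoint'[OF V] sym)
  then show ?thesis by (simp add: d_def)
qed

section \<open>The mean transform\<close>

lemma mean_apply:
  assumes "T \<in> bounded_ops"
  shows "mean_transform T x = (1/2) *\<^sub>C (T x + abs_op T (polar_isometry T x))"
  by (simp add: mean_transform_def polar_abs[OF assms])

lemma mean_double:
  assumes "T \<in> bounded_ops"
  shows "abs_op T (polar_isometry T x) = 2 *\<^sub>C mean_transform T x - T x"
  by (simp add: mean_apply[OF assms])

lemma ops_mean:
  assumes T: "T \<in> bounded_ops" shows "mean_transform T \<in> bounded_ops"
proof -
  have "(\<lambda>x. (1/2) *\<^sub>C (T x + abs_op T (polar_isometry T x))) \<in> bounded_ops"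
    by (rule ops_scaleC, rule ops_add[OF T], rule ops_comp)
      (simp_all add: ops_polar[OF T] positive_ops[OF positive_abs_op[OF T]])
  then show ?thesis by (simp add: mean_apply[OF T, abs_def])
qed

text \<open>
  With \<open>T = VP\<close>, the operator \<open>2V\<^sup>*M(T) = P + V\<^sup>*PV\<close> is a sum of two positive operators, so \<open>P\<close> vanishes
  wherever \<open>M(T)\<close> does.
\<close>

lemma mean_kernel:
  assumes T: "T \<in> bounded_ops" and "mean_transform T x = 0"
  shows "T x = 0"
proof -
  let ?V = "polar_isometry T" and ?P = "abs_op T"
  note P = positive_abs_op[OF T] and V = ops_polar[OF T]
  have "?P (?V x) = - T x" using mean_double[OF T, of x] assms(2) by simp
  then have "cadjoint ?V (?P (?V x)) = - ?P x"
    using polar_initial[OF T, of x] by (simp add: op_minus ops_cadjoint V)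
  then have "cinner (?P (?V x)) (?V x) = - cinner (?P x) x"
    using cinner_cadjoint'[OF V, of "?P (?V x)" x] by simp
  then have "Re (cinner (?P x) x) = 0"
    using positive_ge0[OF P, of x] positive_ge0[OF P, of "?V x"] by simp
  then show ?thesis
    using positive_kernel[OF P, of x] norm_abs_op[OF T, of x] by simp
qed

text \<open>
  Here \<open>T\<close> commutes with \<open>T\<^sup>*T\<close> and thus with \<open>P = |T|\<close>. From \<open>VPP = PVP\<close> one gets that \<open>VP\<close> and \<open>PV\<close> agree
  on the range of \<open>P\<close>; both vanish on its kernel.
\<close>

lemma mean_quasinormal:
  assumes T: "T \<in> bounded_ops" and "\<And>x. T (cadjoint T (T x)) = cadjoint T (T (T x))"
  shows "mean_transform T = T"
proof -
  let ?V = "polar_isometry T" and ?P = "abs_op T"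
  note P = positive_abs_op[OF T] and V = ops_polar[OF T]
  note Pop = positive_ops[OF P]
  have "T (?P x) = ?P (T x)" for x by (rule abs_op_commute[OF T T assms(2)])
  then have "(\<lambda>x. ?V (?P x)) = (\<lambda>x. ?P (?V x))"
    by (intro ops_eqI_range_kernel[OF P ops_comp[OF V Pop] ops_comp[OF Pop V]])
      (simp_all add: polar_abs[OF T] polar_kernel[OF T, THEN iffD2] op_zero V Pop T)
  then have "T x = ?P (?V x)" for x by (metis polar_abs[OF T])
  then show ?thesis
    by (intro ext) (simp add: mean_apply[OF T] complex_vector.scale_right_distrib
        flip: complex_vector.scale_left_distrib)
qed

lemma mean_selfadjoint:
  "T \<in> bounded_ops \<Longrightarrow> (\<And>x y. cinner (T x) y = cinner x (T y)) \<Longrightarrow> mean_transform T = T"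
  by (rule mean_quasinormal) (simp_all add: selfadjoint_iff[THEN iffD2])

lemma mean_zero [simp]: "mean_transform (\<lambda>x. 0) = (\<lambda>x. 0)"
  by (rule mean_selfadjoint) (simp_all add: ops_zero)

text \<open>
  The polar decomposition of \<open>cT\<close> for \<open>c \<noteq> 0\<close> is \<open>((c/|c|)V)(|c|P)\<close>.
\<close>

lemma mean_scaleC:
  assumes T: "T \<in> bounded_ops"
  shows "mean_transform (\<lambda>x. c *\<^sub>C T x) = (\<lambda>x. c *\<^sub>C mean_transform T x)"
proof (cases "c = 0")
  case False
  let ?V = "polar_isometry T" and ?P = "abs_op T"
  note P = positive_abs_op[OF T] and V = ops_polar[OF T]
  note Pop = positive_ops[OF P]
  define cV where "cV = (\<lambda>x. (c / cmod c) *\<^sub>C ?V x)"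
  define cP where "cP = (\<lambda>x. complex_of_real (cmod c) *\<^sub>C ?P x)"
  have cT: "(\<lambda>x. c *\<^sub>C T x) \<in> bounded_ops" by (rule ops_scaleC[OF T])
  have cP: "positive_op cP"
    by (rule positive_opI) (simp_all add: cP_def ops_scaleC Pop cinner_simps
        positive_symmetric[OF P] positive_ge0[OF P, unfolded positive_symmetric[OF P]])
  have "abs_op (\<lambda>x. c *\<^sub>C T x) = cP \<and> polar_isometry (\<lambda>x. c *\<^sub>C T x) = cV"
    using False
    by (intro conjI polar_eqI[OF cT cP, of cV])
      (simp_all add: cV_def cP_def ops_scaleC V op_scaleC polar_abs[OF T] polar_kernel[OF T]
        norm_abs_op[OF T])
  then show ?thesis
    using False by (intro ext)
      (simp add: mean_apply[OF cT] mean_apply[OF T] cV_def cP_def op_scaleC Pop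
        complex_vector.scale_right_distrib mult.commute)
qed simp

subsection \<open>Operators of rank one\<close>

text \<open>
  The polar decomposition of \<open>x \<otimes> y\<close> consists of multiples of \<open>y \<otimes> y\<close> and \<open>x \<otimes> y\<close>.
\<close>

lemma mean_rank_one:
  "mean_transform (rank_one x y) = rank_one ((1/2) *\<^sub>C (x + (cinner x y / (norm y)\<^sup>2) *\<^sub>C y)) y"
proof (cases "x = 0 \<or> y = 0")
  case True
  then show ?thesis by (auto simp: rank_one_def)
next
  case False
  define P where "P = rank_one (complex_of_real (norm x / norm y) *\<^sub>C y) y"
  define V where "V = rank_one (complex_of_real (1 / (norm x * norm y)) *\<^sub>C x) y"
  have P: "positive_op P"
  proof (rule positive_opI)
    show "P \<in> bounded_ops" unfolding P_def by (rule ops_rank_one)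
    show "cinner (P u) v = cinner u (P v)" for u v
      by (simp add: P_def rank_one_def cinner_simps cinner_commute[of v y])
    show "0 \<le> Re (cinner (P u) u)" for u
    proof -
      have "cinner u y * cinner y u = complex_of_real ((cmod (cinner u y))\<^sup>2)"
        by (subst cinner_commute[of y u], subst complex_norm_square) simp
      then have "cinner (P u) u = complex_of_real (norm x / norm y * (cmod (cinner u y))\<^sup>2)"
        by (simp add: P_def rank_one_def cinner_simps mult.left_commute)
      then show ?thesis by simp
    qed
  qed
  have "abs_op (rank_one x y) = P \<and> polar_isometry (rank_one x y) = V"
    using False
    by (intro conjI polar_eqI[OF ops_rank_one P, of V])
      (simp_all add: P_def V_def ops_rank_one, simp_all add: rank_one_def cinner_simps cinner_self
        norm_divide norm_mult power2_eq_square)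
  then show ?thesis
    using False by (intro ext, subst mean_apply[OF ops_rank_one])
      (simp add: P_def V_def rank_one_def cinner_simps complex_vector.scale_right_distrib
        power2_eq_square mult.commute)
qed

lemma rank_one_cancel:
  assumes "b \<noteq> 0" "rank_one x b = rank_one y b" shows "x = y"
proof -
  have "cinner b b *\<^sub>C x = cinner b b *\<^sub>C y" using assms(2) unfolding rank_one_def by metis
  then show ?thesis using assms(1) by (simp only: complex_vector.scale_cancel_left cinner_self_eq_0) simp
qed

text \<open>
  By \<open>mean_kernel\<close> the operator \<open>T\<close> vanishes on the orthogonal complement of \<open>b\<close> when \<open>M(T) = a \<otimes> b\<close>. Hence
  \<open>T\<close> is of the form \<open>t \<otimes> b\<close> and the formula for \<open>M(t \<otimes> b)\<close> can be solved for \<open>t\<close>.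
\<close>

lemma mean_eq_rank_one_imp:
  assumes T: "T \<in> bounded_ops" and mean: "mean_transform T = rank_one a b"
  shows "T = rank_one (2 *\<^sub>C a - (cinner a b / (norm b)\<^sup>2) *\<^sub>C b) b"
proof (cases "b = 0")
  case True
  then have "T x = 0" for x
    by (intro mean_kernel[OF T]) (simp add: mean rank_one_def)
  then show ?thesis using True by (simp add: rank_one_def fun_eq_iff)
next
  case False
  have kernel: "T x = 0" if "cinner x b = 0" for x
    by (rule mean_kernel[OF T]) (simp add: mean rank_one_def that)
  define t where "t = (1 / (norm b)\<^sup>2) *\<^sub>C T b"
  have "T x = rank_one t b x" for x
    using kernel[OF component_orthogonal[OF False, of x]]
    by (simp add: rank_one_def t_def op_simps T)
  then have Tt: "T = rank_one t b" by (rule ext)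
  then have a: "a = (1/2) *\<^sub>C (t + (cinner t b / (norm b)\<^sup>2) *\<^sub>C b)"
    using mean by (intro rank_one_cancel[OF False]) (simp add: mean_rank_one)
  then have "cinner a b = cinner t b"
    using False by (simp add: cinner_simps cinner_self)
  then have "t = 2 *\<^sub>C a - (cinner a b / (norm b)\<^sup>2) *\<^sub>C b"
    by (simp add: a)
  then show ?thesis using Tt by simp
qed

subsection \<open>The trace\<close>

text \<open>
  A relation rather than a function, as the trace is only considered for operators of finite rank. The value is
  read off from an arbitrary representation as a finite sum of operators of rank one; it is shown below
  that the representation does not matter.
\<close>

definition has_trace :: "('a::complex_hilbert \<Rightarrow> 'a) \<Rightarrow> complex \<Rightarrow> bool" where
  "has_trace T t \<longleftrightarrow> (\<exists>ps. (\<forall>z. T z = (\<Sum>(x, y)\<leftarrow>ps. rank_one x y z)) \<and> t = (\<Sum>(x, y)\<leftarrow>ps. cinner x y))"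

lemma has_trace_rank_one: "has_trace (rank_one x y) (cinner x y)"
  unfolding has_trace_def by (rule exI[of _ "[(x, y)]"]) simp

lemma has_trace_add: "has_trace S s \<Longrightarrow> has_trace T t \<Longrightarrow> has_trace (\<lambda>z. S z + T z) (s + t)"
  unfolding has_trace_def
  by (elim exE conjE, rule_tac x = "ps @ psa" in exI) simp

lemma has_trace_scaleC:
  assumes "has_trace T t" shows "has_trace (\<lambda>z. c *\<^sub>C T z) (c * t)"
proof -
  obtain ps where ps: "\<And>z. T z = (\<Sum>(x, y)\<leftarrow>ps. rank_one x y z)" "t = (\<Sum>(x, y)\<leftarrow>ps. cinner x y)"
    using assms unfolding has_trace_def by blast
  have "c *\<^sub>C (\<Sum>(x, y)\<leftarrow>ps. rank_one x y z) = (\<Sum>(x, y)\<leftarrow>map (\<lambda>(x, y). (c *\<^sub>C x, y)) ps. rank_one x y z)"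
    for z by (induction ps) (auto simp: rank_one_def scaleC_add_right mult.commute)
  moreover have "c * (\<Sum>(x, y)\<leftarrow>ps. cinner x y) = (\<Sum>(x, y)\<leftarrow>map (\<lambda>(x, y). (c *\<^sub>C x, y)) ps. cinner x y)"
    by (induction ps) (auto simp: cinner_simps algebra_simps)
  ultimately show ?thesis unfolding has_trace_def ps by blast
qed

lemma has_trace_cyclic:
  assumes S: "S \<in> bounded_ops" and "has_trace T t"
  shows "\<exists>s. has_trace (\<lambda>z. S (T z)) s \<and> has_trace (\<lambda>z. T (S z)) s"
proof -
  obtain ps where ps: "\<And>z. T z = (\<Sum>(x, y)\<leftarrow>ps. rank_one x y z)"
    using assms(2) unfolding has_trace_def by blast
  define s where "s = (\<Sum>(x, y)\<leftarrow>ps. cinner (S x) y)"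
  have "S (\<Sum>(x, y)\<leftarrow>ps. rank_one x y z) = (\<Sum>(x, y)\<leftarrow>map (\<lambda>(x, y). (S x, y)) ps. rank_one x y z)" for z
    by (induction ps) (auto simp: rank_one_def op_simps S)
  moreover have "s = (\<Sum>(x, y)\<leftarrow>map (\<lambda>(x, y). (S x, y)) ps. cinner x y)"
    unfolding s_def by (induction ps) auto
  ultimately have "has_trace (\<lambda>z. S (T z)) s" unfolding has_trace_def ps by blast
  moreover have "(\<Sum>(x, y)\<leftarrow>ps. rank_one x y (S z)) =
      (\<Sum>(x, y)\<leftarrow>map (\<lambda>(x, y). (x, cadjoint S y)) ps. rank_one x y z)" for z
    by (induction ps) (auto simp: rank_one_def cinner_cadjoint S)
  moreover have "s = (\<Sum>(x, y)\<leftarrow>map (\<lambda>(x, y). (x, cadjoint S y)) ps. cinner x y)"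
    unfolding s_def by (induction ps) (auto simp: cinner_cadjoint S)
  ultimately show ?thesis unfolding has_trace_def ps by blast
qed

text \<open>
  Testing \<open>\<Sum> x\<^sub>i \<otimes> y\<^sub>i = 0\<close> on a multiple of \<open>y\<^sub>1 \<noteq> 0\<close> expresses \<open>x\<^sub>1\<close> through the remaining \<open>x\<^sub>i\<close>;
  substituting this back leaves a shorter sum of the same kind with the same trace.
\<close>

lemma trace_list_zero:
  fixes ps :: "('a::complex_hilbert \<times> 'a) list"
  assumes "\<And>z. (\<Sum>(x, y)\<leftarrow>ps. rank_one x y z) = 0"
  shows "(\<Sum>(x, y)\<leftarrow>ps. cinner x y) = 0"
  using assms
proof (induction "length ps" arbitrary: ps)
  case (Suc n)
  then obtain x y qs where ps: "ps = (x, y) # qs" "length qs = n"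
    by (metis length_Suc_conv surj_pair)
  show ?case
  proof (cases "y = 0")
    case True
    have "(\<Sum>(x, y)\<leftarrow>qs. cinner x y) = 0"
      by (rule Suc.hyps(1)) (use ps Suc.prems True in \<open>simp_all add: rank_one_def\<close>)
    then show ?thesis by (simp add: ps True)
  next
    case False
    define w where "w = (1 / (norm y)\<^sup>2) *\<^sub>C y"
    have "cinner w y = 1" using False by (simp add: w_def cinner_simps cinner_self)
    then have x: "x = - (\<Sum>(u, v)\<leftarrow>qs. rank_one u v w)"
      using Suc.prems[of w] by (simp add: ps rank_one_def eq_neg_iff_add_eq_0)
    let ?f = "\<lambda>(u, v). (u, v - cnj (cinner w v) *\<^sub>C y)"
    have "(\<Sum>(u, v)\<leftarrow>map ?f qs. rank_one u v z)
        = (\<Sum>(u, v)\<leftarrow>qs. rank_one u v z) - cinner z y *\<^sub>C (\<Sum>(u, v)\<leftarrow>qs. rank_one u v w)" for z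
      by (induction qs) (auto simp: rank_one_def cinner_simps algebra_simps
          complex_vector.scale_left_diff_distrib scaleC_add_right)
    then have "(\<Sum>(u, v)\<leftarrow>map ?f qs. rank_one u v z) = 0" for z
      using Suc.prems[of z] by (simp add: ps x rank_one_def add.commute)
    then have "(\<Sum>(u, v)\<leftarrow>map ?f qs. cinner u v) = 0"
      by (intro Suc.hyps(1)) (simp_all add: ps)
    moreover have "(\<Sum>(u, v)\<leftarrow>map ?f qs. cinner u v)
        = (\<Sum>(u, v)\<leftarrow>qs. cinner u v) - cinner (\<Sum>(u, v)\<leftarrow>qs. rank_one u v w) y"
      by (induction qs) (auto simp: rank_one_def cinner_simps algebra_simps)
    ultimately show ?thesis by (simp add: ps x)
  qed
qed simp

lemma has_trace_unique:
  fixes T :: "'a::complex_hilbert \<Rightarrow> 'a"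
  assumes "has_trace T s" "has_trace T t" shows "s = t"
proof -
  have "has_trace (\<lambda>z. T z + (-1) *\<^sub>C T z) (s + (-1) * t)"
    by (intro has_trace_add has_trace_scaleC assms)
  then have "has_trace (\<lambda>z::'a. 0) (s - t)" by simp
  then show ?thesis using trace_list_zero unfolding has_trace_def by (metis right_minus_eq)
qed

text \<open>
  The mean transform of \<open>T = VP\<close> is the average of \<open>VP\<close> and \<open>PV\<close>, which have the same trace.
\<close>

lemma has_trace_mean:
  assumes T: "T \<in> bounded_ops" and t: "has_trace T t"
  shows "has_trace (mean_transform T) t"
proof -
  let ?V = "polar_isometry T" and ?P = "abs_op T"
  have "\<exists>p. has_trace (\<lambda>z. cadjoint ?V (T z)) p"
    using has_trace_cyclic[OF ops_cadjoint[OF ops_polar[OF T]] t] by blast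
  then obtain p where "has_trace ?P p" by (auto simp: polar_initial[OF T])
  then obtain s where "has_trace (\<lambda>z. ?V (?P z)) s" "has_trace (\<lambda>z. ?P (?V z)) s"
    using has_trace_cyclic[OF ops_polar[OF T]] by blast
  moreover from this(1) have "s = t" by (intro has_trace_unique[OF _ t]) (simp add: polar_abs[OF T])
  ultimately have "has_trace (\<lambda>z. (1/2) *\<^sub>C (T z + ?P (?V z))) (1/2 * (t + t))"
    by (intro has_trace_scaleC has_trace_add t) simp
  then show ?thesis by (simp add: mean_apply[OF T, abs_def])
qed

subsection \<open>Solutions of \<open>A = M(A\<^sup>2)\<close>\<close>

text \<open>
  Let \<open>A\<^sup>2 = VP\<close> be the polar decomposition, so that \<open>2A = VP + PV\<close> and hence \<open>PV = 2A - A\<^sup>2\<close>. Put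
  \<open>E = V\<^sup>*V\<close>. Two expressions for one operator, \<open>PVP = (A\<^sup>*)\<^sup>2P = PV\<^sup>*P\<close>, show that the compression
  \<open>W = EV\<close> of \<open>V\<close> is self-adjoint. Then \<open>P\<^sup>2W = P(2A - A\<^sup>2)\<close> turns out to be self-adjoint, that is, \<open>W\<close>
  commutes with \<open>P\<^sup>2\<close>, and so with \<open>P\<close>. With these commutation relations the equation for \<open>A\<close> can be
  solved: \<open>P = W = E\<close>, then \<open>V = E\<close>, and finally \<open>A = E\<close>.
\<close>

lemma mean_square_fixed_projection:
  fixes A :: "'a::complex_hilbert \<Rightarrow> 'a"
  assumes A: "A \<in> bounded_ops" and fixed: "mean_transform (\<lambda>x. A (A x)) = A"
  shows "cinner (A x) y = cinner x (A y)" and "A (A x) = A x"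
proof -
  define T where "T = (\<lambda>x. A (A x))"
  have T: "T \<in> bounded_ops" unfolding T_def by (rule ops_comp[OF A A])
  define V where "V = polar_isometry T"
  define P where "P = abs_op T"
  define V' where "V' = cadjoint V"
  define A' where "A' = cadjoint A"
  define E where "E = (\<lambda>x. V' (V x))"
  define W where "W = (\<lambda>x. E (V x))"
  have P: "positive_op P" unfolding P_def by (rule positive_abs_op[OF T])
  have ops: "V \<in> bounded_ops" "P \<in> bounded_ops" "V' \<in> bounded_ops" "A' \<in> bounded_ops" "A \<in> bounded_ops"
    unfolding V_def A'_def P_def V'_def
    using A T by (auto intro: ops_polar ops_cadjoint positive_ops positive_abs_op)
  have Eop: "E \<in> bounded_ops" unfolding E_def by (rule ops_comp) (rule ops)+
  have Wop: "W \<in> bounded_ops" unfolding W_def by (rule ops_comp) (rule ops Eop)+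
  note ops = ops Eop Wop
  have VP: "V (P x) = A (A x)" for x
    using polar_abs[OF T] by (simp add: V_def P_def T_def)
  have ker: "V x = 0 \<longleftrightarrow> P x = 0" for x unfolding V_def P_def by (rule polar_kernel[OF T])
  have PV: "P (V x) = 2 *\<^sub>C A x - A (A x)" for x
    using mean_double[OF T, of x] fixed by (simp add: V_def P_def T_def)
  have V'T: "V' (A (A x)) = P x" for x
    using polar_initial[OF T, of x] by (simp add: V_def V'_def P_def T_def)
  have adjV: "cinner (V x) y = cinner x (V' y)" "cinner (V' x) y = cinner x (V y)" for x y
    unfolding V'_def by (simp_all add: cinner_cadjoint cinner_cadjoint' ops)
  have adjA: "cinner (A x) y = cinner x (A' y)" "cinner (A' x) y = cinner x (A y)" for x y
    unfolding A'_def by (simp_all add: cinner_cadjoint cinner_cadjoint' ops)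
  have symP: "cinner (P x) y = cinner x (P y)" for x y by (rule positive_symmetric[OF P])
  have symE: "cinner (E x) y = cinner x (E y)" for x y by (simp add: E_def adjV)

  \<comment> \<open>\<open>Z = V\<^sup>*A = (P + V\<^sup>*PV)/2\<close> is self-adjoint and \<open>ZA = V\<^sup>*A\<^sup>2 = P\<close>, which makes \<open>PA\<close> and
    \<open>PA\<^sup>2\<close> self-adjoint.\<close>
  define Z where "Z = (\<lambda>x. V' (A x))"
  have A2: "A x = (1/2) *\<^sub>C (V (P x) + P (V x))" for x by (simp add: PV VP)
  have "Z x = (1/2) *\<^sub>C (P x + V' (P (V x)))" for x
    unfolding Z_def by (subst A2) (simp add: op_simps ops VP V'T)
  then have symZ: "cinner (Z x) y = cinner x (Z y)" for x y
    by (simp add: cinner_simps adjV symP)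
  have A'Z: "A' (Z x) = P x" for x
    by (rule cinner_ext) (simp add: adjA symZ symP, simp add: Z_def V'T)
  have PA: "P (A x) = A' (P x)" for x
    using A'Z[of "A x"] by (simp add: Z_def V'T)
  have A'A': "A' (A' x) = P (V' x)" for x
    by (rule cinner_ext) (simp add: adjA symP adjV VP)

  \<comment> \<open>Both \<open>PVP = PA\<^sup>2\<close> and \<open>PV\<^sup>*P = (A\<^sup>*)\<^sup>2P\<close> are the same operator.\<close>
  have PVP: "P (V (P x)) = P (V' (P x))" for x by (simp add: VP PA flip: A'A')
  have EP: "E (P x) = P x" for x by (simp add: E_def VP V'T)
  have PE: "P (E x) = P x" for x by (rule cinner_ext) (simp add: symP symE EP)
  have "(\<lambda>x. V (E x)) = V"
    by (rule ops_eqI_range_kernel[OF P ops_comp[OF ops(1) Eop] ops(1)])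
      (simp add: EP, simp add: E_def op_zero ops flip: ker)
  then have VE: "V (E x) = V x" for x by metis
  have EV': "E (V' x) = V' x" for x by (rule cinner_ext) (simp add: symE adjV VE)
  have EE: "E (E x) = E x" for x unfolding E_def using EV' by (simp add: E_def)
  have cancel: "E d = 0" if "P d = 0" for d using that by (simp add: E_def op_zero ops flip: ker)
  have "(\<lambda>x. P (V x)) = (\<lambda>x. P (V' (E x)))"
    by (rule ops_eqI_range_kernel[OF P ops_comp[OF ops(2,1)] ops_comp[OF ops(2) ops_comp[OF ops(3) Eop]]])
      (simp_all add: EP PVP cancel, simp_all add: op_zero ops flip: ker)
  then have "P (V x - V' (E x)) = 0" for x by (simp add: op_diff ops fun_eq_iff)
  then have WE: "W x = V' (E x)" for x
    using cancel[of "V x - V' (E x)"] by (simp add: W_def op_diff ops EV')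
  have symW: "cinner (W x) y = cinner x (W y)" for x y
    by (subst WE) (simp add: adjV symE W_def)
  have PW: "P (W x) = P (V x)" for x by (simp add: W_def PE)
  have "P (P (W x)) = W (P (P x))" for x
  proof (rule cinner_ext)
    fix y
    have PPW: "P (P (W x)) = 2 *\<^sub>C P (A x) - P (A (A x))" for x
      by (simp add: PW PV op_simps ops)
    have "cinner (P (P (W x))) y = cinner x (P (P (W y)))"
      unfolding PPW by (simp add: cinner_simps adjA symP PA)
    then show "cinner (P (P (W x))) y = cinner (W (P (P x))) y" by (simp add: symW symP)
  qed
  then have WP: "W (P x) = P (W x)" for x by (intro positive_commute_square[OF P Wop]) simp

  \<comment> \<open>Everything now commutes on the range of \<open>E\<close>, and the equation can be solved there.\<close>
  have EW: "E (W x) = W x" for x by (simp add: W_def EE)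
  have WE': "W (E x) = W x" for x by (simp add: W_def VE)
  have V'W: "V' (W x) = W (W x)" for x by (simp add: WE[of "W x"] EW)
  have A2': "A x = (1/2) *\<^sub>C (V (P x) + W (P x))" for x by (simp add: A2[of x] WP PW)
  have "E (A x) = W (P x)" for x
  proof -
    have "E (A x) = (1/2) *\<^sub>C (W (P x) + W (P x))"
      by (subst A2') (simp add: op_simps ops EW, simp add: W_def)
    then show ?thesis by (simp add: scaleC_add_right flip: scaleC_add_left)
  qed
  then have PAx: "P (A x) = W (P (P x))" for x by (metis PE WP)
  have "2 *\<^sub>C P x = W (P (P x)) + W (W (W (P (P x))))" for x
  proof -
    have "P x = V' (A (A x))" by (simp add: V'T)
    also have "\<dots> = (1/2) *\<^sub>C (P (A x) + V' (P (V (A x))))"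
      by (subst A2[of "A x"]) (simp add: op_simps ops VP V'T)
    also have "P (V (A x)) = W (W (P (P x)))" by (simp add: PW[symmetric] WP[symmetric] PAx)
    finally have "P x = (1/2) *\<^sub>C (W (P (P x)) + W (W (W (P (P x)))))" by (simp add: PAx V'W)
    then have "2 *\<^sub>C P x = 2 *\<^sub>C ((1/2) *\<^sub>C (W (P (P x)) + W (W (W (P (P x))))))" by metis
    then show ?thesis by simp
  qed
  then have "P (2 *\<^sub>C x - (W (P x) + W (W (W (P x))))) = 0" for x
    by (simp add: op_simps ops WP)
  then have E1: "2 *\<^sub>C E x = W (P x) + W (W (W (P x)))" for x
    using cancel[of "2 *\<^sub>C x - (W (P x) + W (W (W (P x))))"] by (simp add: op_simps ops EW)
  have W_cancel: "E u = 0" if "W u = 0" for u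
    using E1[of u] that by (simp add: WP op_zero ops)
  have WPP: "W (W (P (P x))) = W (P x)" for x
  proof -
    have "A (A x) = (1/2) *\<^sub>C (V (P (A x)) + W (P (A x)))" by (rule A2')
    then have "E (V (P x)) = (1/2) *\<^sub>C (E (V (W (P (P x)))) + E (W (W (P (P x)))))"
      by (simp add: VP PAx op_simps ops)
    then have "W (P x) = (1/2) *\<^sub>C (W (W (P (P x))) + W (W (P (P x))))"
      unfolding EW by (simp add: W_def)
    then show ?thesis by (simp add: scaleC_add_right flip: scaleC_add_left)
  qed
  have "E (P x - W (P (P x))) = 0" for x by (rule W_cancel) (simp add: op_diff ops WPP)
  then have "P (x - W (P x)) = 0" for x by (simp add: op_diff ops EP EW WP)
  then have "E (x - W (P x)) = 0" for x by (intro cancel)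
  then have E2: "E x = W (P x)" for x by (simp add: op_diff ops EW)
  have WW: "W (W x) = E x" for x
  proof -
    have "2 *\<^sub>C E x = E x + W (W (E x))" using E1[of x] by (simp add: E2[of x])
    then show ?thesis
      using scaleC_add_left[of 1 1 "E x"] by (simp add: WE' scaleC_one)
  qed
  have WisP: "W x = P x" for x by (metis WE' E2 WW EP)
  have PisE: "P x = E x" for x
  proof -
    define z where "z = P x - E x"
    have "P (P x) = E x" by (metis E2 WisP)
    then have "P z = - z" by (simp add: z_def op_diff ops PE)
    then have "cinner (P z) z = - cinner z z" by simp
    then have "z = 0" using positive_ge0[OF P, of z] by (simp add: cinner_self)
    then show ?thesis by (simp add: z_def)
  qed
  have EV: "E (V x) = E x" for x using WisP[of x] PisE[of x] by (simp add: W_def)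
  have VisE: "V x = E x" for x
  proof -
    have "cinner (V x) (V x) = cinner x (E x)" by (simp add: E_def adjV)
    moreover have "cinner (V x) (E x) = cinner (E (V x)) x" "cinner (E x) (V x) = cinner x (E (V x))"
      "cinner (E x) (E x) = cinner x (E (E x))" "cinner (E x) x = cinner x (E x)"
      by (simp_all only: symE)
    ultimately have "cinner (V x - E x) (V x - E x) = 0"
      by (simp add: cinner_simps EV EE)
    then show ?thesis by simp
  qed
  have "A x = E x" for x
    by (subst A2) (simp add: PisE VisE EE scaleC_add_right flip: scaleC_add_left)
  then show "cinner (A x) y = cinner x (A y)" "A (A x) = A x" by (simp_all add: symE EE)
qed

section \<open>Unitary and anti-unitary conjugation\<close>

definition symmetry_op :: "('a::complex_hilbert \<Rightarrow> 'b::complex_hilbert) \<Rightarrow> bool" where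
  "symmetry_op U \<longleftrightarrow> unitary_op U \<or> antiunitary_op U"

lemma symmetry_opE:
  assumes "symmetry_op U"
  obtains \<tau> where "\<tau> = (\<lambda>c. c) \<or> \<tau> = cnj" "\<And>c x. U (c *\<^sub>C x) = \<tau> c *\<^sub>C U x"
    "\<And>x y. cinner (U x) (U y) = \<tau> (cinner x y)"
  using assms unitary_cinner[of U] antiunitary_cinner[of U]
  unfolding symmetry_op_def unitary_op_def antiunitary_op_def by metis

lemma symmetry_op:
  assumes "symmetry_op U"
  shows symmetry_add: "U (x + y) = U x + U y" and symmetry_norm: "norm (U x) = norm x"
    and symmetry_surj: "surj U" and symmetry_bij: "bij U"
proof -
  show add: "U (x + y) = U x + U y" and norm: "norm (U x) = norm x" and surj: "surj U" for x y
    using assms by (auto simp: symmetry_op_def unitary_op_def antiunitary_op_def)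
  have "x = y" if "U x = U y" for x y
    using add[of "x - y" y] norm[of "x - y"] that by simp
  then show "bij U" using surj by (simp add: bij_def inj_def)
qed

lemma symmetry_inv_f: "symmetry_op U \<Longrightarrow> U (inv U y) = y" "symmetry_op U \<Longrightarrow> inv U (U x) = x"
  by (simp_all add: symmetry_surj surj_f_inv_f bij_is_inj symmetry_bij)

lemma symmetry_inv:
  assumes U: "symmetry_op U" shows "symmetry_op (inv U)"
proof -
  note [simp] = symmetry_inv_f[OF U]
  have inj: "x = y" if "U x = U y" for x y by (metis symmetry_inv_f(2)[OF U] that)
  have add: "inv U (x + y) = inv U x + inv U y" for x y
    by (rule inj) (simp add: symmetry_add[OF U])
  have norm: "norm (inv U x) = norm x" for x using symmetry_norm[OF U, of "inv U x"] by simp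
  have surj: "surj (inv U)" by (metis symmetry_inv_f(2)[OF U] surjI)
  obtain \<tau> where \<tau>: "\<tau> = (\<lambda>c. c) \<or> \<tau> = cnj" "\<And>c x. U (c *\<^sub>C x) = \<tau> c *\<^sub>C U x"
    using symmetry_opE[OF U] by metis
  have scale: "inv U (c *\<^sub>C x) = \<tau> c *\<^sub>C inv U x" for c x
    by (rule inj) (use \<tau>(1) in \<open>auto simp: \<tau>(2)\<close>)
  show ?thesis
    using add norm surj scale \<tau>(1) by (auto simp: symmetry_op_def unitary_op_def antiunitary_op_def)
qed

definition conj_by :: "('a \<Rightarrow> 'b) \<Rightarrow> ('a \<Rightarrow> 'a) \<Rightarrow> 'b \<Rightarrow> 'b" where
  "conj_by U T = U \<circ> T \<circ> inv U"

lemma conj_by_inv: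
  assumes "symmetry_op U"
  shows "conj_by (inv U) (conj_by U S) = S" "conj_by U (conj_by (inv U) T) = T"
  by (simp_all add: conj_by_def fun_eq_iff symmetry_inv_f[OF assms] inv_inv_eq[OF symmetry_bij[OF assms]])

lemma ops_conj_by:
  assumes U: "symmetry_op U" and T: "T \<in> bounded_ops"
  shows "conj_by U T \<in> bounded_ops"
proof -
  obtain K where "\<And>x. norm (T x) \<le> K * norm x" using op_bound[OF T] by metis
  then have bound: "norm (conj_by U T x) \<le> norm x * K" for x
    using symmetry_norm[OF symmetry_inv[OF U], of x]
    by (simp add: conj_by_def symmetry_norm[OF U]) (metis mult.commute)
  obtain \<tau> where \<tau>: "\<tau> = (\<lambda>c. c) \<or> \<tau> = cnj" "\<And>c x. U (c *\<^sub>C x) = \<tau> c *\<^sub>C U x"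
    using symmetry_opE[OF U] by metis
  have inv: "inv U (c *\<^sub>C x) = \<tau> c *\<^sub>C inv U x" for c x
    using \<tau>(1) \<tau>(2)[of "\<tau> c" "inv U x"] symmetry_inv_f[OF U] by (metis complex_cnj_cnj)
  show ?thesis
    by (rule bounded_opsI[OF _ _ bound])
      (use \<tau>(1) in \<open>auto simp: conj_by_def inv \<tau>(2) op_simps T symmetry_add[OF U]
        symmetry_add[OF symmetry_inv[OF U]]\<close>)
qed

lemma jordan_conj_by:
  assumes U: "symmetry_op U"
  shows "conj_by U A \<bullet>\<^sub>J conj_by U B = conj_by U (A \<bullet>\<^sub>J B)"
proof -
  obtain \<tau> where "\<tau> = (\<lambda>c. c) \<or> \<tau> = cnj" "\<And>c x. U (c *\<^sub>C x) = \<tau> c *\<^sub>C U x"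
    using symmetry_opE[OF U] by metis
  then show ?thesis
    by (auto simp: jordan_product_def conj_by_def fun_eq_iff symmetry_inv_f[OF U] symmetry_add[OF U])
qed

lemma rank_one_conj_by:
  assumes U: "symmetry_op U"
  shows "conj_by U (rank_one x y) = rank_one (U x) (U y)"
proof
  fix z
  obtain \<tau> where \<tau>: "\<And>c x. U (c *\<^sub>C x) = \<tau> c *\<^sub>C U x" "\<And>x y. cinner (U x) (U y) = \<tau> (cinner x y)"
    using symmetry_opE[OF U] by metis
  show "conj_by U (rank_one x y) z = rank_one (U x) (U y) z"
    using \<tau>(2)[of "inv U z" y] by (simp add: conj_by_def rank_one_def \<tau>(1) symmetry_inv_f[OF U])
qed

text \<open>Both parts of the polar decomposition are carried along by conjugation.\<close>

lemma mean_conj_by: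
  assumes U: "symmetry_op U" and T: "T \<in> bounded_ops"
  shows "mean_transform (conj_by U T) = conj_by U (mean_transform T)"
proof -
  let ?V = "polar_isometry T" and ?P = "abs_op T"
  note P = positive_abs_op[OF T] and V = ops_polar[OF T] and cT = ops_conj_by[OF U T]
  obtain \<tau> where \<tau>: "\<tau> = (\<lambda>c. c) \<or> \<tau> = cnj" "\<And>c x. U (c *\<^sub>C x) = \<tau> c *\<^sub>C U x"
    "\<And>x y. cinner (U x) (U y) = \<tau> (cinner x y)"
    using symmetry_opE[OF U] by metis
  have Re: "Re (\<tau> c) = Re c" for c using \<tau>(1) by auto
  have half: "\<tau> (1/2) = 1/2" using \<tau>(1) by auto
  have inner: "cinner (U x) y = \<tau> (cinner x (inv U y))" "cinner y (U x) = \<tau> (cinner (inv U y) x)" for x y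
    using \<tau>(3)[of x "inv U y"] \<tau>(3)[of "inv U y" x] by (simp_all add: symmetry_inv_f[OF U])
  have zero: "U x = 0 \<longleftrightarrow> x = 0" for x by (metis symmetry_norm[OF U] norm_eq_zero)
  have cP: "positive_op (conj_by U ?P)"
  proof (rule positive_opI)
    show "conj_by U ?P \<in> bounded_ops" by (rule ops_conj_by[OF U positive_ops[OF P]])
    show "cinner (conj_by U ?P x) y = cinner x (conj_by U ?P y)" for x y
      by (simp add: conj_by_def inner positive_symmetric[OF P])
    show "0 \<le> Re (cinner (conj_by U ?P x) x)" for x
      using positive_ge0[OF P, of "inv U x"] by (simp add: conj_by_def inner Re)
  qed
  have "abs_op (conj_by U T) = conj_by U ?P \<and> polar_isometry (conj_by U T) = conj_by U ?V"
    by (intro conjI polar_eqI[OF cT cP ops_conj_by[OF U V]])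
      (simp_all add: conj_by_def symmetry_inv_f[OF U] polar_abs[OF T] polar_kernel[OF T] zero
        norm_abs_op[OF T] symmetry_norm[OF U])
  then show ?thesis
    by (intro ext, simp add: mean_apply[OF cT], simp add: mean_apply[OF T] conj_by_def
        symmetry_inv_f[OF U] symmetry_add[OF U] \<tau>(2) half)
qed

section \<open>Wigner's theorem\<close>

text \<open>
  Fix a unit vector \<open>e\<close>. The phase of the image of \<open>e + z\<close>, where \<open>z\<close> is orthogonal to \<open>e\<close>, can be
  normalised so that this image is \<open>G e + T z\<close> with \<open>T z\<close> orthogonal to \<open>G e\<close>. Both
  \<open>|1 + \<langle>z, w\<rangle>|\<close> and \<open>|\<langle>z, w\<rangle>|\<close> are preserved by \<open>T\<close>, so the real part of the inner product is
  preserved as well and \<open>T\<close> is additive. Moreover \<open>T (iz) = \<plusminus>i T z\<close>; an additive group not being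
  the union of two proper subgroups, the sign does not depend on \<open>z\<close>.
\<close>

theorem wigner:
  fixes G :: "'a::complex_hilbert \<Rightarrow> 'b::complex_hilbert" and e :: 'a
  assumes G: "\<And>z w. cmod (cinner (G z) (G w)) = cmod (cinner z w)"
    and surj: "\<And>y. \<exists>x c. y = c *\<^sub>C G x" and e: "norm e = 1"
  shows "\<exists>U. symmetry_op U \<and> (\<forall>z. \<exists>c. U z = c *\<^sub>C G z)"
proof -
  have G_norm: "norm (G z) = norm z" for z
  proof -
    have "(norm (G z))\<^sup>2 = (norm z)\<^sup>2" using G[of z z] by (simp add: cinner_self norm_power)
    then show ?thesis by simp
  qed
  have parallel: "\<exists>c. u = c *\<^sub>C v" if "cmod (cinner u v) = norm u * norm v" "v \<noteq> 0" for u v :: 'b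
    using cauchy_schwarz_equality[OF that] by blast
  define e' where "e' = G e"
  have e': "norm e' = 1" by (simp add: e'_def G_norm e)
  have ee: "cinner e e = 1" "cinner e' e' = 1" by (simp_all add: cinner_self e e')
  define N where "N = {z. cinner z e = 0}"
  have N0: "cinner e z = 0" if "z \<in> N" for z using that cinner_0_commute by (auto simp: N_def)
  have N_add: "z + w \<in> N" and N_scale: "c *\<^sub>C z \<in> N" if "z \<in> N" "w \<in> N" for z w c
    using that by (simp_all add: N_def cinner_simps)
  define T where "T z = (1 / cinner (G (e + z)) e') *\<^sub>C G (e + z) - e'" for z
  define \<omega> where "\<omega> z = 1 / cinner (G (e + z)) e'" for z
  have phase: "cmod (\<omega> z) = 1" if "z \<in> N" for z
    using that by (simp add: \<omega>_def e'_def G norm_divide cinner_simps ee N_def)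
  have T: "e' + T z = \<omega> z *\<^sub>C G (e + z)" for z by (simp add: T_def \<omega>_def)
  have T_orth: "cinner (T z) e' = 0" "cinner e' (T z) = 0" if "z \<in> N" for z
  proof -
    have "cinner (G (e + z)) e' \<noteq> 0" using phase[OF that] unfolding \<omega>_def by auto
    then show "cinner (T z) e' = 0" by (simp add: T_def cinner_simps ee)
    then show "cinner e' (T z) = 0" using cinner_0_commute by blast
  qed
  have inner1: "cmod (1 + cinner (T z) (T w)) = cmod (1 + cinner z w)" if "z \<in> N" "w \<in> N" for z w
  proof -
    have "1 + cinner (T z) (T w) = cinner (e' + T z) (e' + T w)"
      by (simp add: cinner_simps ee T_orth that)
    also have "cmod \<dots> = cmod (cinner (e + z) (e + w))"
      unfolding T by (simp add: cinner_simps norm_mult phase that G)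
    also have "cinner (e + z) (e + w) = 1 + cinner z w"
      using that by (simp add: cinner_simps ee N0) (simp add: N_def)
    finally show ?thesis .
  qed
  have T_norm: "norm (T z) = norm z" if "z \<in> N" for z
  proof -
    have "cmod (1 + (norm (T z))\<^sup>2) = cmod (1 + (norm z)\<^sup>2)"
      using inner1[OF that that] by (simp add: cinner_self)
    then have "1 + (norm (T z))\<^sup>2 = 1 + (norm z)\<^sup>2"
      by (metis abs_of_nonneg add_nonneg_nonneg norm_of_real of_real_1 of_real_add zero_le_one zero_le_power2)
    then show ?thesis by simp
  qed
  have T_ray: "\<exists>c. cmod c = 1 \<and> T z = c *\<^sub>C G z" if z: "z \<in> N" for z
  proof (cases "z = 0")
    case True
    then show ?thesis using T_norm[OF z] G_norm[of z] by (intro exI[of _ 1]) simp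
  next
    case False
    have "cinner e' (G z) = 0" using G[of e z] N0[OF z] by (simp add: e'_def)
    then have "cinner (T z) (G z) = cinner (e' + T z) (G z)" by (simp add: cinner_simps)
    also have "cmod \<dots> = cmod (cinner (e + z) z)"
      unfolding T by (simp add: cinner_simps norm_mult phase z G)
    also have "\<dots> = norm (T z) * norm (G z)"
      using N0[OF z] by (simp add: cinner_simps cinner_self norm_mult T_norm z G_norm power2_eq_square)
    finally obtain c where c: "T z = c *\<^sub>C G z"
      using parallel[of "T z" "G z"] False by (metis G_norm norm_eq_zero)
    have "cmod c = 1" using T_norm[OF z] False unfolding c by (simp add: G_norm)
    then show ?thesis using c by blast
  qed
  have inner2: "cmod (cinner (T z) (T w)) = cmod (cinner z w)" if "z \<in> N" "w \<in> N" for z w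
    using T_ray[OF that(1)] T_ray[OF that(2)] G[of z w] by (auto simp: cinner_simps norm_mult)
  have T_Re: "Re (cinner (T z) (T w)) = Re (cinner z w)" if "z \<in> N" "w \<in> N" for z w
  proof -
    have "(cmod (1 + a))\<^sup>2 = 1 + (cmod a)\<^sup>2 + 2 * Re a" for a
      unfolding cmod_power2 by (simp add: power2_eq_square algebra_simps)
    from this[of "cinner (T z) (T w)"] this[of "cinner z w"] show ?thesis
      unfolding inner1[OF that] inner2[OF that] by linarith
  qed
  have T_add: "T (z + w) = T z + T w" if "z \<in> N" "w \<in> N" for z w
  proof -
    have "(norm (T (z + w) - (T z + T w)))\<^sup>2 = (norm ((z + w) - (z + w)))\<^sup>2"
      using T_norm[OF N_add[OF that]] T_norm[OF that(1)] T_norm[OF that(2)]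
        T_Re[OF that] T_Re[OF N_add[OF that] that(1)] T_Re[OF N_add[OF that] that(2)]
      unfolding norm_diff_cinner by (simp add: Re_cinner_norm cinner_add_right)
    then show ?thesis by simp
  qed
  have T_scaleR: "T (of_real r *\<^sub>C z) = of_real r *\<^sub>C T z" if "z \<in> N" for r z
  proof -
    have rz: "of_real r *\<^sub>C z \<in> N" by (rule N_scale[OF that that])
    have "(norm (T (of_real r *\<^sub>C z) - of_real r *\<^sub>C T z))\<^sup>2 = (norm (of_real r *\<^sub>C z - of_real r *\<^sub>C z))\<^sup>2"
      using T_norm[OF rz] T_norm[OF that] T_Re[OF rz that]
      unfolding norm_diff_cinner by (simp add: cinner_simps)
    then show ?thesis by simp
  qed
  have T_i: "T (\<i> *\<^sub>C z) = \<i> *\<^sub>C T z \<or> T (\<i> *\<^sub>C z) = - \<i> *\<^sub>C T z" if z: "z \<in> N" for z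
  proof (cases "z = 0")
    case True
    then show ?thesis using T_norm[OF z] T_norm[OF N_scale[OF z z, of \<i>]] by simp
  next
    case False
    note iz = N_scale[OF z z, of \<i>]
    have "cmod (cinner (T (\<i> *\<^sub>C z)) (T z)) = norm (T (\<i> *\<^sub>C z)) * norm (T z)"
      by (simp add: inner2[OF iz z] T_norm iz z cinner_simps cinner_self norm_mult power2_eq_square)
    then obtain c where c: "T (\<i> *\<^sub>C z) = c *\<^sub>C T z"
      using parallel T_norm[OF z] False by (metis norm_eq_zero)
    have "Re c * (norm z)\<^sup>2 = 0"
      using T_Re[OF iz z] unfolding c by (simp add: cinner_simps cinner_self T_norm z flip: of_real_power)
    moreover have "cmod c = 1"
      using T_norm[OF iz] False unfolding c by (simp add: T_norm z)
    ultimately have "Re c = 0" "\<bar>Im c\<bar> = 1" using False by (simp_all add: cmod_def)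
    then have "c = \<i> \<or> c = - \<i>" by (auto simp: complex_eq_iff abs_if split: if_splits)
    then show ?thesis using c by auto
  qed
  have "(\<forall>z\<in>N. T (\<i> *\<^sub>C z) = \<i> *\<^sub>C T z) \<or> (\<forall>z\<in>N. T (\<i> *\<^sub>C z) = - \<i> *\<^sub>C T z)"
  proof (rule ccontr)
    assume "\<not> ?thesis"
    then obtain z w where zw: "z \<in> N" "T (\<i> *\<^sub>C z) \<noteq> \<i> *\<^sub>C T z" "w \<in> N" "T (\<i> *\<^sub>C w) \<noteq> - \<i> *\<^sub>C T w"
      by blast
    then have "T (\<i> *\<^sub>C z) = - \<i> *\<^sub>C T z" "T (\<i> *\<^sub>C w) = \<i> *\<^sub>C T w" using T_i by blast+
    moreover have "T (\<i> *\<^sub>C (z + w)) = T (\<i> *\<^sub>C z) + T (\<i> *\<^sub>C w)" "T (z + w) = T z + T w"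
      using zw by (simp_all add: scaleC_add_right T_add N_scale)
    ultimately show False
      using T_i[OF N_add[OF zw(1,3)]] zw by (auto simp: scaleC_add_right)
  qed
  then obtain \<tau> where \<tau>: "\<tau> = (\<lambda>c. c) \<or> \<tau> = cnj" and "\<And>z. z \<in> N \<Longrightarrow> T (\<i> *\<^sub>C z) = \<tau> \<i> *\<^sub>C T z"
    by (metis complex_cnj_i)
  then have T_i: "\<And>z. z \<in> N \<Longrightarrow> T (\<i> *\<^sub>C z) = \<tau> \<i> *\<^sub>C T z" by blast
  have \<tau>_simps: "\<tau> (a + b) = \<tau> a + \<tau> b" "\<tau> (a * b) = \<tau> a * \<tau> b" "\<tau> (of_real r) = of_real r"
    "\<tau> (a / b) = \<tau> a / \<tau> b" "cmod (\<tau> a) = cmod a" for a b r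
    using \<tau> by auto
  have T_scale: "T (c *\<^sub>C z) = \<tau> c *\<^sub>C T z" if z: "z \<in> N" for c z
  proof -
    have "T (c *\<^sub>C z) = T (of_real (Re c) *\<^sub>C z + of_real (Im c) *\<^sub>C \<i> *\<^sub>C z)"
      by (subst complex_eq[of c]) (simp add: scaleC_add_left mult.commute)
    also have "\<dots> = of_real (Re c) *\<^sub>C T z + of_real (Im c) *\<^sub>C \<tau> \<i> *\<^sub>C T z"
      by (simp only: T_add[OF N_scale[OF z z] N_scale[OF N_scale[OF z z] z]]
          T_scaleR[OF z] T_scaleR[OF N_scale[OF z z]] T_i[OF z])
    also have "\<dots> = \<tau> (of_real (Re c) + \<i> * of_real (Im c)) *\<^sub>C T z"
      by (simp add: \<tau>_simps scaleC_add_left mult.commute)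
    finally show ?thesis using complex_eq[of c] by simp
  qed
  define p where "p v = v - cinner v e *\<^sub>C e" for v
  define U where "U v = \<tau> (cinner v e) *\<^sub>C e' + T (p v)" for v
  have p: "p v \<in> N" for v by (simp add: p_def N_def cinner_simps ee)
  have U_add: "U (v + w) = U v + U w" for v w
  proof -
    have "p (v + w) = p v + p w" by (simp add: p_def cinner_simps scaleC_add_left)
    then show ?thesis by (simp add: U_def T_add p cinner_simps \<tau>_simps scaleC_add_left)
  qed
  have U_scale: "U (c *\<^sub>C v) = \<tau> c *\<^sub>C U v" for c v
  proof -
    have "p (c *\<^sub>C v) = c *\<^sub>C p v"
      by (simp add: p_def cinner_simps complex_vector.scale_right_diff_distrib)
    then show ?thesis by (simp add: U_def T_scale p cinner_simps \<tau>_simps scaleC_add_right)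
  qed
  have U_norm: "norm (U v) = norm v" for v
  proof -
    have "(norm (U v))\<^sup>2 = (cmod (cinner v e))\<^sup>2 + (norm (p v))\<^sup>2"
      unfolding U_def Re_cinner_norm by (simp add: cinner_simps T_orth p \<tau>_simps T_norm e')
    also have "\<dots> = (norm (cinner v e *\<^sub>C e + p v))\<^sup>2"
      unfolding Re_cinner_norm by (simp add: cinner_simps N0 p e)
    finally show ?thesis by (simp add: p_def)
  qed
  have ray: "\<exists>c. cmod c = 1 \<and> U v = c *\<^sub>C G v" for v
  proof (cases "cinner v e = 0")
    case True
    then have "p v = v" "v \<in> N" by (simp_all add: p_def N_def)
    then show ?thesis using T_ray[of v] True \<tau> by (auto simp: U_def)
  next
    case False
    let ?\<alpha> = "cinner v e"
    define z where "z = (1 / ?\<alpha>) *\<^sub>C p v"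
    have z: "z \<in> N" unfolding z_def by (rule N_scale[OF p p])
    have v: "v = ?\<alpha> *\<^sub>C (e + z)"
      using False by (simp add: z_def scaleC_add_right p_def)
    have v0: "G v \<noteq> 0" using False G_norm[of v] by auto
    have "U v = \<tau> ?\<alpha> *\<^sub>C (e' + T z)"
      unfolding U_def z_def T_scale[OF p] using False \<tau>
      by (auto simp: scaleC_add_right)
    then have Uv: "U v = (\<tau> ?\<alpha> * \<omega> z) *\<^sub>C G (e + z)" by (simp add: T)
    have "cmod (cinner (U v) (G v)) = cmod ?\<alpha> * cmod (cinner (e + z) v)"
      unfolding Uv by (simp add: cinner_simps norm_mult phase[OF z] \<tau>_simps G)
    also have "\<dots> = cmod (cinner v v)" by (subst (3) v) (simp add: cinner_scaleC_left norm_mult)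
    also have "\<dots> = norm (U v) * norm (G v)"
      by (simp add: cinner_self norm_mult U_norm G_norm power2_eq_square)
    finally obtain c where c: "U v = c *\<^sub>C G v" using parallel v0 by blast
    have "cmod c = 1" using U_norm[of v] v0 unfolding c by (simp add: G_norm) (metis G_norm norm_eq_zero)
    then show ?thesis using c by blast
  qed
  have "surj U"
  proof (rule surjI)
    fix y :: 'b
    obtain x c where y: "y = c *\<^sub>C G x" using surj by blast
    obtain d where d: "cmod d = 1" "U x = d *\<^sub>C G x" using ray by blast
    have "U (\<tau> (c / d) *\<^sub>C x) = y"
      using d \<tau> unfolding U_scale d(2) y by auto
    then show "U (SOME x. U x = y) = y" by (rule someI)
  qed
  then have "symmetry_op U"
    unfolding symmetry_op_def unitary_op_def antiunitary_op_def
    using \<tau> U_add U_scale U_norm by auto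
  then show ?thesis using ray by blast
qed

section \<open>Jordan products with projections of rank one\<close>

lemma jordan_apply: "(A \<bullet>\<^sub>J B) x = (1/2) *\<^sub>C (A (B x) + B (A x))"
  by (simp add: jordan_product_def)

lemma jordan_self: "A \<bullet>\<^sub>J A = (\<lambda>x. A (A x))"
  by (simp add: jordan_product_def scaleC_add_right flip: scaleC_add_left)

lemma jordan_scaleC_id:
  assumes "A \<in> bounded_ops" shows "(\<lambda>x. c *\<^sub>C x) \<bullet>\<^sub>J A = (\<lambda>x. c *\<^sub>C A x)"
  by (simp add: jordan_product_def op_scaleC assms scaleC_add_right flip: scaleC_add_left)

lemma jordan_id: "A \<in> bounded_ops \<Longrightarrow> A \<bullet>\<^sub>J (\<lambda>x. x) = A"
  by (simp add: jordan_product_def scaleC_add_right flip: scaleC_add_left)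

lemma jordan_symmetric:
  assumes "\<And>x y. cinner (A x) y = cinner x (A y)" "\<And>x y. cinner (B x) y = cinner x (B y)"
  shows "cinner ((A \<bullet>\<^sub>J B) x) y = cinner x ((A \<bullet>\<^sub>J B) y)"
  by (simp add: jordan_apply cinner_simps assms)

abbreviation proj :: "'a::complex_hilbert \<Rightarrow> 'a \<Rightarrow> 'a" where
  "proj u \<equiv> rank_one u u"

lemma rank_one_symmetric: "cinner (proj u x) y = cinner x (proj u y)"
  by (simp add: rank_one_def cinner_simps cinner_commute[of y u])

lemma rank_one_scale_left: "rank_one (c *\<^sub>C x) y = (\<lambda>z. c *\<^sub>C rank_one x y z)"
  by (simp add: rank_one_def mult.commute)

lemma proj_phase:
  assumes "cmod c = 1" shows "proj (c *\<^sub>C u) = proj u"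
proof -
  have "c * cnj c = 1" using complex_norm_square[of c] assms by simp
  then show ?thesis by (simp add: rank_one_def cinner_simps fun_eq_iff mult.commute mult.left_commute)
qed

lemma proj_eq_imp:
  assumes "norm u = 1" "proj u = proj v"
  shows "u = cinner u v *\<^sub>C v"
proof -
  have "proj u u = proj v u" using assms by simp
  then show ?thesis using assms(1) by (simp add: rank_one_def cinner_self scaleC_one)
qed

text \<open>
  A vector \<open>u\<close> is a \<^emph>\<open>reducing\<close> eigenvector of \<open>A\<close> if \<open>Au = \<alpha>u\<close> and \<open>u\<close> is an eigenvector of
  \<open>A\<^sup>*\<close> for the conjugate of \<open>\<alpha>\<close>. For a unit vector this amounts to \<open>A \<circ> P = \<alpha>P\<close> for the projection \<open>P\<close> onto \<open>\<complex>u\<close>, a condition on Jordan products.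
\<close>

definition reducing :: "('a::complex_hilbert \<Rightarrow> 'a) \<Rightarrow> 'a \<Rightarrow> complex \<Rightarrow> bool" where
  "reducing A u \<alpha> \<longleftrightarrow> A u = \<alpha> *\<^sub>C u \<and> (\<forall>x. cinner (A x) u = \<alpha> * cinner x u)"

lemma reducing_iff_jordan:
  assumes A: "A \<in> bounded_ops" and u: "norm u = 1"
  shows "reducing A u \<alpha> \<longleftrightarrow> A \<bullet>\<^sub>J proj u = rank_one (\<alpha> *\<^sub>C u) u"
proof
  assume "reducing A u \<alpha>"
  then show "A \<bullet>\<^sub>J proj u = rank_one (\<alpha> *\<^sub>C u) u"
    by (simp add: fun_eq_iff reducing_def jordan_apply rank_one_def op_scaleC A mult.commute
        flip: scaleC_add_left)
next
  assume eq: "A \<bullet>\<^sub>J proj u = rank_one (\<alpha> *\<^sub>C u) u"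
  have uu: "cinner u u = 1" by (simp add: cinner_self u)
  have eq_at: "A (cinner x u *\<^sub>C u) + cinner (A x) u *\<^sub>C u = (2 * (\<alpha> * cinner x u)) *\<^sub>C u" for x
  proof -
    have "2 *\<^sub>C (A \<bullet>\<^sub>J proj u) x = 2 *\<^sub>C rank_one (\<alpha> *\<^sub>C u) u x" by (simp add: eq)
    then show ?thesis by (simp add: jordan_apply rank_one_def mult.commute mult.left_commute)
  qed
  have eq_u: "A u + cinner (A u) u *\<^sub>C u = (2 * \<alpha>) *\<^sub>C u"
    using eq_at[of u] by (simp add: uu)
  then have "cinner (A u + cinner (A u) u *\<^sub>C u) u = cinner ((2 * \<alpha>) *\<^sub>C u) u" by (rule arg_cong)
  then have Auu: "cinner (A u) u = \<alpha>" by (simp add: cinner_simps uu)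
  have Au: "A u = \<alpha> *\<^sub>C u"
    using eq_u unfolding Auu mult_2 scaleC_add_left by (rule add_right_imp_eq)
  have "cinner (A x) u = \<alpha> * cinner x u" for x
  proof -
    have "cinner (A (cinner x u *\<^sub>C u) + cinner (A x) u *\<^sub>C u) u = cinner ((2 * (\<alpha> * cinner x u)) *\<^sub>C u) u"
      by (simp only: eq_at)
    then show ?thesis by (simp add: cinner_simps uu op_scaleC A Au algebra_simps)
  qed
  then show "reducing A u \<alpha>" using Au by (simp add: reducing_def)
qed

lemma reducing_symmetric:
  assumes "\<And>x y. cinner (A x) y = cinner x (A y)" "A u = of_real r *\<^sub>C u"
  shows "reducing A u (of_real r)"
  using assms by (simp add: reducing_def cinner_simps)

lemma reducing_scale: "A \<in> bounded_ops \<Longrightarrow> reducing A u \<alpha> \<Longrightarrow> reducing A (c *\<^sub>C u) \<alpha>"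
  by (simp add: reducing_def op_scaleC cinner_simps mult.commute mult.left_commute)

lemma rank_one_zero_iff: "rank_one x y = (\<lambda>z. 0) \<longleftrightarrow> x = 0 \<or> y = 0"
proof
  assume "rank_one x y = (\<lambda>z. 0)"
  then have "rank_one x y y = 0" by simp
  then show "x = 0 \<or> y = 0" by (auto simp: rank_one_def)
qed (auto simp: rank_one_def)

lemma jordan_proj_proj_zero:
  assumes "norm u = 1" "norm v = 1"
  shows "proj u \<bullet>\<^sub>J proj v = (\<lambda>x. 0) \<longleftrightarrow> cinner u v = 0"
proof -
  have "reducing (proj u) v 0 \<longleftrightarrow> cinner u v = 0"
    using assms by (auto simp: reducing_def rank_one_def cinner_simps cinner_0_commute[of v u])
  moreover have "rank_one (0 *\<^sub>C v) v = (\<lambda>x. 0)" by (simp add: rank_one_def)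
  ultimately show ?thesis
    using reducing_iff_jordan[OF ops_rank_one[of u u] assms(2), of 0] by metis
qed

definition projection_op :: "('a::complex_hilbert \<Rightarrow> 'a) \<Rightarrow> bool" where
  "projection_op E \<longleftrightarrow> E \<in> bounded_ops \<and> (\<forall>x y. cinner (E x) y = cinner x (E y)) \<and> (\<forall>x. E (E x) = E x)"

lemma projection_iff_mean:
  assumes "A \<in> bounded_ops"
  shows "projection_op A \<longleftrightarrow> mean_transform (A \<bullet>\<^sub>J A) = A"
proof
  assume "projection_op A"
  then show "mean_transform (A \<bullet>\<^sub>J A) = A"
    using assms by (simp add: projection_op_def jordan_self mean_selfadjoint)
next
  assume "mean_transform (A \<bullet>\<^sub>J A) = A"
  then show "projection_op A"
    unfolding projection_op_def jordan_self
    using mean_square_fixed_projection[OF assms] assms by blast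
qed

lemma projection_proj: "norm u = 1 \<Longrightarrow> projection_op (proj u)"
  by (simp add: projection_op_def ops_rank_one rank_one_symmetric)
    (simp add: rank_one_def cinner_simps cinner_self)

text \<open>
  In terms of Jordan products, \<open>E \<circ> F = F\<close> expresses the order \<open>F \<le> E\<close> of projections; the
  projections of rank one are its minimal nonzero elements.
\<close>

lemma projection_below_proj:
  assumes u: "norm u = 1" and A: "projection_op A" and below: "proj u \<bullet>\<^sub>J A = A"
    and nonzero: "A \<noteq> (\<lambda>x. 0)"
  shows "A = proj u"
proof -
  have Aop: "A \<in> bounded_ops" and AA: "A (A x) = A x" and sym: "cinner (A x) y = cinner x (A y)" for x y
    using A by (auto simp: projection_op_def)
  have uu: "cinner u u = 1" by (simp add: cinner_self u)
  have eq: "2 *\<^sub>C A x = cinner (A x) u *\<^sub>C u + cinner x u *\<^sub>C A u" for x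
  proof -
    have "2 *\<^sub>C A x = 2 *\<^sub>C (proj u \<bullet>\<^sub>J A) x" by (simp add: below)
    then show ?thesis by (simp add: jordan_apply rank_one_def op_scaleC Aop)
  qed
  define \<alpha> where "\<alpha> = cinner (A u) u"
  have "2 *\<^sub>C A u = \<alpha> *\<^sub>C u + A u" using eq[of u] by (simp add: uu scaleC_one \<alpha>_def)
  moreover have "2 *\<^sub>C A u = A u + A u" using scaleC_add_left[of 1 1 "A u"] by (simp add: scaleC_one)
  ultimately have Au: "A u = \<alpha> *\<^sub>C u" by simp
  have "cinner (A x) u = \<alpha> * cinner x u" for x
  proof -
    have "cinner (A u) u = of_real (Re (cinner (A u) u))"
      by (rule symmetric_cinner_real[OF sym])
    then have "cnj \<alpha> = \<alpha>" unfolding \<alpha>_def by (metis complex_cnj_complex_of_real)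
    then show ?thesis by (simp add: sym Au cinner_simps)
  qed
  then have "2 *\<^sub>C A x = 2 *\<^sub>C (\<alpha> *\<^sub>C proj u x)" for x
    by (subst eq) (simp add: Au rank_one_def mult.commute flip: scaleC_add_left)
  then have A_eq: "A x = \<alpha> *\<^sub>C proj u x" for x
    by (simp only: complex_vector.scale_cancel_left) simp
  have "\<alpha> \<noteq> 0" using nonzero A_eq by (auto simp: fun_eq_iff)
  moreover have "(\<alpha> * \<alpha>) *\<^sub>C u = \<alpha> *\<^sub>C u"
    using AA[of u] by (simp add: Au op_scaleC Aop)
  then have "\<alpha> * \<alpha> = \<alpha>" using u by (simp only: complex_vector.scale_cancel_right) auto
  ultimately have "\<alpha> = 1" by simp
  then show ?thesis using A_eq by (simp add: fun_eq_iff scaleC_one)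
qed

lemma projection_has_unit_vector:
  assumes "projection_op E" "E \<noteq> (\<lambda>x. 0)"
  obtains v where "norm v = 1" "E v = v"
proof -
  have E: "E \<in> bounded_ops" "\<And>x. E (E x) = E x" using assms(1) by (auto simp: projection_op_def)
  obtain x where x: "E x \<noteq> 0" using assms(2) by blast
  show ?thesis
    by (rule that[of "complex_of_real (1 / norm (E x)) *\<^sub>C E x"])
      (use x in \<open>simp_all add: E op_scaleC norm_divide\<close>)
qed

section \<open>Maps compatible with the mean transform of Jordan products\<close>

locale jordan_mean_map =
  fixes \<Phi> :: "('h::complex_hilbert \<Rightarrow> 'h) \<Rightarrow> ('k::complex_hilbert \<Rightarrow> 'k)"
  assumes bij: "bij_betw \<Phi> bounded_ops bounded_ops"
    and mean_jordan: "\<And>A B. A \<in> bounded_ops \<Longrightarrow> B \<in> bounded_ops \<Longrightarrow>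
      mean_transform (\<Phi> A \<bullet>\<^sub>J \<Phi> B) = \<Phi> (mean_transform (A \<bullet>\<^sub>J B))"
begin

lemma ops: "A \<in> bounded_ops \<Longrightarrow> \<Phi> A \<in> bounded_ops"
  using bij_betwE[OF bij] by blast

lemma inj: "A \<in> bounded_ops \<Longrightarrow> B \<in> bounded_ops \<Longrightarrow> \<Phi> A = \<Phi> B \<longleftrightarrow> A = B"
  using bij by (meson bij_betw_imp_inj_on inj_on_eq_iff)

lemma surj: assumes "X \<in> bounded_ops" obtains A where "A \<in> bounded_ops" "X = \<Phi> A"
  using bij assms unfolding bij_betw_def by blast

lemma inverse: "jordan_mean_map (inv_into bounded_ops \<Phi>)"
proof
  let ?\<Psi> = "inv_into bounded_ops \<Phi>"
  show bij': "bij_betw ?\<Psi> bounded_ops bounded_ops" by (rule bij_betw_inv_into[OF bij])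
  fix A B :: "'k \<Rightarrow> 'k" assume AB: "A \<in> bounded_ops" "B \<in> bounded_ops"
  note mem = bij_betwE[OF bij', rule_format]
  have "mean_transform (A \<bullet>\<^sub>J B) = \<Phi> (mean_transform (?\<Psi> A \<bullet>\<^sub>J ?\<Psi> B))"
    using mean_jordan[OF mem[OF AB(1)] mem[OF AB(2)]] bij_betw_inv_into_right[OF bij] AB by simp
  then show "mean_transform (?\<Psi> A \<bullet>\<^sub>J ?\<Psi> B) = ?\<Psi> (mean_transform (A \<bullet>\<^sub>J B))"
    using bij_betw_inv_into_left[OF bij, of "mean_transform (?\<Psi> A \<bullet>\<^sub>J ?\<Psi> B)"]
    by (simp add: ops_mean ops_jordan mem AB)
qed

lemma zero: "\<Phi> (\<lambda>x. 0) = (\<lambda>x. 0)"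
proof -
  obtain B where B: "B \<in> bounded_ops" "(\<lambda>x. 0) = \<Phi> B" by (rule surj[OF ops_zero])
  have "\<Phi> (\<lambda>x. 0) \<bullet>\<^sub>J \<Phi> B = (\<lambda>x. 0)"
    using ops[OF ops_zero] by (simp add: B(2)[symmetric] jordan_product_def op_zero)
  moreover have "(\<lambda>x. 0) \<bullet>\<^sub>J B = (\<lambda>x. 0)" using B(1) by (simp add: jordan_product_def op_zero)
  ultimately show ?thesis using mean_jordan[OF ops_zero B(1)] by simp
qed

lemma eq_zero: "A \<in> bounded_ops \<Longrightarrow> \<Phi> A = (\<lambda>x. 0) \<longleftrightarrow> A = (\<lambda>x. 0)"
  using inj[OF _ ops_zero] zero by simp

lemma jordan_zero:
  assumes "A \<in> bounded_ops" "B \<in> bounded_ops"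
  shows "\<Phi> A \<bullet>\<^sub>J \<Phi> B = (\<lambda>x. 0) \<longleftrightarrow> A \<bullet>\<^sub>J B = (\<lambda>x. 0)"
proof -
  have mean0: "mean_transform T = (\<lambda>x. 0) \<longleftrightarrow> T = (\<lambda>x. 0)"
    if "T \<in> bounded_ops" for T :: "'c::complex_hilbert \<Rightarrow> 'c"
  proof
    assume "mean_transform T = (\<lambda>x. 0)"
    then show "T = (\<lambda>x. 0)" by (intro ext mean_kernel[OF that]) simp
  qed simp
  show ?thesis
    using mean_jordan[OF assms] eq_zero[OF ops_mean[OF ops_jordan[OF assms]]]
      mean0[OF ops_jordan[OF assms]] mean0[OF ops_jordan[OF ops[OF assms(1)] ops[OF assms(2)]]]
    by simp
qed

lemma projection_iff:
  assumes "A \<in> bounded_ops" shows "projection_op (\<Phi> A) \<longleftrightarrow> projection_op A"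
  unfolding projection_iff_mean[OF assms] projection_iff_mean[OF ops[OF assms]]
  by (simp add: mean_jordan inj ops_mean ops_jordan assms)

lemma jordan_projections:
  assumes "projection_op E" "projection_op F"
  shows "\<Phi> (E \<bullet>\<^sub>J F) = \<Phi> E \<bullet>\<^sub>J \<Phi> F"
proof -
  have fixed: "mean_transform (E \<bullet>\<^sub>J F) = E \<bullet>\<^sub>J F" if "projection_op E" "projection_op F"
    for E F :: "'c::complex_hilbert \<Rightarrow> 'c"
    using that by (intro mean_selfadjoint ops_jordan jordan_symmetric) (auto simp: projection_op_def)
  have "E \<in> bounded_ops" "F \<in> bounded_ops" using assms by (simp_all add: projection_op_def)
  then show ?thesis
    using mean_jordan[of E F] fixed[OF assms] fixed[of "\<Phi> E" "\<Phi> F"] projection_iff assms by simp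
qed

text \<open>
  The image \<open>S\<close> of the identity is a projection. A nonzero vector in its kernel would span the range of a
  projection whose Jordan product with \<open>S\<close> is zero, but only 0 has Jordan product 0 with the identity.
\<close>

lemma identity: "\<Phi> (\<lambda>x. x) = (\<lambda>x. x)"
proof
  fix x
  define S where "S = \<Phi> (\<lambda>x. x)"
  have "projection_op (\<lambda>x::'h. x)" by (simp add: projection_op_def ops_id)
  then have S: "projection_op S" unfolding S_def using projection_iff[OF ops_id] by simp
  then have Sop: "S \<in> bounded_ops" and SS: "\<And>x. S (S x) = S x"
    and sym: "\<And>x y. cinner (S x) y = cinner x (S y)"
    by (auto simp: projection_op_def)
  define w where "w = x - S x"
  have Sw: "S w = 0" by (simp add: w_def op_diff Sop SS)
  obtain A where A: "A \<in> bounded_ops" "proj w = \<Phi> A" by (rule surj[OF ops_rank_one])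
  have "proj w \<bullet>\<^sub>J S = (\<lambda>x. 0)"
    by (simp add: jordan_product_def rank_one_def op_scaleC Sop Sw sym)
  then have "A \<bullet>\<^sub>J (\<lambda>x. x) = (\<lambda>x. 0)" using jordan_zero[OF A(1) ops_id] A(2) S_def by simp
  then have "proj w = (\<lambda>x. 0)" using A by (simp add: jordan_id zero)
  then have "w = 0" by (simp add: rank_one_zero_iff)
  then show "\<Phi> (\<lambda>x. x) x = x" by (simp add: w_def S_def)
qed

lemma mean_commute: "A \<in> bounded_ops \<Longrightarrow> \<Phi> (mean_transform A) = mean_transform (\<Phi> A)"
  using mean_jordan[of A "\<lambda>x. x"] by (simp add: ops_id identity jordan_id ops)

text \<open>
  The image \<open>F\<close> of a minimal projection is minimal: the preimage of a projection of rank one below \<open>F\<close> lies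
  below the given projection, and hence is equal to it.
\<close>

lemma rank_one_projection:
  assumes u: "norm u = 1"
  shows "\<exists>v. norm v = 1 \<and> \<Phi> (proj u) = proj v"
proof -
  have E: "projection_op (proj u)" by (rule projection_proj[OF u])
  have nz: "proj u \<noteq> (\<lambda>x. 0)" using u by (auto simp: rank_one_zero_iff)
  have F: "projection_op (\<Phi> (proj u))" by (simp add: projection_iff ops_rank_one E)
  have "\<Phi> (proj u) \<noteq> (\<lambda>x. 0)" using nz eq_zero[OF ops_rank_one] by simp
  then obtain v where v: "norm v = 1" "\<Phi> (proj u) v = v" using projection_has_unit_vector[OF F] by metis
  obtain A where A: "A \<in> bounded_ops" "proj v = \<Phi> A" by (rule surj[OF ops_rank_one])
  have projA: "projection_op A" using projection_proj[OF v(1)] projection_iff[OF A(1)] A(2) by simp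
  have Fop: "\<Phi> (proj u) \<in> bounded_ops" by (rule ops[OF ops_rank_one])
  have "\<Phi> (proj u) \<bullet>\<^sub>J \<Phi> A = \<Phi> A"
  proof -
    have sym: "cinner (\<Phi> (proj u) x) y = cinner x (\<Phi> (proj u) y)" for x y
      using F by (simp add: projection_op_def)
    have "(\<Phi> (proj u) \<bullet>\<^sub>J proj v) x = proj v x" for x
      unfolding jordan_apply rank_one_def[of v v] op_scaleC[OF Fop] sym v(2)
      by (simp add: scaleC_add_right flip: scaleC_add_left)
    then show ?thesis unfolding A(2)[symmetric] by (rule ext)
  qed
  then have "\<Phi> (proj u \<bullet>\<^sub>J A) = \<Phi> A" by (simp add: jordan_projections E projA)
  then have "proj u \<bullet>\<^sub>J A = A" by (simp add: inj ops_jordan ops_rank_one A)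
  moreover have "A \<noteq> (\<lambda>x. 0)"
  proof
    assume "A = (\<lambda>x. 0)"
    then have "proj v = (\<lambda>x. 0)" using A(2) zero by simp
    then show False using v(1) by (auto simp: rank_one_zero_iff)
  qed
  ultimately have "A = proj u" by (intro projection_below_proj[OF u projA])
  then show ?thesis using A(2) v(1) by auto
qed

text \<open>
  A choice of unit vectors, each determined up to a phase, for the action on projections of rank one.
\<close>

definition g :: "'h \<Rightarrow> 'k" where
  "g u = (SOME v. norm v = 1 \<and> \<Phi> (proj u) = proj v)"

lemma g: assumes "norm u = 1" shows g_norm: "norm (g u) = 1" and g_proj: "\<Phi> (proj u) = proj (g u)"
  using someI_ex[OF rank_one_projection[OF assms]] by (simp_all add: g_def)

lemma g_surj:
  assumes "norm v = 1"
  obtains u c where "norm u = 1" "cmod c = 1" "v = c *\<^sub>C g u"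
proof -
  interpret inv: jordan_mean_map "inv_into bounded_ops \<Phi>" by (rule inverse)
  obtain u where u: "norm u = 1" "inv_into bounded_ops \<Phi> (proj v) = proj u"
    using inv.rank_one_projection[OF assms] by blast
  then have "proj v = proj (g u)"
    using bij_betw_inv_into_right[OF bij ops_rank_one[of v v]] g_proj[OF u(1)] by simp
  then have v: "v = cinner v (g u) *\<^sub>C g u" by (rule proj_eq_imp[OF assms])
  then have "cmod (cinner v (g u)) = 1"
    using g_norm[OF u(1)] assms norm_scaleC[of "cinner v (g u)" "g u"] by simp
  then show ?thesis using that u(1) v by blast
qed

lemma g_orthogonal:
  assumes "norm u = 1" "norm v = 1"
  shows "cinner (g u) (g v) = 0 \<longleftrightarrow> cinner u v = 0"
  using jordan_zero[OF ops_rank_one[of u u] ops_rank_one[of v v]]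
  by (simp add: g_proj g_norm assms jordan_proj_proj_zero)

lemma multiple_of_image:
  assumes "w \<noteq> 0"
  obtains w0 c where "norm w0 = 1" "w = c *\<^sub>C g w0" "c \<noteq> 0"
proof -
  have "norm (complex_of_real (1 / norm w) *\<^sub>C w) = 1" using assms by (simp add: norm_divide)
  then obtain u c where u: "norm u = 1" "cmod c = 1" "complex_of_real (1 / norm w) *\<^sub>C w = c *\<^sub>C g u"
    by (rule g_surj)
  have "w = complex_of_real (norm w) *\<^sub>C complex_of_real (1 / norm w) *\<^sub>C w"
    using assms by (simp add: scaleC_one)
  also have "\<dots> = (complex_of_real (norm w) * c) *\<^sub>C g u" unfolding u(3) by simp
  finally show ?thesis using that u(1,2) assms by (metis mult_eq_0_iff norm_eq_zero norm_zero of_real_eq_0_iff zero_neq_one)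
qed

lemma reducing_zero:
  assumes A: "A \<in> bounded_ops" and w: "norm w = 1" and "reducing A w 0"
  shows "reducing (\<Phi> A) (g w) 0"
proof -
  have "A \<bullet>\<^sub>J proj w = (\<lambda>x. 0)"
    using assms(3) by (simp add: reducing_iff_jordan[OF A w] rank_one_def)
  then have "\<Phi> A \<bullet>\<^sub>J proj (g w) = (\<lambda>x. 0)"
    using jordan_zero[OF A ops_rank_one[of w w]] g_proj[OF w] by simp
  then show ?thesis by (simp add: reducing_iff_jordan[OF ops[OF A] g_norm[OF w]] rank_one_def)
qed

text \<open>
  The image has Jordan product zero with all projections of rank one orthogonal to \<open>\<complex>g u\<close>, which leaves
  only the multiples of the projection onto that line.
\<close>

lemma multiple_of_projection:
  assumes u: "norm u = 1"
  shows "\<exists>\<beta>. \<Phi> (rank_one (\<alpha> *\<^sub>C u) u) = rank_one (\<beta> *\<^sub>C g u) (g u)"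
proof -
  define X where "X = \<Phi> (rank_one (\<alpha> *\<^sub>C u) u)"
  have X: "X \<in> bounded_ops" unfolding X_def by (rule ops[OF ops_rank_one])
  have vv: "cinner (g u) (g u) = 1" by (simp add: cinner_self g_norm[OF u])
  have orth: "X w = 0 \<and> (\<forall>x. cinner (X x) w = 0)" if w: "cinner w (g u) = 0" for w
  proof (cases "w = 0")
    case True
    then show ?thesis by (simp add: op_zero X)
  next
    case False
    then obtain w0 c where w0: "norm w0 = 1" "w = c *\<^sub>C g w0" "c \<noteq> 0"
      by (rule multiple_of_image)
    then have "cinner w0 u = 0" using w by (simp add: g_orthogonal[symmetric] u cinner_simps)
    then have "reducing (rank_one (\<alpha> *\<^sub>C u) u) w0 0"
      by (simp add: reducing_def rank_one_def cinner_simps cinner_0_commute[of u])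
    then have "reducing X w 0"
      unfolding X_def w0(2) by (intro reducing_scale reducing_zero ops ops_rank_one w0)
    then show ?thesis by (simp add: reducing_def)
  qed
  define v where "v = g u"
  have Xv: "X v = cinner (X v) v *\<^sub>C v"
  proof -
    define d where "d = X v - cinner (X v) v *\<^sub>C v"
    have d: "cinner d v = 0" using vv by (simp add: d_def v_def cinner_simps)
    then have "cinner v d = 0" using cinner_0_commute by blast
    moreover have "cinner (X v) d = 0" using orth[of d] d by (simp add: v_def)
    ultimately have "cinner d d = 0" by (subst (1) d_def) (simp add: cinner_simps)
    then show ?thesis by (simp add: d_def)
  qed
  have "X z = rank_one (cinner (X v) v *\<^sub>C v) v z" for z
  proof -
    have "X (z - cinner z v *\<^sub>C v) = 0"
      using orth[of "z - cinner z v *\<^sub>C v"] vv by (simp add: v_def cinner_simps)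
    then show ?thesis using Xv by (simp add: rank_one_def op_simps X)
  qed
  then show ?thesis unfolding X_def v_def by (intro exI ext)
qed

text \<open>
  The condition \<open>A \<circ> P = \<alpha>P\<close> implies \<open>M(\<Phi>(A) \<circ> Q) = \<Phi>(\<alpha>P)\<close> with \<open>Q = \<Phi>(P)\<close>, where the right-hand side
  is a multiple of \<open>Q\<close> depending on \<open>\<alpha>\<close> but not on \<open>A\<close>. As operators of rank one have unique preimages
  under the mean transform, \<open>M\<close> can be removed.
\<close>

lemma reducing_image_ex:
  assumes u: "norm u = 1"
  shows "\<exists>\<beta>. \<forall>A\<in>bounded_ops. reducing A u \<alpha> \<longrightarrow> reducing (\<Phi> A) (g u) \<beta>"
proof -
  obtain \<beta> where \<beta>: "\<Phi> (rank_one (\<alpha> *\<^sub>C u) u) = rank_one (\<beta> *\<^sub>C g u) (g u)"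
    using multiple_of_projection[OF u] by blast
  have vv: "cinner (g u) (g u) = 1" by (simp add: cinner_self g_norm[OF u])
  have "reducing (\<Phi> A) (g u) \<beta>" if A: "A \<in> bounded_ops" and red: "reducing A u \<alpha>" for A
  proof -
    have P: "mean_transform (proj u) = proj u"
      by (rule mean_selfadjoint[OF ops_rank_one rank_one_symmetric])
    have "mean_transform (A \<bullet>\<^sub>J proj u) = rank_one (\<alpha> *\<^sub>C u) u"
      using red mean_scaleC[OF ops_rank_one, of \<alpha> u u]
      by (simp add: reducing_iff_jordan[OF A u] rank_one_scale_left P)
    then have "mean_transform (\<Phi> A \<bullet>\<^sub>J proj (g u)) = rank_one (\<beta> *\<^sub>C g u) (g u)"
      using mean_jordan[OF A ops_rank_one[of u u]] \<beta> g_proj[OF u] by simp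
    from mean_eq_rank_one_imp[OF ops_jordan[OF ops[OF A] ops_rank_one] this]
    have "\<Phi> A \<bullet>\<^sub>J proj (g u) = rank_one (2 *\<^sub>C \<beta> *\<^sub>C g u - \<beta> *\<^sub>C g u) (g u)"
      by (simp only: cinner_scaleC_left vv g_norm[OF u]) simp
    also have "2 *\<^sub>C \<beta> *\<^sub>C g u - \<beta> *\<^sub>C g u = \<beta> *\<^sub>C g u"
      using scaleC_add_left[of 1 1 "\<beta> *\<^sub>C g u"] by (simp only: one_add_one scaleC_one) simp
    finally have "\<Phi> A \<bullet>\<^sub>J proj (g u) = rank_one (\<beta> *\<^sub>C g u) (g u)" .
    then show ?thesis by (simp add: reducing_iff_jordan[OF ops[OF A] g_norm[OF u]])
  qed
  then show ?thesis by blast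
qed

text \<open>
  Applied to \<open>A = \<alpha>I\<close>, for which all vectors are reducing eigenvectors, the previous lemma gives an
  operator all of whose vectors are eigenvectors. So the eigenvalue \<open>\<beta>\<close> depends on \<open>\<alpha>\<close> only.
\<close>

lemma scalar_image: "\<exists>\<beta>. \<Phi> (\<lambda>x. \<alpha> *\<^sub>C x) = (\<lambda>x. \<beta> *\<^sub>C x)"
proof -
  define D where "D = \<Phi> (\<lambda>x. \<alpha> *\<^sub>C x)"
  have \<alpha>I: "(\<lambda>x::'h. \<alpha> *\<^sub>C x) \<in> bounded_ops" by (rule ops_scaleC[OF ops_id])
  have D: "D \<in> bounded_ops" unfolding D_def by (rule ops[OF \<alpha>I])
  have "\<exists>\<beta>. reducing D (g u) \<beta>" if "norm u = 1" for u
    using reducing_image_ex[OF that, of \<alpha>] \<alpha>I unfolding D_def by (auto simp: reducing_def cinner_simps)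
  then obtain \<beta> where \<beta>: "\<And>u. norm u = 1 \<Longrightarrow> reducing D (g u) (\<beta> u)" by metis
  have eq: "\<beta> u = \<beta> v" if "norm u = 1" "norm v = 1" "cinner u v \<noteq> 0" for u v
  proof -
    have "\<beta> u * cinner (g u) (g v) = \<beta> v * cinner (g u) (g v)"
      using \<beta>[OF that(1)] \<beta>[OF that(2)] by (metis reducing_def cinner_scaleC_left)
    then show ?thesis using that by (simp add: g_orthogonal)
  qed
  \<comment> \<open>Two orthogonal vectors are compared by way of a third one, orthogonal to neither.\<close>
  have const: "\<beta> u = \<beta> v" if u: "norm u = 1" and v: "norm v = 1" for u v
  proof (cases "cinner u v = 0")
    case True
    define w where "w = complex_of_real (1 / norm (u + v)) *\<^sub>C (u + v)"
    have vu: "cinner v u = 0" using True cinner_0_commute by blast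
    have "(norm (u + v))\<^sup>2 = 2" by (simp add: Re_cinner_norm True u v)
    then have nz: "u + v \<noteq> 0" by auto
    then have "norm w = 1" by (simp add: w_def norm_divide)
    moreover have "cinner u w \<noteq> 0" "cinner w v \<noteq> 0"
      using nz by (simp_all add: w_def cinner_simps True vu cinner_self u v)
    ultimately show ?thesis using eq u v by metis
  qed (rule eq[OF u v])
  show ?thesis
  proof (cases "\<exists>u::'h. norm u = 1")
    case True
    then obtain u :: 'h where u: "norm u = 1" by blast
    have "D x = \<beta> u *\<^sub>C x" for x
    proof (cases "x = 0")
      case False
      then obtain w c where w: "norm w = 1" "x = c *\<^sub>C g w" by (rule multiple_of_image)
      have "D (g w) = \<beta> u *\<^sub>C g w" using \<beta>[OF w(1)] const[OF w(1) u] by (simp add: reducing_def)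
      then show ?thesis by (simp add: w(2) op_scaleC D mult.commute)
    qed (simp add: op_zero D)
    then show ?thesis unfolding D_def by (intro exI ext)
  next
    case False
    have "x = 0" for x :: 'k
      by (rule ccontr, erule multiple_of_image) (use False in blast)
    then have "D x = 0 *\<^sub>C x" for x by metis
    then show ?thesis unfolding D_def by (intro exI ext)
  qed
qed

text \<open>
  The action on scalar operators, and by \<open>reducing_image\<close> on reducing eigenvalues of arbitrary operators.
\<close>

definition f :: "complex \<Rightarrow> complex" where
  "f \<alpha> = (SOME \<beta>. \<Phi> (\<lambda>x. \<alpha> *\<^sub>C x) = (\<lambda>x. \<beta> *\<^sub>C x))"

lemma f_scalar: "\<Phi> (\<lambda>x. \<alpha> *\<^sub>C x) = (\<lambda>x. f \<alpha> *\<^sub>C x)"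
  unfolding f_def by (rule someI_ex[OF scalar_image])

lemma reducing_image:
  assumes A: "A \<in> bounded_ops" and u: "norm u = 1" and "reducing A u \<alpha>"
  shows "reducing (\<Phi> A) (g u) (f \<alpha>)"
proof -
  obtain \<beta> where \<beta>: "\<And>A. A \<in> bounded_ops \<Longrightarrow> reducing A u \<alpha> \<Longrightarrow> reducing (\<Phi> A) (g u) \<beta>"
    using reducing_image_ex[OF u] by metis
  have "reducing (\<Phi> (\<lambda>x. \<alpha> *\<^sub>C x)) (g u) \<beta>"
    by (rule \<beta>[OF ops_scaleC[OF ops_id]]) (simp add: reducing_def cinner_simps)
  then have "f \<alpha> *\<^sub>C g u = \<beta> *\<^sub>C g u" by (simp add: reducing_def f_scalar)
  then have "f \<alpha> = \<beta>" using g_norm[OF u] by (simp only: complex_vector.scale_cancel_right) auto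
  then show ?thesis using \<beta> assms by simp
qed

lemma scale_mean_image:
  assumes A: "A \<in> bounded_ops"
  shows "\<Phi> (\<lambda>x. \<alpha> *\<^sub>C mean_transform A x) = (\<lambda>x. f \<alpha> *\<^sub>C \<Phi> (mean_transform A) x)"
  using mean_jordan[OF ops_scaleC[OF ops_id, of \<alpha>] A]
  by (simp add: f_scalar jordan_scaleC_id A ops mean_scaleC mean_commute)

context
  fixes u :: 'h
  assumes u: "norm u = 1"
begin

lemma f_eqI:
  assumes "\<And>x::'k. f \<alpha> *\<^sub>C x = \<beta> *\<^sub>C x" shows "f \<alpha> = \<beta>"
  using assms[of "g u"] g_norm[OF u] by (simp only: complex_vector.scale_cancel_right) auto

lemma f_zero: "f 0 = 0"
proof (rule f_eqI)
  show "f 0 *\<^sub>C x = 0 *\<^sub>C x" for x :: 'k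
    using fun_cong[OF f_scalar[of 0], of x] zero by simp
qed

lemma f_one: "f 1 = 1"
proof (rule f_eqI)
  show "f 1 *\<^sub>C x = 1 *\<^sub>C x" for x :: 'k
    using fun_cong[OF f_scalar[of 1], of x] identity by simp
qed

lemma f_mult: "f (\<alpha> * \<beta>) = f \<alpha> * f \<beta>"
proof (rule f_eqI)
  have "mean_transform (\<lambda>x::'h. x) = (\<lambda>x. x)" by (rule mean_selfadjoint[OF ops_id]) simp
  then have \<beta>I: "mean_transform (\<lambda>x::'h. \<beta> *\<^sub>C x) = (\<lambda>x. \<beta> *\<^sub>C x)"
    using mean_scaleC[OF ops_id[where 'a = 'h], of \<beta>] by simp
  have "\<Phi> (\<lambda>x. (\<alpha> * \<beta>) *\<^sub>C x) = (\<lambda>x. f \<alpha> *\<^sub>C f \<beta> *\<^sub>C x)"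
    using scale_mean_image[OF ops_scaleC[OF ops_id, of \<beta>], of \<alpha>] by (simp add: \<beta>I f_scalar)
  then show "f (\<alpha> * \<beta>) *\<^sub>C x = (f \<alpha> * f \<beta>) *\<^sub>C x" for x :: 'k
    using fun_cong[OF f_scalar[of "\<alpha> * \<beta>"], of x] by auto
qed

lemma f_inj: assumes "f \<alpha> = f \<beta>" shows "\<alpha> = \<beta>"
proof -
  have "(\<lambda>x::'h. \<alpha> *\<^sub>C x) = (\<lambda>x. \<beta> *\<^sub>C x)"
    using inj[OF ops_scaleC[OF ops_id, of \<alpha>] ops_scaleC[OF ops_id, of \<beta>]] assms by (simp add: f_scalar)
  then have "\<alpha> *\<^sub>C u = \<beta> *\<^sub>C u" by metis
  then show ?thesis using u by (simp only: complex_vector.scale_cancel_right) auto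
qed

lemma f_minus_one: "f (- 1) = - 1"
proof -
  have "f (- 1) * f (- 1) = 1" using f_mult[of "- 1" "- 1"] f_one by simp
  moreover have "f (- 1) \<noteq> 1" using f_inj[of "- 1" 1] f_one by auto
  ultimately show ?thesis by (metis square_eq_1_iff)
qed

lemma f_nonzero: "\<alpha> \<noteq> 0 \<Longrightarrow> f \<alpha> \<noteq> 0"
  using f_inj f_zero by metis

end

end

section \<open>Preservation of transition probabilities\<close>

text \<open>
  For unit vectors with \<open>\<langle>u, v\<rangle> = c\<close> real, \<open>u + v\<close> is an eigenvector of the Jordan product of the
  projections onto \<open>\<complex>u\<close> and \<open>\<complex>v\<close> with eigenvalue \<open>c(c + 1)/2\<close>. Together with \<open>c(c - 1)/2\<close> this
  exhausts the nonzero spectrum, from which the transition probability can therefore be read off.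
\<close>

lemma jordan_proj_eigenvector:
  assumes u: "norm u = 1" and v: "norm v = 1" and uv: "cinner u v = complex_of_real c"
  shows "(proj u \<bullet>\<^sub>J proj v) (u + v) = complex_of_real (c * (c + 1) / 2) *\<^sub>C (u + v)"
proof -
  have inner: "cinner u u = 1" "cinner v v = 1" "cinner v u = complex_of_real c"
    using cinner_commute[of v u] by (simp_all add: cinner_self u v uv)
  show ?thesis
    by (simp add: jordan_apply rank_one_def cinner_simps inner uv scaleC_add_right scaleC_add_left add_divide_distrib
        algebra_simps)
qed

lemma jordan_proj_eigenvalue:
  assumes u: "norm u = 1" and v: "norm v = 1"
    and eig: "(proj u \<bullet>\<^sub>J proj v) z = \<mu> *\<^sub>C z" and nz: "z \<noteq> 0" "\<mu> \<noteq> 0"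
  defines "d \<equiv> cmod (cinner u v)"
  shows "\<mu> = complex_of_real (d * (d + 1) / 2) \<or> \<mu> = complex_of_real (d * (d - 1) / 2)"
proof -
  define \<alpha> \<beta> \<kappa> where "\<alpha> = cinner z u" and "\<beta> = cinner z v" and "\<kappa> = cinner u v"
  have \<kappa>: "cinner v u = cnj \<kappa>" "cinner u u = 1" "cinner v v = 1"
    using cinner_commute[of v u] by (simp_all add: \<kappa>_def cinner_self u v)
  define m where "m = 2 * \<mu> - \<kappa> * cnj \<kappa>"
  have "2 *\<^sub>C \<mu> *\<^sub>C z = 2 *\<^sub>C (proj u \<bullet>\<^sub>J proj v) z" by (simp add: eig)
  then have z: "(2 * \<mu>) *\<^sub>C z = (\<beta> * cnj \<kappa>) *\<^sub>C u + (\<alpha> * \<kappa>) *\<^sub>C v"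
    by (simp add: jordan_apply rank_one_def cinner_simps \<kappa> \<alpha>_def \<beta>_def flip: \<kappa>_def)
  have "cinner ((2 * \<mu>) *\<^sub>C z) u = \<beta> * cnj \<kappa> + \<alpha> * \<kappa> * cnj \<kappa>"
    unfolding z by (simp add: cinner_simps \<kappa>)
  then have 1: "m * \<alpha> = cnj \<kappa> * \<beta>"
    by (simp add: m_def cinner_simps algebra_simps flip: \<alpha>_def)
  have "cinner ((2 * \<mu>) *\<^sub>C z) v = \<beta> * cnj \<kappa> * \<kappa> + \<alpha> * \<kappa>"
    unfolding z by (simp add: cinner_simps \<kappa> flip: \<kappa>_def)
  then have 2: "m * \<beta> = \<kappa> * \<alpha>"
    by (simp add: m_def cinner_simps algebra_simps flip: \<beta>_def)
  have "\<alpha> \<noteq> 0 \<or> \<beta> \<noteq> 0" using z nz by auto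
  moreover have "m\<^sup>2 * \<alpha> = (\<kappa> * cnj \<kappa>) * \<alpha>"
  proof -
    have "m\<^sup>2 * \<alpha> = m * (m * \<alpha>)" by (simp add: power2_eq_square)
    also have "\<dots> = cnj \<kappa> * (m * \<beta>)" unfolding 1 by simp
    finally show ?thesis by (simp add: 2 mult.commute[of "cnj \<kappa>" \<kappa>])
  qed
  moreover have "m\<^sup>2 * \<beta> = (\<kappa> * cnj \<kappa>) * \<beta>"
  proof -
    have "m\<^sup>2 * \<beta> = m * (m * \<beta>)" by (simp add: power2_eq_square)
    also have "\<dots> = \<kappa> * (m * \<alpha>)" unfolding 2 by simp
    finally show ?thesis by (simp add: 1)
  qed
  moreover have dd: "\<kappa> * cnj \<kappa> = complex_of_real (d\<^sup>2)"
    using complex_norm_square[of \<kappa>] by (simp add: d_def \<kappa>_def)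
  ultimately have "m\<^sup>2 = (complex_of_real d)\<^sup>2" by auto
  then have "(2 * \<mu> - complex_of_real (d\<^sup>2))\<^sup>2 = (complex_of_real d)\<^sup>2" by (simp only: m_def dd)
  then have "2 * \<mu> - complex_of_real (d\<^sup>2) = complex_of_real d \<or>
      2 * \<mu> - complex_of_real (d\<^sup>2) = - complex_of_real d"
    by (simp only: power2_eq_iff)
  then have "2 * \<mu> = complex_of_real (d * (d + 1)) \<or> 2 * \<mu> = complex_of_real (d * (d - 1))"
    by (elim disjE) (simp_all add: power2_eq_square algebra_simps)
  moreover have "\<mu> = complex_of_real (x / 2)" if "2 * \<mu> = complex_of_real x" for x
    using that by (simp add: field_simps)
  ultimately show ?thesis by blast
qed

text \<open>
  A multiplicative self-map of the unit interval is monotone, hence a power function, and a power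
  function with a fixed point inside the interval is the identity.
\<close>

lemma multiplicative_fixed_point:
  fixes h :: "real \<Rightarrow> real"
  assumes mult: "\<And>x y. 0 < x \<Longrightarrow> x < 1 \<Longrightarrow> 0 < y \<Longrightarrow> y < 1 \<Longrightarrow> h (x * y) = h x * h y"
    and range: "\<And>x. 0 < x \<Longrightarrow> x < 1 \<Longrightarrow> 0 < h x \<and> h x \<le> 1"
    and a: "0 < a" "a < 1" "h a = a" and x: "0 < x" "x < 1"
  shows "h x = x"
proof -
  have mono: "h y \<le> h z" if "0 < y" "y \<le> z" "z < 1" for y z
  proof (cases "y = z")
    case False
    then have "h y = h z * h (y / z)" using that mult[of z "y / z"] by simp
    then show ?thesis using False that range[of z] range[of "y / z"] by (simp add: mult_left_le)
  qed simp
  have less_one: "0 < z ^ Suc n" "z ^ Suc n < 1" if "0 < z" "z < 1" for z :: real and n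
    using that by (simp_all add: power_Suc_less_one del: power_Suc)
  have power: "h (z ^ Suc n) = h z ^ Suc n" if "0 < z" "z < 1" for z n
    by (induction n) (use that less_one mult in simp_all)
  \<comment> \<open>A power of \<open>a\<close> fits between two numbers whose ratio exceeds \<open>1/a\<close>.\<close>
  have between: "\<exists>m. q < a ^ Suc m \<and> a ^ Suc m \<le> p" if "0 < q" "q < a * p" "p < 1" for p q
  proof -
    have "0 < p" using that a by (smt (verit) mult_nonneg_nonpos)
    then obtain k where "a ^ k < p" using real_arch_pow_inv[of p a] a by blast
    then have k: "a ^ k \<le> p" by simp
    define m where "m = (LEAST k. a ^ k \<le> p)"
    have m: "a ^ m \<le> p" unfolding m_def by (rule LeastI[of "\<lambda>k. a ^ k \<le> p", OF k])
    then have "m \<noteq> 0" using that(3) by (metis not_le power_0)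
    then obtain l where l: "m = Suc l" by (cases m) auto
    have "\<not> a ^ l \<le> p" using not_less_Least[of l "\<lambda>k. a ^ k \<le> p"] l m_def by simp
    then have "a * p < a * a ^ l" using a by simp
    then show ?thesis using that m l by (intro exI[of _ l]) auto
  qed
  have ratio: "\<exists>n. q ^ Suc n < a * p ^ Suc n" if "0 < q" "q < p" for p q :: real
  proof -
    have "q / p < 1" using that by simp
    then obtain n where "(q / p) ^ n < a" using real_arch_pow_inv[of a "q / p"] a by blast
    moreover have "(q / p) ^ Suc n \<le> (q / p) ^ n" using that by (intro power_decreasing) simp_all
    ultimately have "(q / p) ^ Suc n < a" by linarith
    then have "q ^ Suc n < a * p ^ Suc n" using that by (simp add: power_divide divide_less_eq del: power_Suc)
    then show ?thesis ..
  qed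
  note hx = range[OF x]
  show ?thesis
  proof (rule ccontr, drule neqE)
    assume "h x < x"
    then obtain n where n: "h x ^ Suc n < a * x ^ Suc n" using ratio hx by blast
    then obtain m where m: "h x ^ Suc n < a ^ Suc m" "a ^ Suc m \<le> x ^ Suc n"
      using between[OF _ n] hx less_one[OF x] by (auto simp del: power_Suc)
    have "h (a ^ Suc m) \<le> h (x ^ Suc n)" by (rule mono) (use m less_one a x in blast)+
    then show False using m(1) by (simp add: power a x del: power_Suc)
  next
    assume "x < h x"
    then obtain n where n: "x ^ Suc n < a * h x ^ Suc n" using ratio x by blast
    have "\<exists>m. x ^ Suc n < a ^ Suc m \<and> a ^ Suc m < h x ^ Suc n"
    proof -
      \<comment> \<open>The interval is shrunk a little to make the upper inequality strict.\<close>
      obtain p where p: "x ^ Suc n / a < p" "p < h x ^ Suc n"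
        using dense[of "x ^ Suc n / a" "h x ^ Suc n"] n a by (auto simp: divide_less_eq mult.commute simp del: power_Suc)
      have "h x ^ Suc n \<le> 1" using hx by (simp add: power_le_one del: power_Suc)
      then have "p < 1" using p by simp
      moreover have "x ^ Suc n < a * p" using p(1) a by (simp add: divide_less_eq mult.commute del: power_Suc)
      ultimately show ?thesis using between[of "x ^ Suc n" p] less_one[OF x] p(2) by (meson le_less_trans)
    qed
    then obtain m where m: "x ^ Suc n < a ^ Suc m" "a ^ Suc m < h x ^ Suc n" by blast
    have "h (x ^ Suc n) \<le> h (a ^ Suc m)" by (rule mono) (use m(1) less_one a x in \<open>simp_all del: power_Suc\<close>)
    then show False using m(2) by (simp add: power a x del: power_Suc)
  qed
qed

locale jordan_mean_map_dim2 = jordan_mean_map \<Phi>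
  for \<Phi> :: "('h::complex_hilbert \<Rightarrow> 'h) \<Rightarrow> ('k::complex_hilbert \<Rightarrow> 'k)" +
  assumes orthogonal_ex: "\<exists>v. norm v = 1 \<and> cinner (u::'h) v = 0"
begin

lemma unit_ex: "\<exists>u::'h. norm u = 1"
  using orthogonal_ex[of 0] by blast

lemma f0: "f 0 = 0" and f1: "f 1 = 1" and fmult: "f (\<alpha> * \<beta>) = f \<alpha> * f \<beta>"
  and f_minus1: "f (- 1) = - 1" and f_nz: "\<alpha> \<noteq> 0 \<Longrightarrow> f \<alpha> \<noteq> 0"
  using unit_ex f_zero f_one f_mult f_minus_one f_nonzero by blast+

lemma angle_ex:
  assumes "0 \<le> c" "c \<le> 1"
  shows "\<exists>u v::'h. norm u = 1 \<and> norm v = 1 \<and> cinner u v = complex_of_real c"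
proof -
  obtain u :: 'h where u: "norm u = 1" using unit_ex by blast
  obtain w where w: "norm w = 1" "cinner u w = 0" using orthogonal_ex by blast
  define v where "v = c *\<^sub>R u + sqrt (1 - c\<^sup>2) *\<^sub>R w"
  have "c\<^sup>2 \<le> 1" using assms by (simp add: power_le_one)
  then have "(norm v)\<^sup>2 = 1"
    unfolding v_def Re_cinner_norm by (simp add: cinner_simps u w power_mult_distrib)
  then have "norm v = 1" by (simp add: power2_eq_1_iff) (metis norm_ge_zero not_one_le_zero neg_0_le_iff_le)
  moreover have "cinner u v = complex_of_real c"
    by (simp add: v_def cinner_simps w cinner_self u)
  ultimately show ?thesis using u by blast
qed

lemma f_eigenvalue:
  assumes u: "norm u = 1" and v: "norm v = 1" and uv: "cinner u v = complex_of_real c"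
    and c: "0 < c" "c < 1"
  defines "d \<equiv> cmod (cinner (g u) (g v))"
  shows "f (complex_of_real (c * (c + 1) / 2)) = complex_of_real (d * (d + 1) / 2) \<or>
    f (complex_of_real (c * (c + 1) / 2)) = complex_of_real (d * (d - 1) / 2)"
proof -
  let ?e = "complex_of_real (c * (c + 1) / 2)"
  define w where "w = u + v"
  define w1 where "w1 = complex_of_real (1 / norm w) *\<^sub>C w"
  have "(norm w)\<^sup>2 = 2 + 2 * c"
    unfolding w_def Re_cinner_norm by (simp add: u v uv)
  then have "w \<noteq> 0" using c by auto
  then have w1: "norm w1 = 1" by (simp add: w1_def norm_divide)
  have "reducing (proj u \<bullet>\<^sub>J proj v) w1 ?e"
    unfolding w1_def w_def
    by (intro reducing_scale reducing_symmetric ops_jordan ops_rank_one jordan_symmetric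
        rank_one_symmetric jordan_proj_eigenvector u v uv)
  then have "reducing (\<Phi> (proj u \<bullet>\<^sub>J proj v)) (g w1) (f ?e)"
    by (rule reducing_image[OF ops_jordan[OF ops_rank_one ops_rank_one] w1])
  then have "(proj (g u) \<bullet>\<^sub>J proj (g v)) (g w1) = f ?e *\<^sub>C g w1"
    by (simp add: jordan_projections projection_proj g_proj u v reducing_def)
  moreover have "g w1 \<noteq> 0" using g_norm[OF w1] by auto
  moreover have "f ?e \<noteq> 0" by (rule f_nz, subst of_real_eq_0_iff) (use c in simp)
  ultimately show ?thesis
    unfolding d_def by (intro jordan_proj_eigenvalue g_norm u v)
qed

lemma g_angle_le_one: "norm u = 1 \<Longrightarrow> norm v = 1 \<Longrightarrow> cmod (cinner (g u) (g v)) \<le> 1"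
  using cauchy_schwarz[of "g u" "g v"] by (simp add: g_norm)

text \<open>
  Every number in the unit interval is of the form \<open>c(c + 1)/2\<close>, so its image is one of two real numbers
  of modulus at most one. It is positive as the square of the image of the square root.
\<close>

lemma f_unit_interval:
  assumes "0 < x" "x < 1"
  shows "\<exists>r. f (complex_of_real x) = complex_of_real r \<and> 0 < r \<and> r \<le> 1"
proof -
  have real: "\<exists>r. f (complex_of_real x) = complex_of_real r \<and> \<bar>r\<bar> \<le> 1" if x: "0 < x" "x < 1" for x
  proof -
    define c where "c = (sqrt (1 + 8 * x) - 1) / 2"
    have "(sqrt (1 + 8 * x))\<^sup>2 = 1 + 8 * x" using x by simp
    then have cx: "c * (c + 1) / 2 = x" by (simp add: c_def power2_eq_square field_simps)
    have "1 < sqrt (1 + 8 * x)" "sqrt (1 + 8 * x) < sqrt (3\<^sup>2)"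
      using x by (simp, intro real_sqrt_less_mono) simp
    then have c: "0 < c" "c < 1" by (simp_all add: c_def)
    obtain u v :: 'h where uv: "norm u = 1" "norm v = 1" "cinner u v = complex_of_real c"
      using angle_ex[of c] c by auto
    define d where "d = cmod (cinner (g u) (g v))"
    have d: "0 \<le> d" "d \<le> 1" using g_angle_le_one uv by (simp_all add: d_def)
    have "d * (d + 1) / 2 \<le> 1 * (1 + 1) / 2" using d by (intro divide_right_mono mult_mono) simp_all
    moreover have "d * (1 - d) \<le> 1 * 1" using d by (intro mult_mono) simp_all
    ultimately have "\<bar>d * (d + 1) / 2\<bar> \<le> 1" "\<bar>d * (d - 1) / 2\<bar> \<le> 1"
      using d by (simp_all add: abs_mult)
    then show ?thesis
      using f_eigenvalue[OF uv c] unfolding cx d_def by blast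
  qed
  obtain r where r: "f (complex_of_real (sqrt x)) = complex_of_real r" "\<bar>r\<bar> \<le> 1"
    using real[of "sqrt x"] assms by auto
  have "f (complex_of_real x) = f (complex_of_real (sqrt x) * complex_of_real (sqrt x))"
    using assms by (simp flip: of_real_mult)
  also have "\<dots> = complex_of_real (r * r)" by (simp add: fmult r)
  finally have fx: "f (complex_of_real x) = complex_of_real (r * r)" .
  have "r \<noteq> 0" using f_nz[of "complex_of_real x"] assms fx by auto
  moreover have "r * r \<le> 1" using r(2) by (simp add: abs_le_square_iff[of r 1, simplified] power2_eq_square)
  ultimately show ?thesis using fx by (intro exI[of _ "r * r"]) (auto simp: zero_less_mult_iff linorder_neq_iff)
qed

text \<open>
  Vectors at an angle of 45 degrees give a fixed point of \<open>f\<close>. Indeed, if \<open>v\<close> and \<open>v'\<close> are orthonormal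
  and \<open>u\<close> is at this angle to both, then the images of \<open>v\<close> and \<open>v'\<close> are orthonormal with the
  image of \<open>u\<close> in their span, and both angles of the latter to the former are determined by the same
  value of \<open>f\<close>.
\<close>

lemma f_fixed_point:
  defines "c \<equiv> 1 / sqrt 2"
  shows "f (complex_of_real (c * (c + 1) / 2)) = complex_of_real (c * (c + 1) / 2)"
proof -
  have c: "0 < c" "c < 1" "c * c = 1 / 2" by (simp_all add: c_def)
  obtain v :: 'h where v: "norm v = 1" using unit_ex by blast
  obtain v' where v': "norm v' = 1" "cinner v v' = 0" using orthogonal_ex by blast
  have v'v: "cinner v' v = 0" using v'(2) cinner_0_commute by blast
  define u where "u = c *\<^sub>R v + c *\<^sub>R v'"
  have "(norm u)\<^sup>2 = 1"
    unfolding u_def Re_cinner_norm using c by (simp add: cinner_simps v v' power2_eq_square)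
  then have u: "norm u = 1" by (simp add: power2_eq_1_iff) (metis norm_ge_zero not_one_le_zero neg_0_le_iff_le)
  have uv: "cinner u v = complex_of_real c" "cinner u v' = complex_of_real c"
    by (simp_all add: u_def cinner_simps v' v'v cinner_self v)
  define d d' where "d = cmod (cinner (g u) (g v))" and "d' = cmod (cinner (g u) (g v'))"
  have d: "0 \<le> d" "d \<le> 1" "0 \<le> d'" "d' \<le> 1"
    using g_angle_le_one u v v' by (simp_all add: d_def d'_def)
  obtain r where r: "f (complex_of_real (c * (c + 1) / 2)) = complex_of_real r" "0 < r"
    using f_unit_interval[of "c * (c + 1) / 2"] c by (auto simp: algebra_simps)
  have nonpos: "e * (e - 1) / 2 \<le> 0" if "0 \<le> e" "e \<le> 1" for e :: real
    using that by (simp add: mult_nonneg_nonpos)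
  have rd: "r = d * (d + 1) / 2" "r = d' * (d' + 1) / 2"
    using f_eigenvalue[OF u v uv(1) c(1,2)] f_eigenvalue[OF u v'(1) uv(2) c(1,2)]
      nonpos[OF d(1,2)] nonpos[OF d(3,4)] r unfolding d_def[symmetric] d'_def[symmetric]
    by (auto simp only: of_real_eq_iff simp_thms)
  have "(d - d') * (d + d' + 1) = 0" using rd by (simp add: algebra_simps)
  then have dd': "d = d'" using d by simp
  define a a' where "a = cinner (g u) (g v)" and "a' = cinner (g u) (g v')"
  have gg: "cinner (g v) (g v) = 1" "cinner (g v') (g v') = 1" "cinner (g v) (g v') = 0" "cinner (g v') (g v) = 0"
    by (simp_all add: cinner_self g_norm v v' g_orthogonal v'v)
  have "g u = a *\<^sub>C g v + a' *\<^sub>C g v'"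
  proof (rule ccontr)
    define w where "w = g u - a *\<^sub>C g v - a' *\<^sub>C g v'"
    assume "\<not> ?thesis"
    then have "w \<noteq> 0" by (simp add: w_def algebra_simps)
    then obtain w0 b where w0: "norm w0 = 1" "w = b *\<^sub>C g w0" "b \<noteq> 0" by (rule multiple_of_image)
    have wv: "cinner w (g v) = 0" "cinner w (g v') = 0"
      by (simp_all add: w_def cinner_simps gg a_def a'_def)
    then have "cinner w0 v = 0" "cinner w0 v' = 0"
      using w0 by (simp_all add: cinner_simps g_orthogonal v v')
    then have "cinner w0 u = 0" by (simp add: u_def cinner_simps)
    then have "cinner w (g u) = 0" by (simp add: w0 cinner_simps g_orthogonal u)
    then have "cinner w w = 0" by (subst (2) w_def) (simp add: cinner_simps wv)
    then show False using \<open>w \<noteq> 0\<close> by simp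
  qed
  then have "(norm (g u))\<^sup>2 = (norm (a *\<^sub>C g v))\<^sup>2 + (norm (a' *\<^sub>C g v'))\<^sup>2"
    using Re_cinner_norm[of "a *\<^sub>C g v" "a' *\<^sub>C g v'"] by (simp add: cinner_simps gg)
  then have "d\<^sup>2 + d'\<^sup>2 = 1" by (simp add: g_norm u v v' a_def a'_def d_def d'_def)
  then have "d\<^sup>2 = c\<^sup>2" using dd' c(3) by (simp add: power2_eq_square)
  then have "d = c" using d c by (simp add: power2_eq_iff_nonneg)
  then show ?thesis using r rd by simp
qed

lemma f_nonneg_real:
  assumes "0 \<le> x" shows "f (complex_of_real x) = complex_of_real x"
proof -
  define h where "h x = Re (f (complex_of_real x))" for x
  have h: "f (complex_of_real x) = complex_of_real (h x)" "0 < h x \<and> h x \<le> 1" if "0 < x" "x < 1" for x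
    using f_unit_interval[OF that] by (auto simp: h_def)
  define c :: real where "c = 1 / sqrt 2"
  define a where "a = c * (c + 1) / 2"
  have "0 < c" "c < 1" "c * c = 1 / 2" by (simp_all add: c_def)
  then have a: "0 < a" "a < 1" by (simp_all add: a_def algebra_simps)
  have ha: "h a = a" using f_fixed_point by (simp add: h_def a_def c_def)
  have fixed: "f (complex_of_real x) = complex_of_real x" if x: "0 < x" "x < 1" for x
  proof -
    have "h x = x"
    proof (rule multiplicative_fixed_point[where h = h, OF _ h(2) a ha x])
      show "h (x * y) = h x * h y" if "0 < x" "x < 1" "0 < y" "y < 1" for x y
        unfolding h_def[of "x * y"] of_real_mult fmult h(1)[OF that(1,2)] h(1)[OF that(3,4)] by simp
    qed
    then show ?thesis using h(1)[OF x] by simp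
  qed
  consider "x = 0" | "0 < x" "x < 1" | "x = 1" | "1 < x" using assms by linarith
  then show ?thesis
  proof cases
    case 4
    then have "f (complex_of_real (1 / x)) = complex_of_real (1 / x)" by (intro fixed) simp_all
    moreover have "f (complex_of_real (1 / x)) * f (complex_of_real x) = 1"
      using 4 f1 by (simp flip: fmult)
    ultimately have "complex_of_real (1 / x) * f (complex_of_real x) = 1" by simp
    then show ?thesis using 4 by (simp add: field_simps)
  qed (simp_all add: f0 f1 fixed)
qed

lemma transition_probability:
  assumes u: "norm u = 1" and v: "norm v = 1"
  shows "cmod (cinner (g u) (g v)) = cmod (cinner u v)"
proof (cases "cinner u v = 0")
  case True
  then show ?thesis using g_orthogonal[OF u v] by simp
next
  case False
  define c where "c = cmod (cinner u v)"
  have c: "0 < c" "c \<le> 1" using False cauchy_schwarz[of u v] by (simp_all add: c_def u v)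
  \<comment> \<open>The phase of \<open>v\<close> is changed so as to make the inner product positive.\<close>
  define v1 where "v1 = (cinner u v / complex_of_real c) *\<^sub>C v"
  have phase: "cmod (cinner u v / complex_of_real c) = 1" using c by (simp add: norm_divide c_def)
  have v1: "norm v1 = 1" using phase by (simp add: v1_def v)
  have uv1: "cinner u v1 = complex_of_real c"
  proof -
    have "cnj (cinner u v) * cinner u v = complex_of_real c * complex_of_real c"
      using complex_norm_square[of "cinner u v"] by (simp add: c_def power2_eq_square mult.commute)
    then show ?thesis using c by (simp add: v1_def cinner_simps)
  qed
  have "proj v1 = proj v" unfolding v1_def by (rule proj_phase[OF phase])
  then have "proj (g v1) = proj (g v)" using g_proj[OF v1] g_proj[OF v] by simp
  then obtain k where k: "g v1 = k *\<^sub>C g v" using proj_eq_imp[OF g_norm[OF v1]] by blast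
  then have "cmod k = 1" using g_norm[OF v1] g_norm[OF v] by simp
  then have d: "cmod (cinner (g u) (g v)) = cmod (cinner (g u) (g v1))"
    by (simp add: k cinner_scaleC_right norm_mult)
  have "cmod (cinner (g u) (g v1)) = c"
  proof (cases "c = 1")
    case True
    have "(norm (u - v1))\<^sup>2 = 0" unfolding norm_diff_cinner by (simp add: u v1 uv1 True)
    then show ?thesis using True by (simp add: cinner_self g_norm v1)
  next
    case False
    let ?d = "cmod (cinner (g u) (g v1))"
    have d: "0 \<le> ?d" "?d \<le> 1" using g_angle_le_one[OF u v1] by simp_all
    have "f (complex_of_real (c * (c + 1) / 2)) = complex_of_real (c * (c + 1) / 2)"
      by (rule f_nonneg_real) (use c in simp)
    then have "c * (c + 1) / 2 = ?d * (?d + 1) / 2 \<or> c * (c + 1) / 2 = ?d * (?d - 1) / 2"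
      using f_eigenvalue[OF u v1 uv1] c False by (simp only: of_real_eq_iff simp_thms)
    moreover have "?d * (?d - 1) / 2 \<le> 0" using d by (simp add: mult_nonneg_nonpos)
    moreover have "0 < c * (c + 1) / 2" using c by simp
    ultimately have "c * (c + 1) / 2 = ?d * (?d + 1) / 2" by linarith
    then have "(c - ?d) * (c + ?d + 1) = 0" by (simp add: algebra_simps)
    then show ?thesis using c d by auto
  qed
  then show ?thesis using d by (simp add: c_def)
qed

text \<open>
  Wigner's theorem is applied to the extension of \<open>g\<close> that is homogeneous for positive factors.
\<close>

lemma symmetry_ex: "\<exists>U. symmetry_op U \<and> (\<forall>u. norm u = 1 \<longrightarrow> \<Phi> (proj u) = proj (U u))"
proof -
  define G where "G z = complex_of_real (norm z) *\<^sub>C g (complex_of_real (1 / norm z) *\<^sub>C z)" for z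
  have unit: "norm (complex_of_real (1 / norm z) *\<^sub>C z) = 1" if "z \<noteq> 0" for z :: 'h
    using that by (simp add: norm_divide)
  have G_inner: "cmod (cinner (G z) (G w)) = cmod (cinner z w)" for z w
  proof (cases "z = 0 \<or> w = 0")
    case True
    then show ?thesis by (auto simp: G_def)
  next
    case False
    then show ?thesis
      by (simp add: G_def cinner_simps norm_mult transition_probability[OF unit unit] norm_divide
          del: of_real_divide)
  qed
  have Gg: "G u = g u" if "norm u = 1" for u using that by (simp add: G_def)
  have G_surj: "\<exists>x c. y = c *\<^sub>C G x" for y
  proof (cases "y = 0")
    case True
    then show ?thesis by (intro exI[of _ 0]) simp
  next
    case False
    then obtain u c where "norm u = 1" "y = c *\<^sub>C g u" by (rule multiple_of_image)
    then show ?thesis using Gg by metis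
  qed
  obtain e :: 'h where "norm e = 1" using unit_ex by blast
  from wigner[OF G_inner G_surj this] obtain U
    where U: "symmetry_op U" "\<And>z. \<exists>c. U z = c *\<^sub>C G z" by blast
  have "\<Phi> (proj u) = proj (U u)" if u: "norm u = 1" for u
  proof -
    obtain c where c: "U u = c *\<^sub>C g u" using U(2)[of u] Gg[OF u] by metis
    then have "cmod c = 1" using symmetry_norm[OF U(1), of u] g_norm[OF u] u by simp
    then show ?thesis using g_proj[OF u] proj_phase[of c "g u"] c by simp
  qed
  then show ?thesis using U(1) by blast
qed

end

section \<open>Maps fixing the projections of rank one\<close>

lemma jordan_rank_one_apply:
  assumes "A \<in> bounded_ops"
  shows "(A \<bullet>\<^sub>J rank_one x y) z = (1/2) *\<^sub>C (cinner z y *\<^sub>C A x + cinner (A z) y *\<^sub>C x)"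
  by (simp add: jordan_apply rank_one_def op_scaleC assms)

lemma jordan_rank_one_trace:
  assumes A: "A \<in> bounded_ops"
  shows "has_trace (A \<bullet>\<^sub>J rank_one x y) (cinner (A x) y)"
proof -
  have "has_trace (\<lambda>z. (1/2) *\<^sub>C (rank_one (A x) y z + rank_one x (cadjoint A y) z))
      (1/2 * (cinner (A x) y + cinner x (cadjoint A y)))"
    by (intro has_trace_scaleC has_trace_add has_trace_rank_one)
  moreover have "(\<lambda>z. (1/2) *\<^sub>C (rank_one (A x) y z + rank_one x (cadjoint A y) z)) = A \<bullet>\<^sub>J rank_one x y"
    by (rule ext, simp add: jordan_rank_one_apply[OF A]) (simp add: rank_one_def cinner_cadjoint[OF A])
  ultimately show ?thesis by (simp add: cinner_cadjoint[OF A])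
qed

lemma rank_one_is_mean: "\<exists>c. mean_transform (rank_one c b) = rank_one a b"
proof (cases "b = 0")
  case True
  then show ?thesis by (simp add: rank_one_def)
next
  case False
  define c where "c = 2 *\<^sub>C a - (cinner a b / (norm b)\<^sup>2) *\<^sub>C b"
  have "cinner c b = cinner a b" using False by (simp add: c_def cinner_simps cinner_self)
  then have "mean_transform (rank_one c b) = rank_one a b"
    unfolding mean_rank_one by (simp add: c_def)
  then show ?thesis ..
qed

lemma orthonormal_decomposition:
  fixes x y :: "'a::complex_hilbert"
  assumes "norm x = 1" "norm y = 1" "cinner x y = 0"
  obtains w where "z = cinner z x *\<^sub>C x + cinner z y *\<^sub>C y + w" "cinner w x = 0" "cinner w y = 0"
proof
  have "cinner y x = 0" using assms(3) cinner_0_commute by blast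
  then show "cinner (z - cinner z x *\<^sub>C x - cinner z y *\<^sub>C y) x = 0"
    "cinner (z - cinner z x *\<^sub>C x - cinner z y *\<^sub>C y) y = 0"
    using assms by (simp_all add: cinner_simps cinner_self)
qed simp

text \<open>
  An operator carried on both sides by the span of the orthonormal pair \<open>x, y\<close> is a 2 by 2 matrix.
\<close>

lemma matrix_form:
  assumes X: "X \<in> bounded_ops" and xy: "norm x = 1" "norm y = 1" "cinner x y = 0"
    and carried: "\<And>w. cinner w x = 0 \<Longrightarrow> cinner w y = 0 \<Longrightarrow> reducing X w 0"
  shows "X x = cinner (X x) x *\<^sub>C x + cinner (X x) y *\<^sub>C y" (is ?x)
    and "X y = cinner (X y) x *\<^sub>C x + cinner (X y) y *\<^sub>C y" (is ?y)
    and "X z = cinner z x *\<^sub>C X x + cinner z y *\<^sub>C X y"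
proof -
  have range: "X v = cinner (X v) x *\<^sub>C x + cinner (X v) y *\<^sub>C y" for v
  proof -
    obtain w where w: "X v = cinner (X v) x *\<^sub>C x + cinner (X v) y *\<^sub>C y + w"
      "cinner w x = 0" "cinner w y = 0"
      by (rule orthonormal_decomposition[OF xy])
    have "cinner (X v) w = 0" using carried[OF w(2,3)] by (simp add: reducing_def)
    moreover have "cinner x w = 0" "cinner y w = 0" using w(2,3) cinner_0_commute by blast+
    ultimately have "cinner w w = 0" using arg_cong[OF w(1), of "\<lambda>u. cinner u w"] by (simp add: cinner_simps)
    then show ?thesis using w(1) by simp
  qed
  show ?x ?y by (rule range)+
  obtain w where w: "z = cinner z x *\<^sub>C x + cinner z y *\<^sub>C y + w" "cinner w x = 0" "cinner w y = 0"
    by (rule orthonormal_decomposition[OF xy])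
  have "X z = X (cinner z x *\<^sub>C x + cinner z y *\<^sub>C y + w)" by (rule arg_cong[OF w(1)])
  then show "X z = cinner z x *\<^sub>C X x + cinner z y *\<^sub>C X y"
    using carried[OF w(2,3)] by (simp add: op_simps X reducing_def)
qed

text \<open>
  The situation after composition with the conjugation found above.
\<close>

locale fixes_projections = jordan_mean_map_dim2 \<Phi>
  for \<Phi> :: "('h::complex_hilbert \<Rightarrow> 'h) \<Rightarrow> ('h \<Rightarrow> 'h)" +
  assumes fixes_proj: "norm u = 1 \<Longrightarrow> \<Phi> (proj u) = proj u"
begin

lemma reducing_fixed:
  assumes A: "A \<in> bounded_ops" and red: "reducing A u \<alpha>"
  shows "reducing (\<Phi> A) u (f \<alpha>)"
proof (cases "u = 0")
  case True
  then show ?thesis using ops[OF A] by (simp add: reducing_def op_zero)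
next
  case False
  define v where "v = complex_of_real (1 / norm u) *\<^sub>C u"
  have v: "norm v = 1" using False by (simp add: v_def norm_divide)
  have "proj v = proj (g v)" using fixes_proj[OF v] g_proj[OF v] by simp
  then have "v = cinner v (g v) *\<^sub>C g v" by (rule proj_eq_imp[OF v])
  moreover have "reducing (\<Phi> A) (cinner v (g v) *\<^sub>C g v) (f \<alpha>)"
    unfolding v_def
    by (rule reducing_scale[OF ops[OF A]], rule reducing_image[OF A], fold v_def, rule v)
      (unfold v_def, rule reducing_scale[OF A red])
  ultimately have "reducing (\<Phi> A) v (f \<alpha>)" by simp
  then have "reducing (\<Phi> A) (complex_of_real (norm u) *\<^sub>C v) (f \<alpha>)"
    by (rule reducing_scale[OF ops[OF A]])
  then show ?thesis using False by (simp add: v_def scaleC_one)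
qed

lemma carried_image:
  assumes A: "A \<in> bounded_ops"
    and "\<And>w. cinner w x = 0 \<Longrightarrow> cinner w y = 0 \<Longrightarrow> reducing A w 0"
    and "cinner w x = 0" "cinner w y = 0"
  shows "reducing (\<Phi> A) w 0"
  using reducing_fixed[OF A assms(2)[OF assms(3,4)]] f0 by simp

lemma square_zero: "A \<in> bounded_ops \<Longrightarrow> (\<And>x. A (A x) = 0) \<Longrightarrow> \<Phi> A (\<Phi> A x) = 0"
  using jordan_zero[of A A] unfolding jordan_self by (metis (no_types))

lemma scale_rank_one: "\<Phi> (rank_one (c *\<^sub>C a) b) z = f c *\<^sub>C \<Phi> (rank_one a b) z"
proof -
  obtain t where "mean_transform (rank_one t b) = rank_one a b" using rank_one_is_mean by blast
  then show ?thesis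
    using fun_cong[OF scale_mean_image[OF ops_rank_one[of t b], of c], of z]
    by (simp add: rank_one_scale_left)
qed

context
  fixes x y :: 'h
  assumes xy: "norm x = 1" "norm y = 1" "cinner x y = 0"
begin

lemma inner_xy: "cinner x x = 1" "cinner y y = 1" "cinner x y = 0" "cinner y x = 0"
  using xy cinner_0_commute[of x y] by (simp_all add: cinner_self)

lemma carried_span:
  assumes "cinner w x = 0" "cinner w y = 0"
  shows "reducing (rank_one (a *\<^sub>C x + b *\<^sub>C y) y) w 0"
  using assms cinner_0_commute[of w x] cinner_0_commute[of w y]
  by (simp add: reducing_def rank_one_def cinner_simps)

lemma jordan_nilpotent_proj:
  "rank_one x y \<bullet>\<^sub>J proj x = rank_one ((1/2) *\<^sub>C x) y"
  "rank_one x y \<bullet>\<^sub>J proj y = rank_one ((1/2) *\<^sub>C x) y"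
  by (rule ext, simp add: jordan_apply rank_one_def cinner_simps inner_xy mult.commute)+

lemma mean_nilpotent: "mean_transform (rank_one (c *\<^sub>C x) y) = rank_one ((c/2) *\<^sub>C x) y"
  by (simp add: mean_rank_one cinner_simps inner_xy)

text \<open>
  For the nilpotent \<open>N = x \<otimes> y\<close> one has \<open>N \<circ> P = N/2\<close> for the projections \<open>P\<close> onto \<open>\<complex>x\<close> and \<open>\<complex>y\<close>.
  Comparing traces shows that both diagonal entries of the matrix of the image vanish, and its
  square being zero, one of the off-diagonal entries does.
\<close>

lemma nilpotent_image:
  "\<exists>r. \<Phi> (rank_one x y) = rank_one (r *\<^sub>C x) y \<or> \<Phi> (rank_one x y) = rank_one (r *\<^sub>C y) x"
proof -
  define X where "X = \<Phi> (rank_one x y)"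
  have X: "X \<in> bounded_ops" unfolding X_def by (rule ops[OF ops_rank_one])
  have carried: "reducing X w 0" if "cinner w x = 0" "cinner w y = 0" for w
    unfolding X_def
    by (rule carried_image[OF ops_rank_one _ that]) (use carried_span[of _ 1 0] in simp)
  note form = matrix_form[OF X xy carried]
  define a b c d where "a = cinner (X x) x" and "b = cinner (X x) y" and "c = cinner (X y) x"
    and "d = cinner (X y) y"
  have Xx: "X x = a *\<^sub>C x + b *\<^sub>C y" and Xy: "X y = c *\<^sub>C x + d *\<^sub>C y"
    using form(1,2) by (simp_all only: a_def b_def c_def d_def)
  have quarter: "f (1/4) = 1/4" using f_nonneg_real[of "1/4"] by simp
  have trX: "has_trace X (a + d)"
  proof -
    have "has_trace (\<lambda>z. rank_one (X x) x z + rank_one (X y) y z) (a + d)"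
      unfolding a_def d_def by (intro has_trace_add has_trace_rank_one)
    moreover have "(\<lambda>z. rank_one (X x) x z + rank_one (X y) y z) = X"
      by (rule ext) (simp add: rank_one_def flip: form(3))
    ultimately show ?thesis by simp
  qed
  have tr: "4 * cinner (X u) u = a + d" if u: "norm u = 1"
    and half: "rank_one x y \<bullet>\<^sub>J proj u = rank_one ((1/2) *\<^sub>C x) y" for u
  proof -
    have "mean_transform (X \<bullet>\<^sub>J proj u) = \<Phi> (rank_one ((1/4) *\<^sub>C x) y)"
      using mean_jordan[OF ops_rank_one[of x y] ops_rank_one[of u u]]
      by (simp add: half mean_nilpotent X_def fixes_proj u)
    then have "mean_transform (X \<bullet>\<^sub>J proj u) = (\<lambda>z. (1/4) *\<^sub>C X z)"
      by (simp add: fun_eq_iff scale_rank_one X_def quarter)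
    moreover have "has_trace (mean_transform (X \<bullet>\<^sub>J proj u)) (cinner (X u) u)"
      by (intro has_trace_mean ops_jordan X ops_rank_one jordan_rank_one_trace)
    ultimately have "cinner (X u) u = 1/4 * (a + d)"
      using has_trace_unique has_trace_scaleC[OF trX] by metis
    then show ?thesis by (simp add: mult.commute)
  qed
  have "4 * a = a + d" "4 * d = a + d"
    using tr[OF xy(1) jordan_nilpotent_proj(1)] tr[OF xy(2) jordan_nilpotent_proj(2)]
    by (simp_all only: a_def d_def)
  then have "8 * a = 0" "8 * d = 0" by algebra+
  then have ad: "a = 0" "d = 0" by simp_all
  have "X (X x) = 0"
    unfolding X_def by (rule square_zero[OF ops_rank_one]) (simp add: rank_one_def cinner_simps inner_xy)
  then have "(b * c) *\<^sub>C x = 0" by (simp add: Xx Xy ad op_simps X)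
  then have "b = 0 \<or> c = 0" using xy(1) by auto
  then have "X = rank_one (c *\<^sub>C x) y \<or> X = rank_one (b *\<^sub>C y) x"
    by (auto simp: fun_eq_iff rank_one_def form(3)[of _] Xx Xy ad)
  then show ?thesis unfolding X_def by blast
qed

lemma idempotent_jordan_proj:
  "rank_one (t *\<^sub>C x + y) y \<bullet>\<^sub>J proj x = rank_one ((t/2) *\<^sub>C x) y"
  by (rule ext) (simp add: jordan_apply rank_one_def cinner_simps inner_xy mult.commute scaleC_add_right)

lemma mean_idempotent: "mean_transform (rank_one (t *\<^sub>C x + y) y) = rank_one ((t/2) *\<^sub>C x + y) y"
proof -
  have "(1/2) *\<^sub>C y + (1/2) *\<^sub>C y = y" by (simp flip: scaleC_add_left)
  then show ?thesis by (simp add: mean_rank_one cinner_simps inner_xy xy scaleC_add_right add.assoc scaleC_one)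
qed

lemma idempotent_image_mean:
  "mean_transform (\<Phi> (rank_one (t *\<^sub>C x + y) y) \<bullet>\<^sub>J proj x) = \<Phi> (rank_one ((t/4) *\<^sub>C x) y)"
  using mean_jordan[OF ops_rank_one[of "t *\<^sub>C x + y" y] ops_rank_one[of x x]]
  by (simp add: idempotent_jordan_proj mean_nilpotent fixes_proj xy)

text \<open>
  The transposed alternative is excluded by the idempotents \<open>T = (tx + y) \<otimes> y\<close>. Their images would be of
  the form \<open>y \<otimes> q\<close> with range \<open>\<complex>y\<close>. The mean transform of \<open>T\<close> is again of the form \<open>(sx + y) \<otimes> y\<close>, whereas
  the mean transform changes the range of \<open>y \<otimes> q\<close> unless \<open>q\<close> is a multiple of \<open>y\<close> or orthogonal to \<open>y\<close>. A
  multiple is impossible because \<open>\<langle>x, q\<rangle> \<noteq> 0\<close> for \<open>t = 1\<close>, and orthogonality because \<open>T\<close> does not have square zero.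
\<close>

lemma nilpotent_image_not_transposed:
  assumes N: "\<Phi> (rank_one x y) = rank_one (r *\<^sub>C y) x" shows False
proof -
  have "\<Phi> (rank_one x y) \<noteq> (\<lambda>z. 0)"
    using xy by (auto simp: eq_zero[OF ops_rank_one] rank_one_zero_iff)
  then have r: "r \<noteq> 0" unfolding N by (auto simp: rank_one_def)
  have form: "\<exists>d. \<Phi> (rank_one (t *\<^sub>C x + y) y) = rank_one y (cnj (f t * r) *\<^sub>C x + cnj d *\<^sub>C y)" for t
  proof -
    define X where "X = \<Phi> (rank_one (t *\<^sub>C x + y) y)"
    have X: "X \<in> bounded_ops" unfolding X_def by (rule ops[OF ops_rank_one])
    have carried: "reducing X w 0" if "cinner w x = 0" "cinner w y = 0" for w
      unfolding X_def
      by (rule carried_image[OF ops_rank_one _ that]) (use carried_span[of _ t 1] in \<open>simp add: scaleC_one\<close>)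
    note form = matrix_form[OF X xy carried]
    have "\<Phi> (rank_one ((t/4) *\<^sub>C x) y) = rank_one ((f (t/4) * r) *\<^sub>C y) x"
      by (rule ext) (simp add: scale_rank_one N, simp add: rank_one_def mult.left_commute)
    then have "mean_transform (X \<bullet>\<^sub>J proj x) = rank_one ((f (t/4) * r) *\<^sub>C y) x"
      using idempotent_image_mean[of t] by (simp add: X_def)
    from mean_eq_rank_one_imp[OF ops_jordan[OF X ops_rank_one] this]
    have *: "X \<bullet>\<^sub>J proj x = rank_one ((2 * (f (t/4) * r)) *\<^sub>C y) x"
      by (simp add: cinner_simps inner_xy)
    have ft: "4 * f (t/4) = f t"
      using fmult[of 4 "t/4"] f_nonneg_real[of 4] by simp
    have at: "cinner z x *\<^sub>C X x + cinner (X z) x *\<^sub>C x = (cinner z x * (f t * r)) *\<^sub>C y" for z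
    proof -
      have "2 *\<^sub>C (X \<bullet>\<^sub>J proj x) z = (cinner z x * (4 * f (t/4) * r)) *\<^sub>C y"
        unfolding * by (simp add: rank_one_def ac_simps)
      then show ?thesis by (simp add: jordan_rank_one_apply[OF X] ft)
    qed
    have "cinner (X x + cinner (X x) x *\<^sub>C x) x = 0"
      using at[of x] by (simp add: inner_xy scaleC_one cinner_scaleC_left)
    then have "cinner (X x) x = 0" by (simp add: cinner_simps inner_xy)
    then have Xx: "X x = (f t * r) *\<^sub>C y" using at[of x] by (simp add: inner_xy scaleC_one)
    have "cinner (X y) x = 0" using at[of y] xy by (auto simp: inner_xy)
    then obtain d where Xy: "X y = d *\<^sub>C y" using form(2) by simp
    have "X z = rank_one y (cnj (f t * r) *\<^sub>C x + cnj d *\<^sub>C y) z" for z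
      using form(3)[of z] by (simp add: Xx Xy rank_one_def cinner_simps scaleC_add_left ac_simps)
    then show ?thesis unfolding X_def by (intro exI ext)
  qed
  obtain d where d: "\<Phi> (rank_one (1 *\<^sub>C x + y) y) = rank_one y (cnj (f 1 * r) *\<^sub>C x + cnj d *\<^sub>C y)"
    using form by blast
  define q where "q = cnj (f 1 * r) *\<^sub>C x + cnj d *\<^sub>C y"
  obtain p where p: "\<Phi> (rank_one ((1/2) *\<^sub>C x + y) y) = rank_one y p" using form by blast
  have inner: "cinner x q = r" "cinner q x = cnj r" "cinner y q = d"
    by (simp_all add: q_def cinner_simps inner_xy f1)
  have q0: "q \<noteq> 0" using inner r by auto
  have "rank_one y p = mean_transform (rank_one y q)"
    using mean_commute[OF ops_rank_one[of "1 *\<^sub>C x + y" y]] d p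
    unfolding mean_idempotent by (simp add: q_def)
  then have "rank_one y p x = rank_one ((1/2) *\<^sub>C (y + (cinner y q / (norm q)\<^sup>2) *\<^sub>C q)) q x"
    unfolding mean_rank_one by (rule fun_cong)
  then have "cinner (rank_one y p x) x
      = cinner (rank_one ((1/2) *\<^sub>C (y + (cinner y q / (norm q)\<^sup>2) *\<^sub>C q)) q x) x" by simp
  then have "d = 0"
    using r q0 by (simp add: rank_one_def cinner_simps inner_xy inner)
  then have "\<Phi> (rank_one (1 *\<^sub>C x + y) y) \<bullet>\<^sub>J \<Phi> (rank_one (1 *\<^sub>C x + y) y) = (\<lambda>z. 0)"
    unfolding d jordan_self by (simp add: rank_one_def cinner_simps inner_xy)
  then have "rank_one (1 *\<^sub>C x + y) y \<bullet>\<^sub>J rank_one (1 *\<^sub>C x + y) y = (\<lambda>z. 0)"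
    by (simp add: jordan_zero ops_rank_one)
  then have "rank_one (1 *\<^sub>C x + y) y (rank_one (1 *\<^sub>C x + y) y y) = 0"
    unfolding jordan_self by metis
  then have "cinner (rank_one (1 *\<^sub>C x + y) y (rank_one (1 *\<^sub>C x + y) y y)) y = 0" by simp
  then show False by (simp add: rank_one_def cinner_simps inner_xy)
qed

text \<open>
  The remaining factor is determined by the Jordan product with the self-adjoint operator exchanging \<open>x\<close>
  and \<open>y\<close>, which is fixed by \<open>\<Phi>\<close>, having the eigenvectors \<open>x \<plusminus> y\<close>.
\<close>

lemma nilpotent_fixed: "\<Phi> (rank_one x y) = rank_one x y"
proof -
  obtain r where r: "\<Phi> (rank_one x y) = rank_one (r *\<^sub>C x) y"
    using nilpotent_image nilpotent_image_not_transposed by blast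
  define B where "B = (\<lambda>z. rank_one x y z + rank_one y x z)"
  have B: "B \<in> bounded_ops" unfolding B_def by (rule ops_add; rule ops_rank_one)
  have \<Phi>B: "\<Phi> B \<in> bounded_ops" by (rule ops[OF B])
  have red: "reducing B (x + y) 1" "reducing B (x - y) (- 1)"
    by (simp_all add: reducing_def B_def rank_one_def cinner_simps inner_xy scaleC_one)
  have "\<Phi> B (x + y) = x + y" "\<Phi> B (x - y) = - (x - y)"
    using reducing_fixed[OF B red(1)] reducing_fixed[OF B red(2)] f1 f_minus1
    by (simp_all add: reducing_def scaleC_one)
  then have sum: "\<Phi> B x + \<Phi> B y = x + y" and diff: "\<Phi> B x - \<Phi> B y = y - x"
    by (simp_all add: op_simps \<Phi>B)
  have double: "2 *\<^sub>C v = v + v" for v :: 'h using scaleC_add_left[of 1 1 v] by (simp add: scaleC_one)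
  have "2 *\<^sub>C \<Phi> B x = (\<Phi> B x + \<Phi> B y) + (\<Phi> B x - \<Phi> B y)"
    "2 *\<^sub>C \<Phi> B y = (\<Phi> B x + \<Phi> B y) - (\<Phi> B x - \<Phi> B y)"
    by (simp_all add: double)
  then have "2 *\<^sub>C \<Phi> B x = 2 *\<^sub>C y" "2 *\<^sub>C \<Phi> B y = 2 *\<^sub>C x"
    unfolding sum diff by (simp_all add: double)
  then have Bxy: "\<Phi> B x = y" "\<Phi> B y = x" by (simp_all only: complex_vector.scale_cancel_left) simp_all
  have "mean_transform (rank_one x y \<bullet>\<^sub>J B) = rank_one x y \<bullet>\<^sub>J B"
  proof (rule mean_selfadjoint[OF ops_jordan[OF ops_rank_one B]])
    have *: "(rank_one x y \<bullet>\<^sub>J B) u = (1/2) *\<^sub>C (proj x u + proj y u)" for u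
      by (simp add: jordan_apply B_def rank_one_def cinner_simps inner_xy)
    show "cinner ((rank_one x y \<bullet>\<^sub>J B) u) v = cinner u ((rank_one x y \<bullet>\<^sub>J B) v)" for u v
      unfolding * by (simp add: cinner_simps rank_one_symmetric)
  qed
  then have "mean_transform (rank_one (r *\<^sub>C x) y \<bullet>\<^sub>J \<Phi> B) = \<Phi> (rank_one x y \<bullet>\<^sub>J B)"
    using mean_jordan[OF ops_rank_one[of x y] B] by (simp add: r)
  moreover have "\<Phi> (rank_one x y \<bullet>\<^sub>J B) x = (1/2) *\<^sub>C x"
  proof -
    have "reducing (rank_one x y \<bullet>\<^sub>J B) x (1/2)"
      by (simp add: reducing_def jordan_apply B_def rank_one_def cinner_simps inner_xy scaleC_one)
    from reducing_fixed[OF ops_jordan[OF ops_rank_one B] this]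
    show ?thesis using f_nonneg_real[of "1/2"] by (simp add: reducing_def)
  qed
  moreover have "mean_transform (rank_one (r *\<^sub>C x) y \<bullet>\<^sub>J \<Phi> B) x = (r/2) *\<^sub>C x"
  proof -
    have fixB: "\<Phi> B = B"
    proof -
      have "reducing B w 0" if "cinner w x = 0" "cinner w y = 0" for w
        using that cinner_0_commute[of w x] cinner_0_commute[of w y]
        by (simp add: reducing_def B_def rank_one_def cinner_simps)
      then have "\<Phi> B z = cinner z x *\<^sub>C \<Phi> B x + cinner z y *\<^sub>C \<Phi> B y" for z
        by (intro matrix_form(3)[OF \<Phi>B xy] carried_image[OF B, of x y])
      then have "\<Phi> B z = rank_one y x z + rank_one x y z" for z by (simp only: Bxy rank_one_def)
      then show ?thesis unfolding B_def by (intro ext) (simp only: add.commute)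
    qed
    have "rank_one (r *\<^sub>C x) y \<bullet>\<^sub>J B = (\<lambda>z. r *\<^sub>C (rank_one x y \<bullet>\<^sub>J B) z)"
      by (rule ext) (simp add: jordan_apply rank_one_scale_left op_scaleC[OF B]
          scaleC_add_right mult.commute)
    then show ?thesis
      unfolding fixB
      by (simp add: mean_scaleC[OF ops_jordan[OF ops_rank_one B]]
          \<open>mean_transform (rank_one x y \<bullet>\<^sub>J B) = rank_one x y \<bullet>\<^sub>J B\<close>)
        (simp add: jordan_apply B_def rank_one_def cinner_simps inner_xy)
  qed
  ultimately have "(r/2) *\<^sub>C x = (1/2) *\<^sub>C x" by simp
  then have "r/2 = 1/2" using xy(1) by (simp only: complex_vector.scale_cancel_right) auto
  then show ?thesis using r by (simp add: scaleC_one)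
qed

end

text \<open>
  For \<open>|t| = 1\<close> the operator \<open>(tx) \<otimes> y\<close> is again a nilpotent operator formed from an orthonormal pair, hence
  fixed; this gives \<open>f(t) = t\<close>.
\<close>

lemma f_identity: "f \<alpha> = \<alpha>"
proof (cases "\<alpha> = 0")
  case True
  then show ?thesis by (simp add: f0)
next
  case False
  obtain y :: 'h where y: "norm y = 1" using unit_ex by blast
  obtain x where x: "norm x = 1" "cinner x y = 0" using orthogonal_ex cinner_0_commute by blast
  have unimodular: "f t = t" if t: "cmod t = 1" for t
  proof -
    have "\<Phi> (rank_one (t *\<^sub>C x) y) = rank_one (t *\<^sub>C x) y"
      by (rule nilpotent_fixed) (simp_all add: t x y cinner_simps)
    then have "f t *\<^sub>C rank_one x y y = t *\<^sub>C rank_one x y y"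
      using scale_rank_one[of t x y y] nilpotent_fixed[OF x(1) y x(2)] by (auto simp: rank_one_scale_left)
    moreover have "rank_one x y y \<noteq> 0" using x y by (auto simp: rank_one_def cinner_self)
    ultimately show ?thesis by auto
  qed
  have "\<alpha> = complex_of_real (cmod \<alpha>) * (\<alpha> / complex_of_real (cmod \<alpha>))" using False by simp
  moreover have "f (complex_of_real (cmod \<alpha>) * (\<alpha> / complex_of_real (cmod \<alpha>))) =
      complex_of_real (cmod \<alpha>) * (\<alpha> / complex_of_real (cmod \<alpha>))"
    unfolding fmult using False by (subst f_nonneg_real, simp, subst unimodular) (simp_all add: norm_divide)
  ultimately show ?thesis by metis
qed

text \<open>
  The Jordan product with the projection onto \<open>\<complex>x\<close> determines all matrix entries of the image but one,
  and the remaining one is found from \<open>T\<^sup>2 = T\<close>.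
\<close>

lemma idempotent_fixed:
  assumes xy: "norm x = 1" "norm y = 1" "cinner x y = 0"
  shows "\<Phi> (rank_one (t *\<^sub>C x + y) y) = rank_one (t *\<^sub>C x + y) y"
proof -
  note inner = inner_xy[OF xy]
  define T where "T = rank_one (t *\<^sub>C x + y) y"
  define X where "X = \<Phi> T"
  have T: "T \<in> bounded_ops" unfolding T_def by (rule ops_rank_one)
  have X: "X \<in> bounded_ops" unfolding X_def by (rule ops[OF T])
  have carried: "reducing X w 0" if "cinner w x = 0" "cinner w y = 0" for w
    unfolding X_def T_def
    by (rule carried_image[OF ops_rank_one _ that])
      (use carried_span[OF xy, of _ t 1] in \<open>simp add: scaleC_one\<close>)
  note form = matrix_form[OF X xy carried]
  have "mean_transform (X \<bullet>\<^sub>J proj x) = rank_one ((t/4) *\<^sub>C x) y"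
    unfolding X_def T_def idempotent_image_mean[OF xy]
    by (rule ext) (simp add: scale_rank_one nilpotent_fixed[OF xy] f_identity, simp add: rank_one_def mult.commute)
  from mean_eq_rank_one_imp[OF ops_jordan[OF X ops_rank_one] this]
  have *: "X \<bullet>\<^sub>J proj x = rank_one ((t/2) *\<^sub>C x) y" by (simp add: cinner_simps inner)
  have at: "cinner z x *\<^sub>C X x + cinner (X z) x *\<^sub>C x = (cinner z y * t) *\<^sub>C x" for z
  proof -
    have "2 *\<^sub>C (X \<bullet>\<^sub>J proj x) z = (cinner z y * t) *\<^sub>C x" unfolding * by (simp add: rank_one_def)
    then show ?thesis by (simp add: jordan_rank_one_apply[OF X])
  qed
  have Xxx: "X x + cinner (X x) x *\<^sub>C x = 0" using at[of x] by (simp add: inner scaleC_one)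
  then have "cinner (X x + cinner (X x) x *\<^sub>C x) x = 0" by simp
  then have "cinner (X x) x = 0" by (simp add: cinner_simps inner)
  then have Xx: "X x = 0" using Xxx by simp
  have "cinner (X y) x *\<^sub>C x = t *\<^sub>C x" using at[of y] by (simp add: inner)
  then have "cinner (X y) x = t" using xy(1) by (simp only: complex_vector.scale_cancel_right) auto
  then obtain a where Xy: "X y = t *\<^sub>C x + a *\<^sub>C y" using form(2) by simp
  have X_eq: "X = rank_one (t *\<^sub>C x + a *\<^sub>C y) y"
  proof
    show "X z = rank_one (t *\<^sub>C x + a *\<^sub>C y) y z" for z
      using form(3)[of z] by (simp add: Xx Xy rank_one_def)
  qed
  have "X \<bullet>\<^sub>J X = (\<lambda>z. a *\<^sub>C X z)"
    unfolding jordan_self X_eq by (rule ext) (simp add: rank_one_def cinner_simps inner mult.commute)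
  then have "mean_transform (X \<bullet>\<^sub>J X) = (\<lambda>z. a *\<^sub>C mean_transform X z)"
    using mean_scaleC[OF X] by simp
  moreover have "T \<bullet>\<^sub>J T = T"
    unfolding jordan_self T_def by (rule ext) (simp add: rank_one_def cinner_simps inner)
  ultimately have "a *\<^sub>C mean_transform X z = mean_transform X z" for z
    using mean_jordan[OF T T] mean_commute[OF T] by (simp add: X_def fun_eq_iff)
  moreover have "\<exists>z. mean_transform X z \<noteq> 0"
  proof (rule ccontr)
    assume "\<not> ?thesis"
    then have "X = (\<lambda>z. 0)" using mean_kernel[OF X] by (intro ext) simp
    then have "T = (\<lambda>z. 0)" using eq_zero[OF T] X_def by simp
    then have "t *\<^sub>C x + y = 0" using xy(2) by (auto simp: T_def rank_one_zero_iff)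
    then have "cinner (t *\<^sub>C x + y) y = 0" by simp
    then show False by (simp add: cinner_simps inner)
  qed
  ultimately have "a = 1" by (metis complex_vector.scale_cancel_right scaleC_one)
  then show ?thesis using X_eq by (simp add: X_def T_def scaleC_one)
qed

text \<open>
  Up to a scalar factor, \<open>a \<otimes> b\<close> is either \<open>x \<otimes> y\<close> or \<open>(tx + y) \<otimes> y\<close> for an orthonormal pair \<open>x, y\<close> with
  \<open>y\<close> proportional to \<open>b\<close>.
\<close>

lemma rank_one_fixed: "\<Phi> (rank_one a b) = rank_one a b"
proof (cases "b = 0")
  case True
  then have "rank_one a b = (\<lambda>z. 0)" by (simp add: rank_one_zero_iff)
  then show ?thesis by (simp add: zero)
next
  case False
  define y where "y = complex_of_real (1 / norm b) *\<^sub>C b"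
  have y: "norm y = 1" using False by (simp add: y_def norm_divide)
  have b: "b = complex_of_real (norm b) *\<^sub>C y" using False by (simp add: y_def scaleC_one)
  define w where "w = a - cinner a y *\<^sub>C y"
  have wy: "cinner w y = 0" by (simp add: w_def cinner_simps cinner_self y)
  obtain x \<beta> where x: "norm x = 1" "cinner x y = 0" and w: "w = \<beta> *\<^sub>C x"
  proof (cases "w = 0")
    case True
    obtain x where "norm x = 1" "cinner x y = 0" using orthogonal_ex cinner_0_commute by blast
    then show ?thesis using that[of x 0] True by simp
  next
    case False
    show ?thesis
      by (rule that[of "complex_of_real (1 / norm w) *\<^sub>C w" "complex_of_real (norm w)"])
        (use False wy in \<open>simp_all add: norm_divide cinner_simps scaleC_one\<close>)
  qed
  have a: "a = \<beta> *\<^sub>C x + cinner a y *\<^sub>C y" using w by (simp add: w_def algebra_simps)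
  have scale: "\<Phi> (rank_one (c *\<^sub>C v) y) = rank_one (c *\<^sub>C v) y" if "\<Phi> (rank_one v y) = rank_one v y" for c v
    by (rule ext) (simp add: scale_rank_one f_identity that, simp add: rank_one_scale_left)
  have ay: "\<Phi> (rank_one a y) = rank_one a y"
  proof (cases "cinner a y = 0")
    case True
    then show ?thesis using scale[OF nilpotent_fixed[OF x(1) y x(2)]] a by simp
  next
    case False
    then have "a = cinner a y *\<^sub>C ((\<beta> / cinner a y) *\<^sub>C x + y)"
      using a by (simp add: scaleC_add_right)
    then show ?thesis using scale[OF idempotent_fixed[OF x(1) y x(2)]] by metis
  qed
  have "rank_one a b = rank_one (complex_of_real (norm b) *\<^sub>C a) y"
    by (subst b) (simp add: rank_one_def fun_eq_iff cinner_simps mult.commute)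
  then show ?thesis using scale[OF ay] by simp
qed

section \<open>From rank one to all operators\<close>

text \<open>
  The number \<open>\<langle>Ax, y\<rangle>\<close> is the trace of \<open>Y = A \<circ> (x \<otimes> y)\<close>. As the mean transform preserves the trace, it is
  preserved by \<open>\<Phi>\<close> as soon as the mean transform of \<open>Y\<close> is known to be fixed.
\<close>

lemma matrix_element_image:
  assumes A: "A \<in> bounded_ops"
    and fixed: "\<Phi> (mean_transform (A \<bullet>\<^sub>J rank_one x y)) = mean_transform (A \<bullet>\<^sub>J rank_one x y)"
  shows "cinner (\<Phi> A x) y = cinner (A x) y"
proof -
  have "mean_transform (\<Phi> A \<bullet>\<^sub>J rank_one x y) = mean_transform (A \<bullet>\<^sub>J rank_one x y)"
    using mean_jordan[OF A ops_rank_one[of x y]] fixed by (simp add: rank_one_fixed)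
  moreover have "has_trace (mean_transform (B \<bullet>\<^sub>J rank_one x y)) (cinner (B x) y)"
    if "B \<in> bounded_ops" for B
    by (intro has_trace_mean ops_jordan jordan_rank_one_trace that ops_rank_one)
  ultimately show ?thesis using has_trace_unique A ops[OF A] by metis
qed

text \<open>
  If \<open>Au = \<alpha>u\<close>, then \<open>A \<circ> (u \<otimes> y)\<close> is of the form \<open>u \<otimes> v\<close>. So its mean transform has rank at most one and is
  fixed.
\<close>

lemma eigenvector_image:
  assumes A: "A \<in> bounded_ops" and eig: "A u = \<alpha> *\<^sub>C u"
  shows "\<Phi> A u = \<alpha> *\<^sub>C u"
proof (rule cinner_ext)
  fix y
  define v where "v = (1/2) *\<^sub>C (cnj \<alpha> *\<^sub>C y + cadjoint A y)"
  have "A \<bullet>\<^sub>J rank_one u y = rank_one u v"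
    by (rule ext, simp add: jordan_rank_one_apply[OF A] eig)
      (simp add: rank_one_def v_def cinner_simps cinner_cadjoint[OF A] scaleC_add_left scaleC_add_right ac_simps)
  then have "mean_transform (A \<bullet>\<^sub>J rank_one u y) = rank_one ((1/2) *\<^sub>C (u + (cinner u v / (norm v)\<^sup>2) *\<^sub>C v)) v"
    by (simp add: mean_rank_one)
  then have "\<Phi> (mean_transform (A \<bullet>\<^sub>J rank_one u y)) = mean_transform (A \<bullet>\<^sub>J rank_one u y)"
    by (simp add: rank_one_fixed)
  from matrix_element_image[OF A this] show "cinner (\<Phi> A u) y = cinner (\<alpha> *\<^sub>C u) y" by (simp add: eig)
qed

lemma diagonalizable_fixed:
  assumes Y: "Y \<in> bounded_ops"
    and diag: "\<And>z. \<exists>u v w \<alpha> \<beta>. z = u + v + w \<and> Y u = \<alpha> *\<^sub>C u \<and> Y v = \<beta> *\<^sub>C v \<and> Y w = 0"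
  shows "\<Phi> Y = Y"
proof
  fix z
  obtain u v w \<alpha> \<beta> where z: "z = u + v + w" and eig: "Y u = \<alpha> *\<^sub>C u" "Y v = \<beta> *\<^sub>C v" "Y w = 0"
    using diag[of z] by blast
  have "\<Phi> Y u = Y u" "\<Phi> Y v = Y v" "\<Phi> Y w = Y w"
    using eigenvector_image[OF Y eig(1)] eigenvector_image[OF Y eig(2)] eigenvector_image[OF Y, of w 0] eig
    by simp_all
  then show "\<Phi> Y z = Y z" by (simp add: z op_add Y ops[OF Y])
qed

text \<open>
  The operator \<open>Y = A \<circ> (x \<otimes> y)\<close> has its range in the span of \<open>x\<close> and \<open>Ax\<close>. With \<open>n = \<langle>x, y\<rangle>\<close>,
  \<open>p = \<langle>Ax, y\<rangle>\<close>, \<open>s = \<langle>A\<^sup>2x, y\<rangle>\<close> and \<open>k\<^sup>2 = ns\<close> the vectors \<open>kx \<plusminus> nAx\<close> are eigenvectors with eigenvalues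
  \<open>(p \<plusminus> k)/2\<close>.
\<close>

lemma matrix_element_generic:
  fixes x y :: 'h
  assumes A: "A \<in> bounded_ops"
  defines "n \<equiv> cinner x y" and "p \<equiv> cinner (A x) y" and "s \<equiv> cinner (A (A x)) y"
  assumes ns: "n * s \<noteq> 0" and p: "(p)\<^sup>2 \<noteq> n * s"
  shows "cinner (\<Phi> A x) y = cinner (A x) y"
proof -
  define Y where "Y = A \<bullet>\<^sub>J rank_one x y"
  have Y: "Y \<in> bounded_ops" unfolding Y_def by (rule ops_jordan[OF A ops_rank_one])
  have Yz: "Y z = (1/2) *\<^sub>C (cinner z y *\<^sub>C A x + cinner (A z) y *\<^sub>C x)" for z
    by (simp add: Y_def jordan_rank_one_apply[OF A])
  define k where "k = csqrt (n * s)"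
  have kk: "k * k = n * s" using power2_csqrt[of "n * s"] by (simp add: k_def power2_eq_square)
  have nz: "k \<noteq> 0" "n \<noteq> 0" using kk ns by auto
  have pk: "p + k \<noteq> 0" "p - k \<noteq> 0"
    using p kk by (auto simp: power2_eq_square add_eq_0_iff2)
  define u v where "u = k *\<^sub>C x + n *\<^sub>C A x" and "v = k *\<^sub>C x - n *\<^sub>C A x"
  have Yx: "Y x = (n / 2) *\<^sub>C A x + (p / 2) *\<^sub>C x"
    by (simp add: Yz n_def p_def scaleC_add_right)
  have YAx: "Y (A x) = (p / 2) *\<^sub>C A x + (s / 2) *\<^sub>C x"
    by (simp add: Yz s_def p_def scaleC_add_right)
  have Yu: "Y u = ((p + k) / 2) *\<^sub>C u"
  proof -
    have "Y u = ((p * k + n * s) / 2) *\<^sub>C x + (n * (p + k) / 2) *\<^sub>C A x"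
      by (simp add: u_def op_simps Y Yx YAx scaleC_add_right scaleC_add_left algebra_simps add_divide_distrib)
    also have "(p * k + n * s) / 2 = (p + k) / 2 * k" by (simp add: algebra_simps flip: kk)
    finally show ?thesis by (simp add: u_def scaleC_add_right mult.commute)
  qed
  have Yv: "Y v = ((p - k) / 2) *\<^sub>C v"
  proof -
    have "Y v = ((p * k - n * s) / 2) *\<^sub>C x - (n * (p - k) / 2) *\<^sub>C A x"
      by (simp add: v_def op_simps Y Yx YAx scaleC_add_right complex_vector.scale_left_diff_distrib
          complex_vector.scale_right_diff_distrib algebra_simps diff_divide_distrib)
    also have "(p * k - n * s) / 2 = (p - k) / 2 * k" by (simp add: algebra_simps flip: kk)
    finally show ?thesis by (simp add: v_def complex_vector.scale_right_diff_distrib mult.commute)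
  qed
  have "\<Phi> Y = Y"
  proof (rule diagonalizable_fixed[OF Y])
    fix z
    define a b where "a = (cinner (A z) y / k + cinner z y / n) / 4"
      and "b = (cinner (A z) y / k - cinner z y / n) / 4"
    have abk: "(a + b) * k = cinner (A z) y / 2" "(a - b) * n = cinner z y / 2"
      using nz by (simp_all add: a_def b_def field_simps)
    have "a *\<^sub>C u + b *\<^sub>C v = ((a + b) * k) *\<^sub>C x + ((a - b) * n) *\<^sub>C A x"
      by (simp add: u_def v_def scaleC_add_right scaleC_add_left complex_vector.scale_left_diff_distrib
          complex_vector.scale_right_diff_distrib algebra_simps)
    then have Yab: "Y z = a *\<^sub>C u + b *\<^sub>C v"
      unfolding abk by (simp add: Yz scaleC_add_right add.commute)
    define u' v' where "u' = (2 * a / (p + k)) *\<^sub>C u" and "v' = (2 * b / (p - k)) *\<^sub>C v"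
    have "Y u' = a *\<^sub>C u" "Y v' = b *\<^sub>C v"
      using pk by (simp_all add: u'_def v'_def op_scaleC Y Yu Yv)
    then have "Y (z - u' - v') = 0" by (simp add: op_diff Y Yab)
    moreover have "Y u' = ((p + k) / 2) *\<^sub>C u'" "Y v' = ((p - k) / 2) *\<^sub>C v'"
      by (simp_all add: u'_def v'_def op_scaleC Y Yu Yv mult.commute)
    moreover have "z = u' + v' + (z - u' - v')" by simp
    ultimately show "\<exists>u v w \<alpha> \<beta>. z = u + v + w \<and> Y u = \<alpha> *\<^sub>C u \<and> Y v = \<beta> *\<^sub>C v \<and> Y w = 0" by blast
  qed
  then have "\<Phi> (mean_transform Y) = mean_transform Y" by (simp add: mean_commute Y)
  then show ?thesis unfolding Y_def by (rule matrix_element_image[OF A])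
qed

text \<open>
  In this degenerate case, with \<open>n = s = 0\<close>, the operator \<open>Y\<close> acts on the span of \<open>x\<close> and \<open>Ax\<close> as the scalar
  \<open>p/2\<close>.
\<close>

lemma matrix_element_square_zero:
  assumes A: "A \<in> bounded_ops" and AA: "A (A x) = 0" and "cinner x y = 0" "cinner (A x) y \<noteq> 0"
  shows "cinner (\<Phi> A x) y = cinner (A x) y"
proof -
  define Y where "Y = A \<bullet>\<^sub>J rank_one x y"
  have Y: "Y \<in> bounded_ops" unfolding Y_def by (rule ops_jordan[OF A ops_rank_one])
  define p where "p = cinner (A x) y"
  have Yz: "Y z = (cinner z y / 2) *\<^sub>C A x + (cinner (A z) y / 2) *\<^sub>C x" for z
    by (simp add: Y_def jordan_rank_one_apply[OF A] scaleC_add_right)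
  have Yx: "Y x = (p / 2) *\<^sub>C x" "Y (A x) = (p / 2) *\<^sub>C A x"
    by (simp_all add: Yz assms(3) AA p_def)
  have "\<Phi> Y = Y"
  proof (rule diagonalizable_fixed[OF Y])
    fix z
    define u v where "u = (cinner z y / p) *\<^sub>C A x" and "v = (cinner (A z) y / p) *\<^sub>C x"
    have uv: "Y u = (p / 2) *\<^sub>C u" "Y v = (p / 2) *\<^sub>C v"
      by (simp_all add: u_def v_def op_scaleC Y Yx mult.commute)
    have "Y (z - u - v) = 0"
      using assms(4) by (simp add: op_diff Y uv) (simp add: Yz u_def v_def flip: p_def)
    moreover have "z = u + v + (z - u - v)" by simp
    ultimately show "\<exists>u v w \<alpha> \<beta>. z = u + v + w \<and> Y u = \<alpha> *\<^sub>C u \<and> Y v = \<beta> *\<^sub>C v \<and> Y w = 0"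
      using uv by blast
  qed
  then have "\<Phi> (mean_transform Y) = mean_transform Y" by (simp add: mean_commute Y)
  then show ?thesis unfolding Y_def by (rule matrix_element_image[OF A])
qed

end

text \<open>
  Functions that are polynomial along real lines form an algebra without zero divisors. So finitely many
  conditions \<open>q(y) \<noteq> 0\<close>, each of which can be satisfied, can be satisfied simultaneously. Real
  lines are needed since the inner product is conjugate-linear in \<open>y\<close>.
\<close>

definition line_polynomial :: "('a::real_vector \<Rightarrow> complex) \<Rightarrow> bool" where
  "line_polynomial q \<longleftrightarrow> (\<forall>a b. \<exists>r. \<forall>t::real. q (a + t *\<^sub>R b) = poly r (of_real t))"

lemma line_polynomial_cinner: "line_polynomial (\<lambda>y::'a::complex_hilbert. cinner v y)"
  unfolding line_polynomial_def
proof (intro allI)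
  fix a b :: 'a
  show "\<exists>r. \<forall>t::real. cinner v (a + t *\<^sub>R b) = poly r (of_real t)"
    by (rule exI[of _ "[:cinner v a, cinner v b:]"]) (simp add: cinner_simps)
qed

lemma line_polynomial_mult:
  assumes "line_polynomial q" "line_polynomial r" shows "line_polynomial (\<lambda>y. q y * r y)"
  using assms unfolding line_polynomial_def by (metis poly_mult)

lemma line_polynomial_diff:
  assumes "line_polynomial q" "line_polynomial r" shows "line_polynomial (\<lambda>y. q y - r y)"
  using assms unfolding line_polynomial_def by (metis poly_diff)

lemma line_polynomial_nonzero_mult:
  assumes "line_polynomial q" "line_polynomial r" "\<exists>y. q y \<noteq> 0" "\<exists>y. r y \<noteq> 0"
  shows "\<exists>y. q y * r y \<noteq> 0"
proof (rule ccontr)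
  assume "\<not> ?thesis"
  then have prod0: "q y * r y = 0" for y by blast
  obtain a b where a: "q a \<noteq> 0" and b: "r b \<noteq> 0" using assms by blast
  obtain Q where Q: "\<And>t::real. q (a + t *\<^sub>R (b - a)) = poly Q (of_real t)"
    using assms(1) unfolding line_polynomial_def by metis
  obtain R where R: "\<And>t::real. r (a + t *\<^sub>R (b - a)) = poly R (of_real t)"
    using assms(2) unfolding line_polynomial_def by metis
  have "poly (Q * R) (complex_of_real t) = 0" for t
    using prod0[of "a + t *\<^sub>R (b - a)"] by (simp add: Q R)
  then have "range complex_of_real \<subseteq> {z. poly (Q * R) z = 0}" by auto
  moreover have "infinite (range complex_of_real)"
    by (metis finite_imageD infinite_UNIV_char_0 inj_of_real)
  ultimately have "Q * R = 0" using poly_roots_finite[of "Q * R"] finite_subset by blast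
  then show False using Q[of 0] R[of 1] a b by auto
qed

context fixes_projections
begin

text \<open>
  If \<open>\<Phi>(A)x \<noteq> Ax\<close>, some \<open>y\<close> in general position would distinguish the two vectors. For an eigenvector \<open>x\<close> no
  such \<open>y\<close> exists, as \<open>p\<^sup>2 = ns\<close> identically, but this case is already settled. Otherwise the component of \<open>Ax\<close>
  orthogonal to \<open>x\<close> is a vector \<open>y\<close> with \<open>n = 0 \<noteq> p\<close>.
\<close>

lemma fixed_at:
  assumes A: "A \<in> bounded_ops" and AA: "A (A x) \<noteq> 0"
  shows "\<Phi> A x = A x"
proof (cases "\<exists>\<alpha>. A x = \<alpha> *\<^sub>C x")
  case True
  then show ?thesis using eigenvector_image[OF A] by auto
next
  case False
  have x: "x \<noteq> 0" using AA by (auto simp: op_zero A)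
  let ?w = "\<Phi> A x - A x"
  let ?q = "\<lambda>y. cinner (A x) y * cinner (A x) y - cinner x y * cinner (A (A x)) y"
  show ?thesis
  proof (rule ccontr)
    assume "\<Phi> A x \<noteq> A x"
    then have w: "?w \<noteq> 0" by simp
    have ex: "\<exists>y. cinner v y \<noteq> 0" if "v \<noteq> 0" for v :: 'h
      by (rule exI[of _ v]) (use that in simp)
    have "\<exists>y. ?q y \<noteq> 0"
    proof -
      define y where "y = A x - (cinner (A x) x / (norm x)\<^sup>2) *\<^sub>C x"
      have "y \<noteq> 0" using False by (auto simp: y_def)
      have yx: "cinner y x = 0" unfolding y_def by (rule component_orthogonal[OF x])
      then have xy: "cinner x y = 0" using cinner_0_commute by blast
      have "A x = y + (cinner (A x) x / (norm x)\<^sup>2) *\<^sub>C x" by (simp add: y_def)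
      then have "cinner (A x) y = cinner y y" using xy by (metis cinner_add_left cinner_scaleC_left add.right_neutral mult_zero_right)
      then show ?thesis using \<open>y \<noteq> 0\<close> xy by (intro exI[of _ y]) simp
    qed
    note lp = line_polynomial_mult line_polynomial_diff line_polynomial_cinner
    have "\<exists>y. ?q y * (cinner ?w y * (cinner x y * cinner (A (A x)) y)) \<noteq> 0"
      by (intro line_polynomial_nonzero_mult lp ex w x AA \<open>\<exists>y. ?q y \<noteq> 0\<close>)
    then obtain y where y: "?q y \<noteq> 0" "cinner ?w y \<noteq> 0" "cinner x y * cinner (A (A x)) y \<noteq> 0" by auto
    then have "cinner (\<Phi> A x) y = cinner (A x) y"
      by (intro matrix_element_generic[OF A]) (simp_all add: power2_eq_square)
    then show False using y(2) by (simp add: cinner_simps)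
  qed
qed

text \<open>
  The matrix elements only give \<open>\<Phi>(A)x = Ax + \<gamma>x\<close>. But \<open>\<Phi>(A)\<close> has square zero as well and annihilates
  \<open>Ax\<close>, so that \<open>\<gamma>(Ax + \<gamma>x) = 0\<close>.
\<close>

lemma square_zero_fixed:
  assumes A: "A \<in> bounded_ops" and AA: "\<And>x. A (A x) = 0"
  shows "\<Phi> A x = A x"
proof (cases "A x = 0")
  case True
  then show ?thesis using eigenvector_image[OF A, of x 0] by simp
next
  case False
  have x: "x \<noteq> 0" using False by (auto simp: op_zero A)
  let ?w = "\<Phi> A x - A x"
  define z where "z = A x - (cinner (A x) x / (norm x)\<^sup>2) *\<^sub>C x"
  have not_eig: "A x \<noteq> \<alpha> *\<^sub>C x" for \<alpha>
  proof
    assume eig: "A x = \<alpha> *\<^sub>C x"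
    then have "\<alpha> *\<^sub>C A x = 0" using AA[of x] by (simp add: op_scaleC A)
    then show False using False eig by auto
  qed
  have "cinner z x = 0" unfolding z_def by (rule component_orthogonal[OF x])
  then have xz: "cinner x z = 0" using cinner_0_commute by blast
  have "A x = z + (cinner (A x) x / (norm x)\<^sup>2) *\<^sub>C x" by (simp add: z_def)
  then have "cinner (A x) z = cinner z z"
    using xz by (metis cinner_add_left cinner_scaleC_left add.right_neutral mult_zero_right)
  then have Axz: "cinner (A x) z \<noteq> 0" using not_eig by (auto simp: z_def)
  have zero_on: "cinner ?w y = 0" if "cinner x y = 0" "cinner (A x) y \<noteq> 0" for y
    using matrix_element_square_zero[OF A AA that] by (simp add: cinner_simps)
  have orth: "cinner ?w y = 0" if y: "cinner x y = 0" for y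
  proof (cases "cinner (A x) y = 0")
    case True
    have "cinner ?w (y + z) = 0" by (rule zero_on) (use True y xz Axz in \<open>simp_all add: cinner_simps\<close>)
    then show ?thesis using zero_on[OF xz Axz] by (simp add: cinner_add_right)
  next
    case False
    then show ?thesis by (rule zero_on[OF y])
  qed
  define \<gamma> where "\<gamma> = cinner ?w x / (norm x)\<^sup>2"
  have "?w = \<gamma> *\<^sub>C x"
  proof -
    define d where "d = ?w - \<gamma> *\<^sub>C x"
    have "cinner d x = 0" unfolding d_def \<gamma>_def by (rule component_orthogonal[OF x])
    then have xd: "cinner x d = 0" using cinner_0_commute by blast
    then have "cinner ?w d = 0" by (rule orth)
    then have "cinner d d = 0" using xd by (subst (1) d_def) (simp add: cinner_diff_left cinner_scaleC_left)
    then show ?thesis by (simp add: d_def)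
  qed
  then have \<Phi>A: "\<Phi> A x = A x + \<gamma> *\<^sub>C x" by (simp add: algebra_simps)
  have "\<Phi> A (A x) = 0" using eigenvector_image[OF A, of "A x" 0] AA by simp
  moreover have "\<Phi> A (\<Phi> A x) = 0" by (rule square_zero[OF A AA])
  ultimately have "\<gamma> *\<^sub>C (A x + \<gamma> *\<^sub>C x) = 0"
    using \<Phi>A by (simp add: op_simps ops[OF A])
  moreover have "A x + \<gamma> *\<^sub>C x \<noteq> 0" using not_eig[of "- \<gamma>"] by (auto simp: add_eq_0_iff2)
  ultimately have "\<gamma> = 0" by simp
  then show ?thesis using \<Phi>A by simp
qed

text \<open>
  If \<open>A\<^sup>2 \<noteq> 0\<close>, every vector is a difference of vectors not annihilated by \<open>A\<^sup>2\<close>.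
\<close>

theorem all_fixed:
  assumes A: "A \<in> bounded_ops" shows "\<Phi> A = A"
proof
  fix x
  show "\<Phi> A x = A x"
  proof (cases "\<exists>z. A (A z) \<noteq> 0")
    case False
    then show ?thesis by (intro square_zero_fixed[OF A]) blast
  next
    case True
    then obtain z where z: "A (A z) \<noteq> 0" by blast
    show ?thesis
    proof (cases "A (A x) = 0")
      case False
      then show ?thesis by (rule fixed_at[OF A])
    next
      case AAx: True
      have "A (A (x + z)) \<noteq> 0" using z AAx by (simp add: op_add A)
      from fixed_at[OF A this] fixed_at[OF A z] show ?thesis by (simp add: op_add A ops[OF A])
    qed
  qed
qed

end

section \<open>The characterisation\<close>

lemma orthogonal_unit_vector:
  fixes u :: "'a::complex_hilbert"
  assumes "cdim TYPE('a) \<ge> 3"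
  shows "\<exists>v. norm v = 1 \<and> cinner u v = 0"
proof -
  have "\<exists>x. x \<notin> complex_vector.span {u}"
  proof (rule ccontr)
    assume "\<not> ?thesis"
    then have span: "complex_vector.span {u} = UNIV" by blast
    have "complex_vector.dim (UNIV :: 'a set) \<le> card {u}"
      by (rule complex_vector.dim_le_card) (simp_all add: span)
    then have "complex_vector.dim (UNIV :: 'a set) \<le> 1" by simp
    moreover have "cdim TYPE('a) = enat (complex_vector.dim (UNIV :: 'a set))"
      unfolding cdim_def using span by (intro if_P exI[of _ "{u}"]) simp
    ultimately show False using assms by (simp add: numeral_eq_enat)
  qed
  then obtain x where x: "x \<notin> complex_vector.span {u}" ..
  define v where "v = x - (cinner x u / (norm u)\<^sup>2) *\<^sub>C u"
  have "v \<noteq> 0"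
  proof
    assume "v = 0"
    then have "x = (cinner x u / (norm u)\<^sup>2) *\<^sub>C u" by (simp add: v_def)
    then show False
      using x complex_vector.span_scale[OF complex_vector.span_base[of u "{u}"]] by (metis singletonI)
  qed
  have "cinner v u = 0"
    unfolding v_def by (cases "u = 0") (simp, rule component_orthogonal)
  then have "cinner u v = 0" using cinner_0_commute by blast
  then show ?thesis
    using \<open>v \<noteq> 0\<close>
    by (intro exI[of _ "complex_of_real (1 / norm v) *\<^sub>C v"]) (simp add: norm_divide cinner_simps)
qed

theorem theorem1p1:
  fixes \<Phi> :: "('h::complex_hilbert \<Rightarrow> 'h) \<Rightarrow> ('k::complex_hilbert \<Rightarrow> 'k)"
  assumes "cdim TYPE('h) \<ge> 3"
    and "bij_betw \<Phi> bounded_ops bounded_ops"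
  shows "(\<forall>A\<in>bounded_ops. \<forall>B\<in>bounded_ops.
            mean_transform (\<Phi> A \<bullet>\<^sub>J \<Phi> B) = \<Phi> (mean_transform (A \<bullet>\<^sub>J B)))
         \<longleftrightarrow>
         (\<exists>U :: 'h \<Rightarrow> 'k. (unitary_op U \<or> antiunitary_op U) \<and>
            (\<forall>T\<in>bounded_ops. \<Phi> T = U \<circ> T \<circ> inv U))"
proof
  assume "\<exists>U :: 'h \<Rightarrow> 'k. (unitary_op U \<or> antiunitary_op U) \<and>
    (\<forall>T\<in>bounded_ops. \<Phi> T = U \<circ> T \<circ> inv U)"
  then obtain U :: "'h \<Rightarrow> 'k" where U: "symmetry_op U"
    and \<Phi>: "\<And>T. T \<in> bounded_ops \<Longrightarrow> \<Phi> T = conj_by U T"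
    unfolding symmetry_op_def conj_by_def by blast
  show "\<forall>A\<in>bounded_ops. \<forall>B\<in>bounded_ops.
      mean_transform (\<Phi> A \<bullet>\<^sub>J \<Phi> B) = \<Phi> (mean_transform (A \<bullet>\<^sub>J B))"
    by (simp add: \<Phi> ops_mean ops_jordan jordan_conj_by[OF U] mean_conj_by[OF U])
next
  assume eq: "\<forall>A\<in>bounded_ops. \<forall>B\<in>bounded_ops.
    mean_transform (\<Phi> A \<bullet>\<^sub>J \<Phi> B) = \<Phi> (mean_transform (A \<bullet>\<^sub>J B))"
  interpret jordan_mean_map_dim2 \<Phi>
    using assms(2) eq orthogonal_unit_vector[OF assms(1)] by unfold_locales blast+
  obtain U where U: "symmetry_op U" and proj: "\<And>u. norm u = 1 \<Longrightarrow> \<Phi> (proj u) = proj (U u)"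
    using symmetry_ex by blast
  note inv_U = symmetry_inv[OF U]
  define \<Psi> where "\<Psi> T = conj_by (inv U) (\<Phi> T)" for T
  have bij_conj: "bij_betw (conj_by (inv U)) bounded_ops bounded_ops"
    by (rule bij_betw_byWitness[of _ "conj_by U"])
      (auto simp: conj_by_inv[OF U] ops_conj_by[OF U] ops_conj_by[OF inv_U])
  interpret normal: fixes_projections \<Psi>
  proof unfold_locales
    show "bij_betw \<Psi> bounded_ops bounded_ops"
      using bij_betw_trans[OF bij bij_conj] by (simp add: \<Psi>_def[abs_def] comp_def)
    show "mean_transform (\<Psi> A \<bullet>\<^sub>J \<Psi> B) = \<Psi> (mean_transform (A \<bullet>\<^sub>J B))"
      if "A \<in> bounded_ops" "B \<in> bounded_ops" for A B
      using that
      by (simp add: \<Psi>_def jordan_conj_by[OF inv_U] mean_conj_by[OF inv_U] ops_jordan ops mean_jordan)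
    show "\<exists>v. norm v = 1 \<and> cinner u v = 0" for u :: 'h by (rule orthogonal_ex)
    show "\<Psi> (proj u) = proj u" if "norm u = 1" for u
      using that by (simp add: \<Psi>_def proj rank_one_conj_by[OF inv_U] symmetry_inv_f[OF U])
  qed
  have "\<Phi> T = conj_by U T" if "T \<in> bounded_ops" for T
    using normal.all_fixed[OF that] conj_by_inv(2)[OF U, of "\<Phi> T"] by (simp add: \<Psi>_def)
  then show "\<exists>U :: 'h \<Rightarrow> 'k. (unitary_op U \<or> antiunitary_op U) \<and>
      (\<forall>T\<in>bounded_ops. \<Phi> T = U \<circ> T \<circ> inv U)"
    using U unfolding symmetry_op_def conj_by_def by blast
qed

end
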